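(* Let $u\in C^\infty(\mathbb R^3;\mathbb R^3)$ be a $D$-solution of the stationary Navier--Stokes equations. Suppose that for some constants $C>0$ and $0<\beta<1$, $$\int_{x_0}^{x}u\cdot d\ell\le C|x-x_0|^{\beta}\qquad\text{for all }x_0,x\in\mathbb R^3 .$$ Then $u\in L^{p,\infty}(\mathbb R^3)$ for every $p>\frac{4-34\beta/29}{1-\beta}$. Moreover, if $\beta<\frac{29}{193}$, then $u\equiv0$.
   Context: A $D$-solution of the stationary Navier--Stokes equations in $\mathbb R^3$ is a smooth vector field $u:\mathbb R^3\to\mathbb R^3$ for which there is a smooth pressure $p:\mathbb R^3\to\mathbb R$ with $-\Delta u+u\cdot\nabla u+\nabla p=0$ and $\operatorname{div}u=0$ on $\mathbb R^3$, such that $\lim_{|x|\to\infty}u(x)=0$ and $\int_{\mathbb R^3}|\nabla u|^2\,dx<\infty$. The line integral $\int_{x_0}^{x}u\cdot d\ell$ is taken along the straight line segment from $x_0$ to $x$, i.e. it equals $\int_0^1 u(x_0+\tau(x-x_0))\cdot(x-x_0)\,d\tau$. $L^{p,\infty}$ is the weak $L^p$ (Lorentz) space. *)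

theory Defs
  imports "HOL-Analysis.Analysis"
begin

definition partial_deriv :: "'n \<Rightarrow> (real^'n \<Rightarrow> 'b) \<Rightarrow> real^'n \<Rightarrow> 'b::real_normed_vector" where
  "partial_deriv i f x = frechet_derivative f (at x) (axis i 1)"

(* frechet_derivative is a choice operator, so differentiability has to be
   required explicitly before the partial derivatives are used. *)
primrec C_k :: "nat \<Rightarrow> (real^'n \<Rightarrow> 'b::real_normed_vector) \<Rightarrow> bool" where
  "C_k 0 f \<longleftrightarrow> continuous_on UNIV f"
| "C_k (Suc k) f \<longleftrightarrow> (\<forall>x. f differentiable (at x)) \<and> (\<forall>i. C_k k (partial_deriv i f))"

definition smooth :: "(real^'n \<Rightarrow> 'b::real_normed_vector) \<Rightarrow> bool" where
  "smooth f \<longleftrightarrow> (\<forall>k. C_k k f)"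

definition gradient :: "(real^'n \<Rightarrow> real) \<Rightarrow> real^'n \<Rightarrow> real^'n" where
  "gradient p x = (\<chi> i. partial_deriv i p x)"

definition divergence :: "(real^'n \<Rightarrow> real^'n) \<Rightarrow> real^'n \<Rightarrow> real" where
  "divergence u x = (\<Sum>i\<in>UNIV. partial_deriv i u x $ i)"

definition laplacian :: "(real^'n \<Rightarrow> 'b::real_normed_vector) \<Rightarrow> real^'n \<Rightarrow> 'b" where
  "laplacian u x = (\<Sum>i\<in>UNIV. partial_deriv i (partial_deriv i u) x)"

definition convection :: "(real^'n \<Rightarrow> real^'n) \<Rightarrow> real^'n \<Rightarrow> real^'n" where
  "convection u x = (\<Sum>i\<in>UNIV. u x $ i *\<^sub>R partial_deriv i u x)"

definition grad_norm_sq :: "(real^'n \<Rightarrow> real^'m) \<Rightarrow> real^'n \<Rightarrow> real" where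
  "grad_norm_sq u x = (\<Sum>i\<in>UNIV. \<Sum>j\<in>UNIV. (partial_deriv i u x $ j)\<^sup>2)"

definition D_solution :: "(real^3 \<Rightarrow> real^3) \<Rightarrow> bool" where
  "D_solution u \<longleftrightarrow>
     smooth u \<and>
     (\<exists>p::real^3 \<Rightarrow> real. smooth p \<and>
        (\<forall>x. - laplacian u x + convection u x + gradient p x = 0)) \<and>
     (\<forall>x. divergence u x = 0) \<and>
     (u \<longlongrightarrow> 0) at_infinity \<and>
     (\<integral>\<^sup>+ x. ennreal (grad_norm_sq u x) \<partial>lborel) < \<infinity>"

definition segment_integral :: "(real^'n \<Rightarrow> real^'n) \<Rightarrow> real^'n \<Rightarrow> real^'n \<Rightarrow> real" where
  "segment_integral u x0 x =
     integral {0..1} (\<lambda>\<tau>. u (x0 + \<tau> *\<^sub>R (x - x0)) \<bullet> (x - x0))"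

(* Intended for 0 < p < \<infinity>; the least admissible C is the weak quasi-norm
   sup over t > 0 of t * |{x. t < |f x|}| powr (1/p). *)
definition weak_Lp :: "real \<Rightarrow> (real^'n \<Rightarrow> 'b::real_normed_vector) \<Rightarrow> bool" where
  "weak_Lp p f \<longleftrightarrow>
     f \<in> borel_measurable lebesgue \<and>
     (\<exists>C\<ge>0. \<forall>t>0. emeasure lebesgue {x. t < norm (f x)} \<le> ennreal ((C / t) powr p))"

end

theory Submission
  imports Defs
begin

text \<open>
The hypothesis, used for a segment and for its reversal, says that the mean of \<open>u\<^sub>i\<close> over a segment
of length \<open>L\<close> in direction \<open>i\<close> is at most \<open>C L\<^bsup>\<beta>-1\<^esup>\<close> in absolute value.  On the other hand, the distance of
\<open>u\<^sub>i\<close> from that mean has \<open>L\<^sup>2\<close> norm at most \<open>L\<close> times that of \<open>\<partial>\<^sub>i u\<^sub>i\<close>, which is finite.  Everything below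
comes from balancing these two facts (lemmas \<open>U_le_average_plus_osc\<close> and \<open>osc_L2\<close>) at a suitable
length \<open>L\<close>.

Decay.  If \<open>C L\<^bsup>\<beta>-1\<^esup>\<close> is a fixed fraction of \<open>t\<close>, then \<open>|u| > t\<close> forces the second contribution to be
comparable to \<open>t\<close>, and Chebyshev's inequality bounds the measure of \<open>{|u| > t}\<close> by a multiple of
\<open>L\<^sup>2 / t\<^sup>2\<close>, that is, of \<open>t\<^bsup>-q\<^esup>\<close> with \<open>q = (4 - 2 \<beta>) / (1 - \<beta>)\<close>.  This \<open>q\<close> is smaller than the exponent in the
theorem, and \<open>u\<close> is bounded, so \<open>u\<close> is in weak \<open>L\<^sup>p\<close> for all \<open>p \<ge> q\<close>.  With \<open>L = R\<^bsup>\<alpha>\<^esup>\<close> and \<open>\<alpha> = 3 / (4 - 2 \<beta>)\<close> the same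
two facts show that the integral of \<open>|u|\<^sup>2\<close> over the cube \<open>[-R,R]\<^sup>3\<close> is at most a multiple of \<open>R\<^bsup>2\<alpha>\<^esup>\<close>
(\<open>local_L2\<close>).

Vanishing.  Let \<open>\<phi>\<close> be a product cutoff of scale \<open>R\<close> and \<open>Q = p + |u|\<^sup>2 / 2\<close> the Bernoulli head.  Testing
the equation with \<open>\<phi> u\<close> gives (\<open>energy_identity\<close>)

  \<open>\<integral> \<phi> |\<nabla>u|\<^sup>2 = \<Sum>\<^sub>i \<integral> Q u\<^sub>i \<partial>\<^sub>i\<phi> - \<Sum>\<^sub>i\<^sub>j \<integral> u\<^sub>i \<partial>\<^sub>ju\<^sub>i \<partial>\<^sub>j\<phi>\<close>,

and the last sum is of order \<open>R\<^bsup>\<alpha>-1\<^esup>\<close>.  The first sum contains the pressure, which is not estimated at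
all.  Instead each \<open>u\<^sub>i \<partial>\<^sub>i\<phi>\<close> is written as the divergence of a field \<open>W\<close> supported in the cube, plus a
multiple \<open>\<kappa>\<^sub>i \<phi>\<close> of the cutoff (\<open>divergence_decomposition\<close>).  The field is built from antiderivatives along
coordinate lines, beginning with direction \<open>i\<close>; there the hypothesis applies and gives
\<open>|W| \<le> const R\<^bsup>\<beta>-1\<^esup>\<close>, while \<open>\<nabla>W\<close> stays bounded in \<open>L\<^sup>2\<close>.  Incompressibility makes the \<open>\<kappa>\<^sub>i\<close> add up to \<open>0\<close>, so
the first sum is an integral of \<open>-\<nabla>Q \<cdot> W\<close>, where \<open>\<nabla>Q = \<Delta>u - (u \<cdot> \<nabla>)u + \<nabla>|u|\<^sup>2 / 2\<close>.  The quadratic terms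
contribute at most \<open>R\<^bsup>\<alpha>\<^esup> R\<^bsup>\<beta>-1\<^esup>\<close>.  The viscous term tends to \<open>0\<close> because a field that tends to \<open>0\<close> uniformly
and has bounded gradient in \<open>L\<^sup>2\<close> has gradient tending weakly to \<open>0\<close> (\<open>weak_convergence_bound\<close>).  Hence
\<open>\<nabla>u = 0\<close> as soon as \<open>\<alpha> + \<beta> < 1\<close>, that is \<open>6 \<beta> - 2 \<beta>\<^sup>2 < 1\<close>, which holds in particular for \<open>\<beta> < 29 / 193\<close>.
\<close>

section \<open>Oriented integrals on the real line\<close>

text \<open>
The oriented integral of \<open>\<phi>\<close> from \<open>a\<close> to \<open>b\<close>.  Writing it over the unit interval makes one formula serve
both orders of the endpoints, makes its dependence on parameters (and on \<open>b\<close>) easy to differentiate, and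
gives exactly the line integral of a vector field along a coordinate segment.
\<close>

definition prim :: "(real \<Rightarrow> real) \<Rightarrow> real \<Rightarrow> real \<Rightarrow> real" where
  "prim \<phi> a b = (b - a) * integral {0..1} (\<lambda>\<tau>. \<phi> (a + \<tau> * (b - a)))"

lemma prim_antiderivative:
  assumes "\<And>x. (\<Psi> has_real_derivative \<phi> x) (at x)"
  shows "prim \<phi> a b = \<Psi> b - \<Psi> a"
proof -
  have "((\<lambda>\<tau>. (b - a) * \<phi> (a + \<tau> * (b - a))) has_integral (\<Psi> (a + 1 * (b - a)) - \<Psi> (a + 0 * (b - a)))) {0..1}"
  proof (rule fundamental_theorem_of_calculus)
    fix \<tau> :: real
    have "((\<lambda>\<tau>. \<Psi> (a + \<tau> * (b - a))) has_real_derivative \<phi> (a + \<tau> * (b - a)) * (b - a)) (at \<tau> within {0..1})"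
      by (rule DERIV_chain'[OF _ assms, THEN DERIV_cong]) (auto intro!: derivative_eq_intros)
    then show "((\<lambda>\<tau>. \<Psi> (a + \<tau> * (b - a))) has_vector_derivative (b - a) * \<phi> (a + \<tau> * (b - a))) (at \<tau> within {0..1})"
      by (simp add: has_real_derivative_iff_has_vector_derivative mult.commute)
  qed simp
  then show ?thesis
    unfolding prim_def by (simp add: integral_unique flip: integral_mult_right)
qed

lemma continuous_has_antiderivative:
  fixes \<phi> :: "real \<Rightarrow> real"
  assumes "continuous_on UNIV \<phi>"
  obtains \<Psi> where "\<And>x. (\<Psi> has_real_derivative \<phi> x) (at x)"
proof -
  have "\<exists>\<Psi>. \<forall>x. -\<infinity> < ereal x \<longrightarrow> ereal x < \<infinity> \<longrightarrow> (\<Psi> has_vector_derivative \<phi> x) (at x)"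
    by (rule einterval_antiderivative) (use assms in \<open>auto simp: continuous_on_eq_continuous_at\<close>)
  then show thesis using that by (auto simp: has_real_derivative_iff_has_vector_derivative)
qed

lemma prim_has_derivative:
  assumes "continuous_on UNIV \<phi>"
  shows "((\<lambda>b. prim \<phi> a b) has_real_derivative \<phi> b) (at b)"
proof -
  obtain \<Psi> where \<Psi>: "\<And>x. (\<Psi> has_real_derivative \<phi> x) (at x)"
    using continuous_has_antiderivative[OF assms] by blast
  show ?thesis unfolding prim_antiderivative[OF \<Psi>]
    by (auto intro!: derivative_eq_intros \<Psi>)
qed

lemma prim_combine:
  assumes "continuous_on UNIV \<phi>"
  shows "prim \<phi> a b + prim \<phi> b c = prim \<phi> a c"
proof -
  obtain \<Psi> where \<Psi>: "\<And>x. (\<Psi> has_real_derivative \<phi> x) (at x)"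
    using continuous_has_antiderivative[OF assms] by blast
  show ?thesis unfolding prim_antiderivative[OF \<Psi>] by simp
qed

lemma prim_integrable:
  fixes \<phi> :: "real \<Rightarrow> real"
  assumes "continuous_on UNIV \<phi>"
  shows "(\<lambda>\<tau>. \<phi> (a + \<tau> * (b - a))) integrable_on {0..1::real}"
  by (intro integrable_continuous_real continuous_on_compose2[OF assms] continuous_intros) auto

lemma segment_mem:
  fixes a b t :: real assumes "0 \<le> t" "t \<le> 1"
  shows "min a b \<le> a + t * (b - a)" "a + t * (b - a) \<le> max a b"
proof -
  have *: "a + t * (b - a) = (1 - t) * a + t * b" by (simp add: algebra_simps)
  have "(1 - t) * min a b + t * min a b \<le> (1 - t) * a + t * b"
    using assms by (intro add_mono mult_left_mono) auto
  then show "min a b \<le> a + t * (b - a)" unfolding * by (simp add: algebra_simps)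
  have "(1 - t) * a + t * b \<le> (1 - t) * max a b + t * max a b"
    using assms by (intro add_mono mult_left_mono) auto
  then show "a + t * (b - a) \<le> max a b" unfolding * by (simp add: algebra_simps)
qed

lemma prim_bound:
  assumes "continuous_on UNIV \<phi>" "\<And>s. min a b \<le> s \<Longrightarrow> s \<le> max a b \<Longrightarrow> \<bar>\<phi> s\<bar> \<le> B"
  shows "\<bar>prim \<phi> a b\<bar> \<le> \<bar>b - a\<bar> * B"
proof -
  have "norm (integral {0..1} (\<lambda>\<tau>. \<phi> (a + \<tau> * (b - a)))) \<le> B * (1 - 0)"
    using assms segment_mem
    by (intro integral_bound) (auto intro!: continuous_on_compose2[OF assms(1)] continuous_intros)
  then show ?thesis unfolding prim_def abs_mult by (intro mult_left_mono) auto
qed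

lemma prim_zero:
  assumes "\<And>s. min a b \<le> s \<Longrightarrow> s \<le> max a b \<Longrightarrow> \<phi> s = 0"
  shows "prim \<phi> a b = 0"
proof -
  have "integral {0..1} (\<lambda>\<tau>. \<phi> (a + \<tau> * (b - a))) = integral {0..1::real} (\<lambda>\<tau>. 0::real)"
    using assms segment_mem by (intro Henstock_Kurzweil_Integration.integral_cong) auto
  then show ?thesis by (simp add: prim_def)
qed

lemma prim_mono:
  assumes "continuous_on UNIV \<phi>" "continuous_on UNIV \<psi>" "a \<le> b" "\<And>s. a \<le> s \<Longrightarrow> s \<le> b \<Longrightarrow> \<phi> s \<le> \<psi> s"
  shows "prim \<phi> a b \<le> prim \<psi> a b"
  unfolding prim_def
  using assms segment_mem[of _ a b]
  by (intro mult_left_mono integral_le prim_integrable) auto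

lemma prim_nonneg:
  assumes "continuous_on UNIV \<phi>" "a \<le> b" "\<And>s. a \<le> s \<Longrightarrow> s \<le> b \<Longrightarrow> 0 \<le> \<phi> s"
  shows "0 \<le> prim \<phi> a b"
  using prim_mono[of "\<lambda>_. 0" \<phi> a b] assms by (auto simp: prim_def)

lemma prim_cmult: "prim (\<lambda>s. c * \<phi> s) a b = c * prim \<phi> a b"
  by (simp add: prim_def)

lemma prim_add:
  assumes "continuous_on UNIV \<phi>" "continuous_on UNIV \<psi>"
  shows "prim (\<lambda>s. \<phi> s + \<psi> s) a b = prim \<phi> a b + prim \<psi> a b"
  unfolding prim_def
  by (subst integral_add[OF prim_integrable[OF assms(1)] prim_integrable[OF assms(2)]]) (rule distrib_left)

lemma prim_shift: "prim (\<lambda>s. \<phi> (c + s)) a b = prim \<phi> (c + a) (c + b)"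
  by (simp add: prim_def algebra_simps)

text \<open>
Cauchy-Schwarz on an interval, from the nonnegativity of the variance of \<open>\<phi>\<close>.
\<close>

lemma prim_square:
  assumes "continuous_on UNIV \<phi>" "a \<le> b"
  shows "(prim \<phi> a b)\<^sup>2 \<le> (b - a) * prim (\<lambda>s. (\<phi> s)\<^sup>2) a b"
proof -
  let ?f = "\<lambda>\<tau>. \<phi> (a + \<tau> * (b - a))"
  define c where "c = integral {0..1} ?f"
  have c2: "continuous_on UNIV (\<lambda>s. (\<phi> s)\<^sup>2)" using assms by (intro continuous_intros)
  have i1: "?f integrable_on {0..1}" by (rule prim_integrable[OF assms(1)])
  have i2: "(\<lambda>\<tau>. (?f \<tau>)\<^sup>2) integrable_on {0..1}" by (rule prim_integrable[OF c2])
  have "((\<lambda>\<tau>. (?f \<tau>)\<^sup>2 - 2 * c * ?f \<tau> + c\<^sup>2) has_integral (integral {0..1} (\<lambda>\<tau>. (?f \<tau>)\<^sup>2) - 2 * c * c + c\<^sup>2)) {0..1}"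
    using has_integral_const_real[of "c\<^sup>2" 0 1]
    by (intro has_integral_add has_integral_diff has_integral_mult_right integrable_integral i2)
       (auto simp: c_def intro: integrable_integral i1)
  moreover have "(?f \<tau>)\<^sup>2 - 2 * c * ?f \<tau> + c\<^sup>2 \<ge> 0" for \<tau>
    using zero_le_power2[of "?f \<tau> - c"] by (simp add: power2_diff algebra_simps)
  ultimately have "0 \<le> integral {0..1} (\<lambda>\<tau>. (?f \<tau>)\<^sup>2) - 2 * c * c + c\<^sup>2"
    by (meson has_integral_nonneg)
  then have "c\<^sup>2 \<le> integral {0..1} (\<lambda>\<tau>. (?f \<tau>)\<^sup>2)" by (simp add: power2_eq_square)
  then have "(b - a)\<^sup>2 * c\<^sup>2 \<le> (b - a)\<^sup>2 * integral {0..1} (\<lambda>\<tau>. (?f \<tau>)\<^sup>2)" by (intro mult_left_mono) auto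
  then show ?thesis unfolding prim_def c_def by (simp add: power2_eq_square mult_ac)
qed

lemma prim_by_parts:
  assumes \<phi>: "continuous_on UNIV \<phi>" and g: "\<And>x. (g has_real_derivative g' x) (at x)"
    and g': "continuous_on UNIV g'"
  shows "prim (\<lambda>s. \<phi> s * g s) a b = prim \<phi> a b * g b - prim (\<lambda>s. prim \<phi> a s * g' s) a b"
proof -
  have gc: "continuous_on UNIV g" using g by (meson DERIV_isCont continuous_at_imp_continuous_on)
  have pc: "continuous_on UNIV (prim \<phi> a)"
    using prim_has_derivative[OF \<phi>] by (meson DERIV_isCont continuous_at_imp_continuous_on)
  have "prim (\<lambda>s. \<phi> s * g s + prim \<phi> a s * g' s) a b = prim \<phi> a b * g b - prim \<phi> a a * g a"
    by (rule prim_antiderivative) (auto intro!: derivative_eq_intros prim_has_derivative \<phi> g)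
  moreover have "prim \<phi> a a = 0" by (simp add: prim_def)
  ultimately show ?thesis
    by (subst (asm) prim_add) (auto intro!: continuous_intros \<phi> gc pc g')
qed

lemma nn_integral_Icc_eq_prim:
  assumes "continuous_on UNIV \<phi>" "a \<le> b" "\<And>s. 0 \<le> \<phi> s"
  shows "(\<integral>\<^sup>+s. ennreal (\<phi> s) * indicator {a..b} s \<partial>lborel) = ennreal (prim \<phi> a b)"
proof -
  obtain \<Psi> where \<Psi>: "\<And>x. (\<Psi> has_real_derivative \<phi> x) (at x)"
    using continuous_has_antiderivative[OF assms(1)] by blast
  show ?thesis unfolding prim_antiderivative[OF \<Psi>]
    by (rule nn_integral_FTC_Icc)
       (use assms \<Psi> in \<open>auto intro: borel_measurable_continuous_onI has_field_derivative_at_within\<close>)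
qed

section \<open>Partial derivatives, supports and integration by parts\<close>

definition upd :: "'n \<Rightarrow> real \<Rightarrow> real^'n \<Rightarrow> real^'n" where
  "upd i s x = (\<chi> l. if l = i then s else x $ l)"

text \<open>
Only derivatives along coordinate lines are ever used, so partial derivatives are taken as ordinary
derivatives along lines, for all points at once.  Continuity of \<open>f\<close> and \<open>f'\<close> is demanded separately.
\<close>

definition has_pd :: "'n::finite \<Rightarrow> (real^'n \<Rightarrow> real) \<Rightarrow> (real^'n \<Rightarrow> real) \<Rightarrow> bool" where
  "has_pd i f f' \<longleftrightarrow> (\<forall>x. ((\<lambda>t. f (x + t *\<^sub>R axis i 1)) has_real_derivative f' x) (at 0))"

definition supp_in :: "real \<Rightarrow> (real^'n \<Rightarrow> real) \<Rightarrow> bool" where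
  "supp_in R f \<longleftrightarrow> (\<forall>x i. R < \<bar>x $ i\<bar> \<longrightarrow> f x = 0)"

lemma upd_nth: "upd i s x $ l = (if l = i then s else x $ l)"
  by (simp add: upd_def)

lemma upd_same [simp]: "upd i (x $ i) x = x"
  by (simp add: vec_eq_iff upd_nth)

lemma upd_add_axis: "upd i s (x + t *\<^sub>R axis i 1) = upd i s x"
  by (simp add: vec_eq_iff upd_nth axis_def)

lemma upd_add_axis_other: "j \<noteq> i \<Longrightarrow> upd i s (x + t *\<^sub>R axis j 1) = upd i s x + t *\<^sub>R axis j 1"
  by (simp add: vec_eq_iff upd_nth axis_def)

lemma upd_plus_axis: "upd i s x + t *\<^sub>R axis i 1 = upd i (s + t) x"
  by (simp add: vec_eq_iff upd_nth axis_def)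

lemma upd_eq_translate: "upd i s x = x + (s - x $ i) *\<^sub>R axis i 1"
  by (simp add: vec_eq_iff upd_nth axis_def)

lemma continuous_on_upd [continuous_intros]:
  fixes b :: "'a::topological_space \<Rightarrow> real^'n"
  assumes "continuous_on S a" "continuous_on S b"
  shows "continuous_on S (\<lambda>z. upd i (a z) (b z))"
  unfolding upd_eq_translate by (intro continuous_intros assms)

lemma continuous_on_comp_UNIV:
  assumes "continuous_on UNIV f" "continuous_on S g"
  shows "continuous_on S (\<lambda>x. f (g x))"
  using continuous_on_compose2[OF assms] by auto

lemma has_pd_along:
  assumes "has_pd i f f'"
  shows "((\<lambda>t. f (x + t *\<^sub>R axis i 1)) has_real_derivative f' (x + s *\<^sub>R axis i 1)) (at s)"
proof -
  have "((\<lambda>t. f ((x + s *\<^sub>R axis i 1) + t *\<^sub>R axis i 1)) has_real_derivative f' (x + s *\<^sub>R axis i 1)) (at 0)"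
    using assms unfolding has_pd_def by blast
  then have "((\<lambda>t. f (x + (t + s) *\<^sub>R axis i 1)) has_real_derivative f' (x + s *\<^sub>R axis i 1)) (at 0)"
    by (simp add: algebra_simps)
  then show ?thesis using DERIV_shift[of "\<lambda>t. f (x + t *\<^sub>R axis i 1)" _ 0 s] by simp
qed

lemma has_pd_add: "has_pd i f f' \<Longrightarrow> has_pd i g g' \<Longrightarrow> has_pd i (\<lambda>x. f x + g x) (\<lambda>x. f' x + g' x)"
  unfolding has_pd_def by (auto intro!: derivative_eq_intros)

lemma has_pd_diff: "has_pd i f f' \<Longrightarrow> has_pd i g g' \<Longrightarrow> has_pd i (\<lambda>x. f x - g x) (\<lambda>x. f' x - g' x)"
  unfolding has_pd_def by (auto intro!: derivative_eq_intros)

lemma has_pd_mult: "has_pd i f f' \<Longrightarrow> has_pd i g g' \<Longrightarrow> has_pd i (\<lambda>x. f x * g x) (\<lambda>x. f' x * g x + f x * g' x)"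
  unfolding has_pd_def
proof (intro allI)
  fix x
  assume "\<forall>x. ((\<lambda>t. f (x + t *\<^sub>R axis i 1)) has_real_derivative f' x) (at 0)"
    and "\<forall>x. ((\<lambda>t. g (x + t *\<^sub>R axis i 1)) has_real_derivative g' x) (at 0)"
  then have "((\<lambda>t. f (x + t *\<^sub>R axis i 1)) has_real_derivative f' x) (at 0)"
    "((\<lambda>t. g (x + t *\<^sub>R axis i 1)) has_real_derivative g' x) (at 0)" by blast+
  from DERIV_mult[OF this]
  show "((\<lambda>t. f (x + t *\<^sub>R axis i 1) * g (x + t *\<^sub>R axis i 1)) has_real_derivative f' x * g x + f x * g' x) (at 0)"
    by (simp add: mult.commute add.commute)
qed

lemma has_pd_const: "has_pd i (\<lambda>x. c) (\<lambda>x. 0)"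
  unfolding has_pd_def by (auto intro!: derivative_eq_intros)

lemma has_pd_sum:
  assumes "\<And>k. k \<in> A \<Longrightarrow> has_pd i (f k) (f' k)"
  shows "has_pd i (\<lambda>x. \<Sum>k\<in>A. f k x) (\<lambda>x. \<Sum>k\<in>A. f' k x)"
  using assms unfolding has_pd_def by (auto intro!: derivative_eq_intros)

lemma has_pd_coord:
  assumes "\<And>t. (h has_real_derivative h' t) (at t)"
  shows "has_pd i (\<lambda>x. h (x $ i)) (\<lambda>x. h' (x $ i))"
  unfolding has_pd_def
proof
  fix x :: "real^'a"
  have "((\<lambda>t. h (t + x $ i)) has_real_derivative h' (x $ i)) (at 0)"
    using DERIV_shift[of h "h' (x $ i)" 0 "x $ i"] assms[of "x $ i"] by simp
  then show "((\<lambda>t. h ((x + t *\<^sub>R axis i 1) $ i)) has_real_derivative h' (x $ i)) (at 0)"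
    by (simp add: axis_def add.commute)
qed

lemma has_pd_indep:
  assumes "\<And>x t. f (x + t *\<^sub>R axis i 1) = f x"
  shows "has_pd i f (\<lambda>x. 0)"
  unfolding has_pd_def assms by auto

lemma has_pd_coord_other: "j \<noteq> i \<Longrightarrow> has_pd j (\<lambda>x. h (x $ i)) (\<lambda>x. 0)"
  by (rule has_pd_indep) (simp add: axis_def)

lemma has_pd_cong: "has_pd i f f' \<Longrightarrow> (\<And>x. f' x = g' x) \<Longrightarrow> has_pd i f g'"
  unfolding has_pd_def by simp

lemma supp_in_mult: "supp_in R f \<Longrightarrow> supp_in R (\<lambda>x. f x * g x)" "supp_in R f \<Longrightarrow> supp_in R (\<lambda>x. g x * f x)"
  unfolding supp_in_def by auto

lemma supp_in_add: "supp_in R f \<Longrightarrow> supp_in R g \<Longrightarrow> supp_in R (\<lambda>x. f x + g x)"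
  unfolding supp_in_def by auto

lemma supp_in_diff: "supp_in R f \<Longrightarrow> supp_in R g \<Longrightarrow> supp_in R (\<lambda>x. f x - g x)"
  unfolding supp_in_def by auto

lemma supp_in_square: "supp_in R f \<Longrightarrow> supp_in R (\<lambda>x. (f x)\<^sup>2)"
  unfolding supp_in_def by auto

definition cube :: "real \<Rightarrow> (real^'n) set" where "cube R = cbox (\<chi> i. - R) (\<chi> i. R)"

lemma mem_cube: "x \<in> cube R \<longleftrightarrow> (\<forall>i. \<bar>x $ i\<bar> \<le> R)"
proof -
  have "\<bar>x $ i\<bar> \<le> R \<longleftrightarrow> - R \<le> x $ i \<and> x $ i \<le> R" for i by linarith
  then show ?thesis unfolding cube_def by (simp add: mem_box_cart)
qed

lemma supp_in_iff: "supp_in R f \<longleftrightarrow> (\<forall>x. x \<notin> cube R \<longrightarrow> f x = 0)"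
  unfolding supp_in_def mem_cube by (auto simp: not_le)

lemma supp_in_bounded:
  fixes f :: "real^'n \<Rightarrow> real"
  assumes "continuous_on UNIV f" "supp_in R f"
  obtains B where "B \<ge> 0" "\<And>x. \<bar>f x\<bar> \<le> B"
proof -
  have "compact (f ` cube R)"
    by (rule compact_continuous_image) (use assms in \<open>auto simp: cube_def intro: continuous_on_subset\<close>)
  then obtain B where B: "\<And>x. x \<in> cube R \<Longrightarrow> \<bar>f x\<bar> \<le> B"
    by (metis compact_imp_bounded bounded_iff imageI real_norm_def)
  have "\<bar>f x\<bar> \<le> max B 0" for x
    using B[of x] assms(2) unfolding supp_in_iff by (cases "x \<in> cube R") auto
  then show thesis using that[of "max B 0"] by auto
qed

lemma supp_in_integrable:
  fixes f :: "real^'n \<Rightarrow> real"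
  assumes "continuous_on UNIV f" "supp_in R f"
  shows "integrable lborel f"
proof -
  have "integrable lborel (\<lambda>x. indicator (cube R) x *\<^sub>R f x)"
    by (rule borel_integrable_compact) (use assms in \<open>auto simp: cube_def intro: continuous_on_subset\<close>)
  also have "(\<lambda>x. indicator (cube R) x *\<^sub>R f x) = f"
    using assms(2) unfolding supp_in_iff by (auto simp: fun_eq_iff indicator_def)
  finally show ?thesis .
qed

lemma has_pd_supp:
  assumes "has_pd i f f'" "supp_in R f"
  shows "supp_in R f'"
  unfolding supp_in_def
proof (intro allI impI)
  fix x :: "real^'a" and l assume l: "R < \<bar>x $ l\<bar>"
  have "((\<lambda>t. f (x + t *\<^sub>R axis i 1)) has_real_derivative f' x) (at 0)"
    using assms unfolding has_pd_def by blast
  moreover have "((\<lambda>t. f (x + t *\<^sub>R axis i 1)) has_real_derivative 0) (at 0)"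
  proof (rule has_field_derivative_transform_within_open[where f = "\<lambda>_. 0" and S = "{t. R < \<bar>(x + t *\<^sub>R axis i 1) $ l\<bar>}"])
    show "open {t. R < \<bar>(x + t *\<^sub>R axis i 1) $ l\<bar>}"
      by (intro open_Collect_less continuous_intros)
    show "0 = f (x + t *\<^sub>R axis i 1)" if "t \<in> {t. R < \<bar>(x + t *\<^sub>R axis i 1) $ l\<bar>}" for t
      using assms(2) that unfolding supp_in_def by (metis mem_Collect_eq)
  qed (use l in auto)
  ultimately show "f' x = 0" by (rule DERIV_unique)
qed

lemma nn_integral_translate:
  fixes f :: "real^'n \<Rightarrow> ennreal"
  assumes [measurable]: "f \<in> borel_measurable borel"
  shows "(\<integral>\<^sup>+x. f (x + c) \<partial>lborel) = (\<integral>\<^sup>+x. f x \<partial>lborel)"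
  by (subst (2) lborel_distr_plus[of c, symmetric]) (simp add: nn_integral_distr add.commute)

lemma integral_translate:
  fixes f :: "real^'n \<Rightarrow> real"
  assumes [measurable]: "f \<in> borel_measurable borel"
  shows "(\<integral>x. f (x + c) \<partial>lborel) = (\<integral>x. f x \<partial>lborel)"
  by (subst (2) lborel_distr_plus[of c, symmetric]) (simp add: integral_distr add.commute)

text \<open>
The integral of \<open>f\<close> is invariant under translations, so every difference quotient in direction \<open>i\<close> has
integral \<open>0\<close>; by the mean value theorem these quotients are dominated by a multiple of the indicator of a
cube, and they converge to \<open>f'\<close>.
\<close>

lemma integral_pd_eq_0:
  fixes f :: "real^'n \<Rightarrow> real"
  assumes f: "continuous_on UNIV f" and f': "continuous_on UNIV f'" and pd: "has_pd i f f'" and supp: "supp_in R f"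
  shows "(\<integral>x. f' x \<partial>lborel) = 0"
proof -
  let ?e = "axis i 1 :: real^'n"
  obtain B where B: "B \<ge> 0" "\<And>x. \<bar>f' x\<bar> \<le> B"
    using supp_in_bounded[OF f' has_pd_supp[OF pd supp]] by blast
  have [measurable]: "f \<in> borel_measurable borel" "f' \<in> borel_measurable borel"
    using f f' by (auto intro: borel_measurable_continuous_onI)
  have int: "integrable lborel f" by (rule supp_in_integrable[OF f supp])
  have int': "integrable lborel (\<lambda>x. f (x + c))" for c
    by (rule integrableI_bounded)
       (use int in \<open>simp_all add: nn_integral_translate[of "\<lambda>x. ennreal \<bar>f x\<bar>"] integrable_iff_bounded\<close>)
  define g where "g n x = (f (x + (1 / real (Suc n)) *\<^sub>R ?e) - f x) / (1 / real (Suc n))" for n x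
  have g0: "(\<integral>x. g n x \<partial>lborel) = 0" for n
    unfolding g_def by (simp add: int int' integral_translate)
  have "(\<lambda>n. \<integral>x. g n x \<partial>lborel) \<longlonglongrightarrow> (\<integral>x. f' x \<partial>lborel)"
  proof (rule integral_dominated_convergence[where w = "\<lambda>x. B * indicator (cube (R + 1)) x"])
    show "integrable lborel (\<lambda>x. B * indicator (cube (R + 1)) x :: real)"
      unfolding cube_def by (intro integrable_mult_right integrable_real_indicator) (auto simp: emeasure_lborel_cbox_eq)
    show "AE x in lborel. (\<lambda>n. g n x) \<longlonglongrightarrow> f' x"
    proof (rule AE_I2)
      fix x
      have "((\<lambda>t. (f (x + t *\<^sub>R ?e) - f x) / t) \<longlongrightarrow> f' x) (at 0)"
        using pd unfolding has_pd_def has_field_derivative_iff by simp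
      moreover have "filterlim (\<lambda>n. 1 / real (Suc n)) (at 0) sequentially"
        unfolding filterlim_at using LIMSEQ_inverse_real_of_nat by (auto simp: divide_inverse)
      ultimately show "(\<lambda>n. g n x) \<longlonglongrightarrow> f' x"
        unfolding g_def by (rule filterlim_compose)
    qed
    fix n show "AE x in lborel. norm (g n x) \<le> B * indicator (cube (R + 1)) x"
    proof (rule AE_I2)
      fix x
      let ?t = "1 / real (Suc n)"
      show "norm (g n x) \<le> B * indicator (cube (R + 1)) x"
      proof (cases "x \<in> cube (R + 1)")
        case True
        have "\<exists>z. 0 < z \<and> z < ?t \<and> f (x + ?t *\<^sub>R ?e) - f (x + 0 *\<^sub>R ?e) = (?t - 0) * f' (x + z *\<^sub>R ?e)"
          by (rule MVT2) (auto intro: has_pd_along[OF pd])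
        then obtain z where "f (x + ?t *\<^sub>R ?e) - f x = ?t * f' (x + z *\<^sub>R ?e)" by auto
        then have "g n x = f' (x + z *\<^sub>R ?e)" by (simp add: g_def)
        then show ?thesis using B(2)[of "x + z *\<^sub>R ?e"] True by simp
      next
        case False
        then obtain l where l: "R + 1 < \<bar>x $ l\<bar>" by (auto simp: mem_cube not_le)
        have "\<bar>(x + ?t *\<^sub>R ?e) $ l - x $ l\<bar> \<le> 1" by (simp add: axis_def)
        then have "R < \<bar>(x + ?t *\<^sub>R ?e) $ l\<bar>" using l by linarith
        then have "f (x + ?t *\<^sub>R ?e) = 0" using supp unfolding supp_in_def by blast
        moreover have "R < \<bar>x $ l\<bar>" using l by linarith
        then have "f x = 0" using supp unfolding supp_in_def by blast
        ultimately have "f (x + ?t *\<^sub>R ?e) = 0" "f x = 0" by auto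
        then show ?thesis using B by (simp add: g_def)
      qed
    qed
  qed (auto simp: g_def)
  then show ?thesis unfolding g0 using LIMSEQ_unique by blast
qed

lemma integral_by_parts_pd:
  fixes f g :: "real^'n \<Rightarrow> real"
  assumes "continuous_on UNIV f" "continuous_on UNIV f'" "has_pd i f f'"
    "continuous_on UNIV g" "continuous_on UNIV g'" "has_pd i g g'" "supp_in R g"
  shows "(\<integral>x. f' x * g x \<partial>lborel) = - (\<integral>x. f x * g' x \<partial>lborel)"
proof -
  have "(\<integral>x. f' x * g x + f x * g' x \<partial>lborel) = 0"
    by (rule integral_pd_eq_0[of "\<lambda>x. f x * g x" _ i R])
       (use assms in \<open>auto intro!: continuous_intros has_pd_mult supp_in_mult\<close>)
  moreover have "integrable lborel (\<lambda>x. f' x * g x)" "integrable lborel (\<lambda>x. f x * g' x)"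
    using assms has_pd_supp[OF assms(6,7)]
    by (auto intro!: supp_in_integrable[where R = R] continuous_intros supp_in_mult)
  ultimately show ?thesis by simp
qed

text \<open>
Tonelli's theorem: each translate of \<open>f\<close> has the same \<open>L\<^sup>2\<close> norm.
\<close>

lemma nn_integral_line_average:
  fixes f :: "real^'n \<Rightarrow> real"
  assumes f: "continuous_on UNIV f" and "a \<le> b"
  shows "(\<integral>\<^sup>+x. ennreal (prim (\<lambda>r. (f (x + r *\<^sub>R axis i 1))\<^sup>2) a b) \<partial>lborel)
    = ennreal (b - a) * (\<integral>\<^sup>+x. ennreal ((f x)\<^sup>2) \<partial>lborel)"
proof -
  have [measurable]: "f \<in> borel_measurable borel" using f by (rule borel_measurable_continuous_onI)
  have "(\<integral>\<^sup>+x. ennreal (prim (\<lambda>r. (f (x + r *\<^sub>R axis i 1))\<^sup>2) a b) \<partial>lborel)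
    = (\<integral>\<^sup>+x. \<integral>\<^sup>+r. ennreal ((f (x + r *\<^sub>R axis i 1))\<^sup>2) * indicator {a..b} r \<partial>lborel \<partial>lborel)"
  proof (rule nn_integral_cong)
    fix x :: "real^'n"
    have "continuous_on UNIV (\<lambda>r. (f (x + r *\<^sub>R axis i 1))\<^sup>2)"
      by (intro continuous_on_power continuous_on_comp_UNIV[OF f]) (intro continuous_intros)
    from nn_integral_Icc_eq_prim[OF this \<open>a \<le> b\<close>]
    show "ennreal (prim (\<lambda>r. (f (x + r *\<^sub>R axis i 1))\<^sup>2) a b)
      = (\<integral>\<^sup>+r. ennreal ((f (x + r *\<^sub>R axis i 1))\<^sup>2) * indicator {a..b} r \<partial>lborel)" by simp
  qed
  also have "\<dots> = (\<integral>\<^sup>+r. \<integral>\<^sup>+x. ennreal ((f (x + r *\<^sub>R axis i 1))\<^sup>2) * indicator {a..b} r \<partial>lborel \<partial>lborel)"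
  proof (rule lborel_pair.Fubini')
    have "continuous_on UNIV (\<lambda>z. (f (snd z + fst z *\<^sub>R axis i 1))\<^sup>2)"
      by (intro continuous_on_power continuous_on_comp_UNIV[OF f]) (intro continuous_intros)
    then have "(\<lambda>z. (f (snd z + fst z *\<^sub>R axis i 1))\<^sup>2) \<in> borel_measurable borel"
      by (rule borel_measurable_continuous_onI)
    then have [measurable]: "(\<lambda>z. (f (snd z + fst z *\<^sub>R axis i 1))\<^sup>2) \<in> borel_measurable (lborel \<Otimes>\<^sub>M lborel)"
      by (simp add: lborel_prod)
    show "(\<lambda>(r, x). ennreal ((f (x + r *\<^sub>R axis i 1))\<^sup>2) * indicator {a..b} r)
        \<in> borel_measurable (lborel \<Otimes>\<^sub>M lborel)"
      unfolding case_prod_beta by measurable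
  qed
  also have "\<dots> = (\<integral>\<^sup>+r. (\<integral>\<^sup>+x. ennreal ((f x)\<^sup>2) \<partial>lborel) * indicator {a..b} r \<partial>lborel)"
  proof (intro nn_integral_cong)
    fix r :: real
    have "continuous_on UNIV (\<lambda>x. f (x + r *\<^sub>R axis i 1))"
      by (intro continuous_on_comp_UNIV[OF f]) (intro continuous_intros)
    then have [measurable]: "(\<lambda>x. f (x + r *\<^sub>R axis i 1)) \<in> borel_measurable borel"
      by (rule borel_measurable_continuous_onI)
    have "(\<integral>\<^sup>+x. ennreal ((f (x + r *\<^sub>R axis i 1))\<^sup>2) * indicator {a..b} r \<partial>lborel)
        = (\<integral>\<^sup>+x. ennreal ((f (x + r *\<^sub>R axis i 1))\<^sup>2) \<partial>lborel) * indicator {a..b} r"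
      by (rule nn_integral_multc) measurable
    also have "\<dots> = (\<integral>\<^sup>+x. ennreal ((f x)\<^sup>2) \<partial>lborel) * indicator {a..b} r"
      by (subst nn_integral_translate[of "\<lambda>x. ennreal ((f x)\<^sup>2)"]) measurable
    finally show "(\<integral>\<^sup>+x. ennreal ((f (x + r *\<^sub>R axis i 1))\<^sup>2) * indicator {a..b} r \<partial>lborel)
        = (\<integral>\<^sup>+x. ennreal ((f x)\<^sup>2) \<partial>lborel) * indicator {a..b} r" .
  qed
  also have "\<dots> = (\<integral>\<^sup>+x. ennreal ((f x)\<^sup>2) \<partial>lborel) * emeasure lborel {a..b}"
    by (rule nn_integral_cmult_indicator) simp
  finally show ?thesis using assms by (simp add: mult.commute)
qed

lemma continuous_prim_translate:
  fixes f :: "real^'n \<Rightarrow> real"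
  assumes f: "continuous_on UNIV f"
  shows "continuous_on UNIV (\<lambda>x. prim (\<lambda>r. f (x + r *\<^sub>R axis i 1)) a b)"
proof -
  have "continuous_on (UNIV \<times> cbox 0 1) (\<lambda>(x, \<tau>). f (x + (a + \<tau> * (b - a)) *\<^sub>R axis i 1))"
    unfolding case_prod_beta by (rule continuous_on_comp_UNIV[OF f]) (intro continuous_intros)
  from integral_continuous_on_param[OF this]
  show ?thesis unfolding prim_def by (intro continuous_intros) simp
qed

section \<open>A cutoff on the line and antiderivatives along coordinate lines\<close>

text \<open>
The positive part of \<open>1 - (t/R)\<^sup>2\<close>, cubed to make it twice continuously differentiable; \<open>bump1\<close> and
\<open>bump2\<close> are its first two derivatives.  It is not constant near \<open>0\<close>, but it tends to \<open>1\<close> pointwise as \<open>R\<close>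
grows, which is all that is asked of a cutoff here.
\<close>

definition bump :: "real \<Rightarrow> real \<Rightarrow> real" where
  "bump R t = (max 0 (1 - (t / R)\<^sup>2)) ^ 3"

definition bump1 :: "real \<Rightarrow> real \<Rightarrow> real" where
  "bump1 R t = - (6 * t / R\<^sup>2) * (max 0 (1 - (t / R)\<^sup>2))\<^sup>2"

definition bump2 :: "real \<Rightarrow> real \<Rightarrow> real" where
  "bump2 R t = - (6 / R\<^sup>2) * (max 0 (1 - (t / R)\<^sup>2))\<^sup>2 + (24 * t\<^sup>2 / R ^ 4) * max 0 (1 - (t / R)\<^sup>2)"

lemma positive_part_power_derivative:
  fixes y :: real
  shows "((\<lambda>y. max 0 y ^ Suc (Suc n)) has_real_derivative real (Suc (Suc n)) * max 0 y ^ Suc n) (at y)"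
proof -
  consider "y > 0" | "y < 0" | "y = 0" by linarith
  then show ?thesis
  proof cases
    case 1
    have "((\<lambda>y. y ^ Suc (Suc n)) has_real_derivative real (Suc (Suc n)) * y ^ Suc n) (at y)"
      by (rule DERIV_cong[OF DERIV_pow]) simp
    then have "((\<lambda>y. max 0 y ^ Suc (Suc n)) has_real_derivative real (Suc (Suc n)) * y ^ Suc n) (at y)"
      by (rule has_field_derivative_transform_within_open[where S = "{0<..}"]) (use 1 in auto)
    then show ?thesis using 1 by simp
  next
    case 2
    have "((\<lambda>y. 0::real) has_real_derivative 0) (at y)" by simp
    then have "((\<lambda>y. max 0 y ^ Suc (Suc n)) has_real_derivative 0) (at y)"
      by (rule has_field_derivative_transform_within_open[where S = "{..<0}"]) (use 2 in auto)
    then show ?thesis using 2 by simp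
  next
    case 3
    have "((\<lambda>h::real. max 0 h ^ Suc (Suc n) / h) \<longlongrightarrow> 0) (at 0)"
    proof (rule Lim_null_comparison)
      show "\<forall>\<^sub>F h::real in at 0. norm (max 0 h ^ Suc (Suc n) / h) \<le> \<bar>h\<bar> ^ Suc n"
      proof (rule always_eventually, rule allI)
        fix h :: real
        show "norm (max 0 h ^ Suc (Suc n) / h) \<le> \<bar>h\<bar> ^ Suc n"
        proof (cases "h > 0")
          case False
          then have "norm (max 0 h ^ Suc (Suc n) / h) = 0" by (simp add: max_absorb1)
          then show ?thesis using zero_le_power[OF abs_ge_zero, of h "Suc n"] by linarith
        qed (simp add: max_absorb2 abs_mult)
      qed
      show "((\<lambda>h::real. \<bar>h\<bar> ^ Suc n) \<longlongrightarrow> 0) (at 0)"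
        by (rule tendsto_eq_intros | simp)+
    qed
    then show ?thesis using 3 by (simp add: has_field_derivative_iff)
  qed
qed

lemma bump_derivative: "R > 0 \<Longrightarrow> (bump R has_real_derivative bump1 R t) (at t)"
proof -
  assume R: "R > 0"
  have "((\<lambda>t. 1 - (t / R)\<^sup>2) has_real_derivative - (2 * t / R\<^sup>2)) (at t)"
    using R by (auto intro!: derivative_eq_intros simp: power2_eq_square)
  from DERIV_chain'[OF this positive_part_power_derivative[of 1]]
  show ?thesis unfolding bump_def[abs_def] bump1_def
    by (simp add: numeral_3_eq_3 numeral_2_eq_2 algebra_simps)
qed

lemma bump1_derivative: "R > 0 \<Longrightarrow> (bump1 R has_real_derivative bump2 R t) (at t)"
proof -
  assume R: "R > 0"
  have "((\<lambda>t. 1 - (t / R)\<^sup>2) has_real_derivative - (2 * t / R\<^sup>2)) (at t)"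
    using R by (auto intro!: derivative_eq_intros simp: power2_eq_square)
  from DERIV_chain'[OF this positive_part_power_derivative[of 0]]
  have 1: "((\<lambda>t. (max 0 (1 - (t / R)\<^sup>2))\<^sup>2) has_real_derivative - (4 * t / R\<^sup>2) * max 0 (1 - (t / R)\<^sup>2)) (at t)"
    by (simp add: numeral_2_eq_2 algebra_simps)
  have 2: "((\<lambda>t. - (6 * t / R\<^sup>2)) has_real_derivative - (6 / R\<^sup>2)) (at t)"
  proof -
    have "(\<lambda>t. - (6 * t / R\<^sup>2)) = (*) (- (6 / R\<^sup>2))" by (simp add: fun_eq_iff)
    then show ?thesis using DERIV_cmult_Id by metis
  qed
  show ?thesis unfolding bump1_def[abs_def] bump2_def
    by (rule DERIV_cong[OF DERIV_mult[OF 2 1]]) (simp add: field_simps power4_eq_xxxx power2_eq_square)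
qed

lemma continuous_bump: "R > 0 \<Longrightarrow> continuous_on S (bump R)"
  and continuous_bump1: "R > 0 \<Longrightarrow> continuous_on S (bump1 R)"
  using bump_derivative bump1_derivative by (meson DERIV_isCont continuous_at_imp_continuous_on)+

lemma continuous_bump2: "R > 0 \<Longrightarrow> continuous_on S (bump2 R)"
  unfolding bump2_def[abs_def] by (intro continuous_intros) auto

lemma bump_nonneg: "0 \<le> bump R t"
  by (simp add: bump_def)

lemma bump_le_1: "bump R t \<le> 1"
  unfolding bump_def by (rule power_le_one) auto

lemma square_quotient: 
  fixes R t :: real
  assumes "R > 0"
  shows "(t / R)\<^sup>2 \<le> 1 \<longleftrightarrow> \<bar>t\<bar> \<le> R"
  using assms by (simp add: abs_square_le_1)

lemma bump_outside:
  assumes "R > 0" "R < \<bar>t\<bar>"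
  shows "bump R t = 0" "bump1 R t = 0" "bump2 R t = 0"
  using square_quotient[OF assms(1), of t] assms(2) unfolding bump_def bump1_def bump2_def by (auto simp: max_def)

lemma bump1_bound:
  assumes "R > 0" shows "\<bar>bump1 R t\<bar> \<le> 6 / R"
proof (cases "R < \<bar>t\<bar>")
  case False
  have "\<bar>bump1 R t\<bar> = (6 * \<bar>t\<bar> / R\<^sup>2) * (max 0 (1 - (t / R)\<^sup>2))\<^sup>2"
    unfolding bump1_def by (simp add: abs_mult)
  also have "\<dots> \<le> (6 * R / R\<^sup>2) * 1"
    using False assms by (intro mult_mono divide_right_mono power_le_one) auto
  finally show ?thesis using assms by (simp add: power2_eq_square)
qed (use bump_outside assms in auto)

lemma bump2_bound:
  assumes "R > 0" shows "\<bar>bump2 R t\<bar> \<le> 30 / R\<^sup>2"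
proof (cases "R < \<bar>t\<bar>")
  case False
  let ?M = "max 0 (1 - (t / R)\<^sup>2)"
  have M: "0 \<le> ?M" "?M \<le> 1" by auto
  have t2: "t\<^sup>2 \<le> R\<^sup>2" using False assms by (simp add: abs_le_square_iff[symmetric])
  have "\<bar>bump2 R t\<bar> \<le> \<bar>(6 / R\<^sup>2) * ?M\<^sup>2\<bar> + \<bar>(24 * t\<^sup>2 / R ^ 4) * ?M\<bar>"
    unfolding bump2_def by linarith
  also have "\<dots> = (6 / R\<^sup>2) * ?M\<^sup>2 + (24 * t\<^sup>2 / R ^ 4) * ?M" by (simp add: abs_mult)
  also have "\<dots> \<le> (6 / R\<^sup>2) * 1 + (24 * R\<^sup>2 / R ^ 4) * 1"
    using t2 M by (intro add_mono mult_mono divide_right_mono power_le_one) auto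
  also have "\<dots> = 30 / R\<^sup>2" using assms by (simp add: field_simps power4_eq_xxxx power2_eq_square)
  finally show ?thesis .
qed (use bump_outside assms in auto)

definition bump_mass :: "real \<Rightarrow> real" where "bump_mass R = prim (bump R) (- 2 * R) (2 * R)"

lemma bump_mass_ge:
  assumes "R > 0" shows "R / 4 \<le> bump_mass R"
proof -
  note c = continuous_bump[OF assms, of UNIV]
  have "bump_mass R = prim (bump R) (- 2 * R) (- R / 2) + (prim (bump R) (- R / 2) (R / 2) + prim (bump R) (R / 2) (2 * R))"
    unfolding bump_mass_def by (simp add: prim_combine[OF c])
  moreover have "0 \<le> prim (bump R) (- 2 * R) (- R / 2)" "0 \<le> prim (bump R) (R / 2) (2 * R)"
    using assms by (auto intro!: prim_nonneg c bump_nonneg)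
  moreover have "prim (\<lambda>_. 1 / 4) (- R / 2) (R / 2) \<le> prim (bump R) (- R / 2) (R / 2)"
  proof (rule prim_mono)
    fix s assume s: "- R / 2 \<le> s" "s \<le> R / 2"
    then have "\<bar>s / R\<bar> \<le> 1 / 2" using assms by (auto simp: abs_le_iff field_simps)
    then have "(s / R)\<^sup>2 \<le> (1 / 2)\<^sup>2" by (metis abs_ge_zero power2_abs power_mono)
    moreover have "(1 / 2)\<^sup>2 = (1 / 4 :: real)" by (simp add: power2_eq_square)
    ultimately have "3 / 4 \<le> max 0 (1 - (s / R)\<^sup>2)" by linarith
    then have "(3 / 4) ^ 3 \<le> bump R s" unfolding bump_def by (rule power_mono) simp
    then show "1 / 4 \<le> bump R s" by (simp add: power3_eq_cube)
  qed (use assms c in auto)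
  ultimately show ?thesis by (simp add: prim_def)
qed

lemma continuous_on_prim_upd:
  fixes f :: "real^'n \<Rightarrow> real"
  assumes f: "continuous_on UNIV f" and b: "continuous_on UNIV b"
  shows "continuous_on UNIV (\<lambda>x. prim (\<lambda>s. f (upd i s x)) a (b x))"
proof -
  have "continuous_on (UNIV \<times> cbox 0 1) (\<lambda>(x, \<tau>). f (upd i (a + \<tau> * (b x - a)) x))"
    unfolding case_prod_beta
    by (intro continuous_on_comp_UNIV[OF f] continuous_on_upd continuous_on_add continuous_on_mult
          continuous_on_diff continuous_on_comp_UNIV[OF b] continuous_on_fst continuous_on_snd
          continuous_on_id continuous_on_const)
  from integral_continuous_on_param[OF this]
  show ?thesis unfolding prim_def by (intro continuous_intros b) simp
qed

lemma has_pd_prim_upd: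
  fixes f :: "real^'n \<Rightarrow> real"
  assumes f: "continuous_on UNIV f" and f': "continuous_on UNIV f'" and pd: "has_pd j f f'" and "j \<noteq> i"
    and b: "\<And>x t. b (x + t *\<^sub>R axis j 1) = b x"
  shows "has_pd j (\<lambda>x. prim (\<lambda>s. f (upd i s x)) a (b x)) (\<lambda>x. prim (\<lambda>s. f' (upd i s x)) a (b x))"
  unfolding has_pd_def
proof
  fix x :: "real^'n"
  let ?p = "\<lambda>\<tau>. upd i (a + \<tau> * (b x - a)) x"
  have cp: "continuous_on S ?p" for S
    by (intro continuous_on_upd continuous_intros)
  have "((\<lambda>t. integral (cbox 0 1) (\<lambda>\<tau>. f (?p \<tau> + t *\<^sub>R axis j 1)))
      has_real_derivative integral (cbox 0 1) (\<lambda>\<tau>. f' (?p \<tau> + 0 *\<^sub>R axis j 1))) (at 0 within UNIV)"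
  proof (rule leibniz_rule_field_derivative)
    show "((\<lambda>t. f (?p \<tau> + t *\<^sub>R axis j 1)) has_real_derivative f' (?p \<tau> + t *\<^sub>R axis j 1)) (at t within UNIV)" for t \<tau>
      using has_pd_along[OF pd] by simp
    show "(\<lambda>\<tau>. f (?p \<tau> + t *\<^sub>R axis j 1)) integrable_on cbox 0 1" for t
      by (intro integrable_continuous continuous_on_comp_UNIV[OF f] continuous_on_add cp continuous_on_const)
    show "continuous_on (UNIV \<times> cbox 0 1) (\<lambda>(t, \<tau>). f' (?p \<tau> + t *\<^sub>R axis j 1))"
      unfolding case_prod_beta
      by (intro continuous_on_comp_UNIV[OF f'] continuous_on_add continuous_on_compose2[OF cp[of UNIV]]
          continuous_on_scaleR continuous_on_fst continuous_on_snd continuous_on_id continuous_on_const) auto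
  qed auto
  then show "((\<lambda>t. prim (\<lambda>s. f (upd i s (x + t *\<^sub>R axis j 1))) a (b (x + t *\<^sub>R axis j 1)))
      has_real_derivative prim (\<lambda>s. f' (upd i s x)) a (b x)) (at 0)"
    unfolding prim_def b upd_add_axis_other[OF \<open>j \<noteq> i\<close>]
    by (intro DERIV_cmult) simp
qed

text \<open>
Operators for functions supported in the cube \<open>[-R,R]\<^sup>n\<close>; the limits \<open>-2R\<close> and \<open>2R\<close> only have to enclose
the support.  On every line in direction \<open>i\<close>, \<open>spread\<close> replaces \<open>f\<close> by a multiple of the bump with the same
integral.  Then \<open>f - spread R i f\<close> has integral \<open>0\<close> on each such line, and therefore its antiderivative
\<open>line_potential\<close> is supported in the cube again.
\<close>

definition line_total :: "real \<Rightarrow> 'n \<Rightarrow> (real^'n \<Rightarrow> real) \<Rightarrow> real^'n \<Rightarrow> real" where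
  "line_total R i f x = prim (\<lambda>s. f (upd i s x)) (- 2 * R) (2 * R)"

definition line_part :: "real \<Rightarrow> 'n \<Rightarrow> (real^'n \<Rightarrow> real) \<Rightarrow> real^'n \<Rightarrow> real" where
  "line_part R i f x = prim (\<lambda>s. f (upd i s x)) (- 2 * R) (x $ i)"

definition spread :: "real \<Rightarrow> 'n \<Rightarrow> (real^'n \<Rightarrow> real) \<Rightarrow> real^'n \<Rightarrow> real" where
  "spread R i f x = bump R (x $ i) / bump_mass R * line_total R i f x"

definition line_potential :: "real \<Rightarrow> 'n \<Rightarrow> (real^'n \<Rightarrow> real) \<Rightarrow> real^'n \<Rightarrow> real" where
  "line_potential R i f x = line_part R i f x - prim (bump R) (- 2 * R) (x $ i) / bump_mass R * line_total R i f x"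

lemma continuous_line_total: "continuous_on UNIV f \<Longrightarrow> continuous_on UNIV (line_total R i f)"
  unfolding line_total_def[abs_def] by (rule continuous_on_prim_upd) auto

lemma continuous_line_part: "continuous_on UNIV f \<Longrightarrow> continuous_on UNIV (line_part R i f)"
  unfolding line_part_def[abs_def] by (rule continuous_on_prim_upd) (auto intro!: continuous_intros)

lemma continuous_prim: "continuous_on UNIV \<phi> \<Longrightarrow> continuous_on S (prim \<phi> a)"
  using prim_has_derivative by (meson DERIV_isCont continuous_at_imp_continuous_on)

lemma continuous_on_coord: "continuous_on UNIV \<phi> \<Longrightarrow> continuous_on UNIV (\<lambda>x::real^'n. \<phi> (x $ i) :: real)"
  by (rule continuous_on_comp_UNIV) (auto intro!: continuous_intros)

lemma continuous_spread: "R > 0 \<Longrightarrow> continuous_on UNIV f \<Longrightarrow> continuous_on UNIV (spread R i f)"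
  unfolding spread_def[abs_def] using bump_mass_ge[of R]
  by (intro continuous_on_mult continuous_on_divide continuous_line_total continuous_on_coord continuous_bump continuous_on_const) auto

lemma continuous_line_potential: "R > 0 \<Longrightarrow> continuous_on UNIV f \<Longrightarrow> continuous_on UNIV (line_potential R i f)"
  unfolding line_potential_def[abs_def] using bump_mass_ge[of R]
  by (intro continuous_on_diff continuous_on_mult continuous_on_divide continuous_line_total continuous_line_part
      continuous_on_coord continuous_bump continuous_on_const continuous_prim) auto

lemma line_total_indep: "line_total R i f (x + t *\<^sub>R axis i 1) = line_total R i f x"
  unfolding line_total_def upd_add_axis ..

lemma has_pd_line_total:
  assumes "continuous_on UNIV f" "continuous_on UNIV f'" "has_pd j f f'" "j \<noteq> i"
  shows "has_pd j (line_total R i f) (line_total R i f')"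
  unfolding line_total_def[abs_def] by (rule has_pd_prim_upd[OF assms]) simp

lemma has_pd_line_part:
  assumes "continuous_on UNIV f" "continuous_on UNIV f'" "has_pd j f f'" "j \<noteq> i"
  shows "has_pd j (line_part R i f) (line_part R i f')"
  unfolding line_part_def[abs_def] by (rule has_pd_prim_upd[OF assms]) (use assms in \<open>simp add: axis_def\<close>)

lemma has_pd_line_part_same:
  assumes f: "continuous_on UNIV f"
  shows "has_pd i (line_part R i f) f"
  unfolding has_pd_def
proof
  fix x :: "real^'a"
  have c: "continuous_on UNIV (\<lambda>s. f (upd i s x))"
    by (intro continuous_on_comp_UNIV[OF f] continuous_on_upd continuous_intros)
  have "((\<lambda>b. prim (\<lambda>s. f (upd i s x)) (- 2 * R) b) has_real_derivative f (upd i (x $ i) x)) (at (0 + x $ i))"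
    using prim_has_derivative[OF c, of "- 2 * R" "x $ i"] by simp
  then have "((\<lambda>t. prim (\<lambda>s. f (upd i s x)) (- 2 * R) (t + x $ i)) has_real_derivative f x) (at 0)"
    unfolding DERIV_shift by simp
  then show "((\<lambda>t. line_part R i f (x + t *\<^sub>R axis i 1)) has_real_derivative f x) (at 0)"
    unfolding line_part_def upd_add_axis by (simp add: axis_def add.commute)
qed

lemma has_pd_spread:
  assumes "R > 0" "continuous_on UNIV f" "continuous_on UNIV f'" "has_pd j f f'" "j \<noteq> i"
  shows "has_pd j (spread R i f) (spread R i f')"
  unfolding spread_def[abs_def]
  by (rule has_pd_cong[OF has_pd_mult[OF has_pd_coord_other[OF assms(5)] has_pd_line_total[OF assms(2-5)]]]) simp

lemma has_pd_spread_same: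
  assumes "R > 0"
  shows "has_pd i (spread R i f) (\<lambda>x. bump1 R (x $ i) / bump_mass R * line_total R i f x)"
proof -
  have "((\<lambda>t. bump R t / bump_mass R) has_real_derivative bump1 R t / bump_mass R) (at t)" for t
    using bump_derivative[OF assms] by (rule DERIV_cdivide)
  from has_pd_mult[OF has_pd_coord[OF this, where i = i] has_pd_indep[of "line_total R i f" i]]
  show ?thesis unfolding spread_def[abs_def] by (simp add: line_total_indep)
qed

lemma has_pd_line_potential:
  assumes "R > 0" "continuous_on UNIV f" "continuous_on UNIV f'" "has_pd j f f'" "j \<noteq> i"
  shows "has_pd j (line_potential R i f) (line_potential R i f')"
  unfolding line_potential_def[abs_def]
  by (rule has_pd_diff[OF has_pd_line_part[OF assms(2-5)] has_pd_cong[OF has_pd_mult[OF has_pd_coord_other[OF assms(5)] has_pd_line_total[OF assms(2-5)]]]]) simp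

lemma has_pd_line_potential_same:
  assumes "R > 0" "continuous_on UNIV f"
  shows "has_pd i (line_potential R i f) (\<lambda>x. f x - spread R i f x)"
proof -
  have "((\<lambda>t. prim (bump R) (- 2 * R) t / bump_mass R) has_real_derivative bump R t / bump_mass R) (at t)" for t
    using prim_has_derivative[OF continuous_bump[OF assms(1)]] by (rule DERIV_cdivide)
  from has_pd_mult[OF has_pd_coord[OF this, where i = i] has_pd_indep[of "line_total R i f" i]]
  have "has_pd i (\<lambda>x. prim (bump R) (- 2 * R) (x $ i) / bump_mass R * line_total R i f x) (spread R i f)"
    unfolding spread_def[abs_def] by (simp add: line_total_indep)
  from has_pd_diff[OF has_pd_line_part_same[OF assms(2)] this] show ?thesis unfolding line_potential_def[abs_def] .
qed

section \<open>Moving mass along coordinate lines\<close>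

lemma supp_in_upd:
  assumes "supp_in R f"
  shows "R < \<bar>s\<bar> \<Longrightarrow> f (upd i s x) = 0" "l \<noteq> i \<Longrightarrow> R < \<bar>x $ l\<bar> \<Longrightarrow> f (upd i s x) = 0"
  using assms unfolding supp_in_def by (metis upd_nth)+

lemma prim_beyond_left:
  assumes "R > 0" "\<And>s. R < \<bar>s\<bar> \<Longrightarrow> \<phi> s = 0" "b < - R"
  shows "prim \<phi> (- 2 * R) b = 0"
proof (rule prim_zero)
  fix s assume "s \<le> max (- 2 * R) b"
  then have "R < \<bar>s\<bar>" using assms(1,3) by linarith
  then show "\<phi> s = 0" by (rule assms)
qed

lemma prim_beyond_right:
  assumes "R > 0" "continuous_on UNIV \<phi>" "\<And>s. R < \<bar>s\<bar> \<Longrightarrow> \<phi> s = 0" "R < b"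
  shows "prim \<phi> (- 2 * R) b = prim \<phi> (- 2 * R) (2 * R)"
proof -
  have "prim \<phi> b (2 * R) = 0"
  proof (rule prim_zero)
    fix s assume "min b (2 * R) \<le> s"
    then have "R < \<bar>s\<bar>" using assms(1,4) by linarith
    then show "\<phi> s = 0" by (rule assms)
  qed
  then show ?thesis using prim_combine[OF assms(2), of "- 2 * R" b "2 * R"] by simp
qed

lemma continuous_on_line: "continuous_on UNIV f \<Longrightarrow> continuous_on UNIV (\<lambda>s. f (upd i s x))"
  by (erule continuous_on_comp_UNIV) (intro continuous_intros)

lemma supp_in_spread:
  fixes f :: "real^'n \<Rightarrow> real"
  assumes "R > 0" "supp_in R f"
  shows "supp_in R (spread R i f)"
  unfolding supp_in_def
proof (intro allI impI)
  fix x :: "real^'n" and l assume l: "R < \<bar>x $ l\<bar>"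
  show "spread R i f x = 0"
  proof (cases "l = i")
    case True then show ?thesis using bump_outside[OF assms(1)] l by (simp add: spread_def)
  next
    case False
    have "line_total R i f x = 0" unfolding line_total_def
      by (rule prim_zero) (rule supp_in_upd(2)[OF assms(2) False l])
    then show ?thesis by (simp add: spread_def)
  qed
qed

lemma supp_in_line_potential:
  fixes f :: "real^'n \<Rightarrow> real"
  assumes "R > 0" "supp_in R f" "continuous_on UNIV f"
  shows "supp_in R (line_potential R i f)"
  unfolding supp_in_def
proof (intro allI impI)
  fix x :: "real^'n" and l assume l: "R < \<bar>x $ l\<bar>"
  note cb = continuous_bump[OF assms(1), of UNIV]
  show "line_potential R i f x = 0"
  proof (cases "l = i")
    case True
    have "R < \<bar>x $ i\<bar>" using l True by simp
    then consider "x $ i < - R" | "R < x $ i" by linarith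
    then show ?thesis
    proof cases
      case 1
      have "line_part R i f x = 0" unfolding line_part_def
        by (rule prim_beyond_left[OF assms(1) _ 1]) (rule supp_in_upd(1)[OF assms(2)])
      moreover have "prim (bump R) (- 2 * R) (x $ i) = 0"
        by (rule prim_beyond_left[OF assms(1) _ 1]) (rule bump_outside[OF assms(1)])
      ultimately show ?thesis by (simp add: line_potential_def)
    next
      case 2
      have "line_part R i f x = line_total R i f x" unfolding line_part_def line_total_def
        by (rule prim_beyond_right[OF assms(1) continuous_on_line[OF assms(3)] _ 2]) (rule supp_in_upd(1)[OF assms(2)])
      moreover have "prim (bump R) (- 2 * R) (x $ i) = bump_mass R" unfolding bump_mass_def
        by (rule prim_beyond_right[OF assms(1) cb _ 2]) (rule bump_outside[OF assms(1)])
      ultimately show ?thesis using bump_mass_ge[OF assms(1)] assms(1) by (simp add: line_potential_def)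
    qed
  next
    case False
    have "line_total R i f x = 0" "line_part R i f x = 0" unfolding line_total_def line_part_def
      by (rule prim_zero, rule supp_in_upd(2)[OF assms(2) False l])+
    then show ?thesis by (simp add: line_potential_def)
  qed
qed

lemma line_total_square:
  assumes "R > 0" "continuous_on UNIV f"
  shows "(line_total R i f x)\<^sup>2 \<le> 4 * R * line_total R i (\<lambda>x. (f x)\<^sup>2) x"
  using prim_square[OF continuous_on_line[OF assms(2)], of "- 2 * R" "2 * R" i x] assms(1) by (simp add: line_total_def)

lemma line_part_square:
  assumes "R > 0" "continuous_on UNIV f" "\<bar>x $ i\<bar> \<le> R"
  shows "(line_part R i f x)\<^sup>2 \<le> 4 * R * line_total R i (\<lambda>x. (f x)\<^sup>2) x"
proof -
  have c2: "continuous_on UNIV (\<lambda>x. (f x)\<^sup>2)" using assms by (intro continuous_intros)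
  let ?g = "\<lambda>s. (f (upd i s x))\<^sup>2"
  note cg = continuous_on_line[OF c2, of i x]
  have "(line_part R i f x)\<^sup>2 \<le> (x $ i - (- 2 * R)) * prim ?g (- 2 * R) (x $ i)"
    unfolding line_part_def by (rule prim_square[OF continuous_on_line[OF assms(2)]]) (use assms in linarith)
  also have "\<dots> \<le> (4 * R) * prim ?g (- 2 * R) (2 * R)"
  proof (rule mult_mono)
    have "0 \<le> prim ?g (x $ i) (2 * R)" by (rule prim_nonneg[OF cg]) (use assms in auto)
    then show "prim ?g (- 2 * R) (x $ i) \<le> prim ?g (- 2 * R) (2 * R)"
      using prim_combine[OF cg, of "- 2 * R" "x $ i" "2 * R"] by simp
    show "0 \<le> prim ?g (- 2 * R) (x $ i)" by (rule prim_nonneg[OF cg]) (use assms in auto)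
  qed (use assms in auto)
  finally show ?thesis by (simp add: line_total_def)
qed

abbreviation L2sq :: "(real^'n \<Rightarrow> real) \<Rightarrow> real" where
  "L2sq f \<equiv> \<integral>x. (f x)\<^sup>2 \<partial>lborel"

text \<open>
If \<open>|x\<^sub>i| \<le> R\<close>, then the integral of \<open>f\<^sup>2\<close> over the part \<open>[-2R,2R]\<close> of the line through \<open>x\<close> is an
integral of \<open>f\<^sup>2(x + r e\<^sub>i)\<close> over \<open>r\<close> in a subinterval of \<open>[-3R,3R]\<close>; averaging over \<open>x\<close> costs the length \<open>6R\<close>.
All \<open>L\<^sup>2\<close> bounds for the line operators are pointwise estimates of this form.
\<close>

lemma line_L2:
  fixes f g :: "real^'n \<Rightarrow> real"
  assumes R: "R > 0" and c: "c \<ge> 0" and f: "continuous_on UNIV f" "supp_in R f"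
    and g: "continuous_on UNIV g" "supp_in R g"
    and le: "\<And>x. \<bar>x $ i\<bar> \<le> R \<Longrightarrow> (g x)\<^sup>2 \<le> c * line_total R i (\<lambda>x. (f x)\<^sup>2) x"
  shows "(L2sq g) \<le> 6 * R * c * (L2sq f)"
proof -
  have c2: "continuous_on UNIV (\<lambda>x. (f x)\<^sup>2)" "continuous_on UNIV (\<lambda>x. (g x)\<^sup>2)" using f g by (auto intro: continuous_intros)
  have int: "integrable lborel (\<lambda>x. (f x)\<^sup>2)" "integrable lborel (\<lambda>x. (g x)\<^sup>2)"
    using c2 f g by (auto intro: supp_in_integrable supp_in_square)
  let ?h = "\<lambda>x. prim (\<lambda>r. (f (x + r *\<^sub>R axis i 1))\<^sup>2)"
  have ch: "continuous_on UNIV (\<lambda>r. (f (x + r *\<^sub>R axis i 1))\<^sup>2)" for x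
    by (rule continuous_on_comp_UNIV[OF c2(1)]) (intro continuous_intros)
  have pos: "0 \<le> ?h x a b" if "a \<le> b" for a b x by (rule prim_nonneg[OF ch that]) simp
  have ptw: "(g x)\<^sup>2 \<le> c * ?h x (- 3 * R) (3 * R)" for x
  proof (cases "\<bar>x $ i\<bar> \<le> R")
    case True
    have "line_total R i (\<lambda>x. (f x)\<^sup>2) x = prim (\<lambda>s. (f (upd i s x))\<^sup>2) (x $ i + (- 2 * R - x $ i)) (x $ i + (2 * R - x $ i))"
      by (simp add: line_total_def)
    also have "\<dots> = prim (\<lambda>r. (f (upd i (x $ i + r) x))\<^sup>2) (- 2 * R - x $ i) (2 * R - x $ i)"
      by (rule prim_shift[symmetric])
    also have "\<dots> = ?h x (- 2 * R - x $ i) (2 * R - x $ i)"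
      by (simp add: upd_eq_translate)
    also have "\<dots> \<le> ?h x (- 3 * R) (3 * R)"
    proof -
      have "?h x (- 3 * R) (3 * R) = ?h x (- 3 * R) (- 2 * R - x $ i) + (?h x (- 2 * R - x $ i) (2 * R - x $ i) + ?h x (2 * R - x $ i) (3 * R))"
        by (simp only: prim_combine[OF ch])
      moreover have "0 \<le> ?h x (- 3 * R) (- 2 * R - x $ i)" "0 \<le> ?h x (2 * R - x $ i) (3 * R)"
        using True by (auto intro!: pos)
      ultimately show ?thesis by linarith
    qed
    finally show ?thesis using le[OF True] c by (meson mult_left_mono order_trans)
  next
    case False
    then have "g x = 0" using g(2) unfolding supp_in_def not_le by blast
    moreover have "0 \<le> c * ?h x (- 3 * R) (3 * R)" using R by (intro mult_nonneg_nonneg c pos) auto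
    ultimately show ?thesis by simp
  qed
  have "ennreal (L2sq g) = (\<integral>\<^sup>+x. ennreal ((g x)\<^sup>2) \<partial>lborel)"
    by (rule nn_integral_eq_integral[symmetric]) (use int in auto)
  also have "\<dots> \<le> (\<integral>\<^sup>+x. ennreal c * ennreal (?h x (- 3 * R) (3 * R)) \<partial>lborel)"
    by (intro nn_integral_mono, subst ennreal_mult'[symmetric], rule c, rule ennreal_leI, rule ptw)
  also have "\<dots> = ennreal c * (\<integral>\<^sup>+x. ennreal (?h x (- 3 * R) (3 * R)) \<partial>lborel)"
  proof (rule nn_integral_cmult)
    have "continuous_on UNIV (\<lambda>x. ?h x (- 3 * R) (3 * R))" by (rule continuous_prim_translate[OF c2(1)])
    then have [measurable]: "(\<lambda>x. ?h x (- 3 * R) (3 * R)) \<in> borel_measurable borel"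
      by (rule borel_measurable_continuous_onI)
    show "(\<lambda>x. ennreal (?h x (- 3 * R) (3 * R))) \<in> borel_measurable lborel"
      by measurable
  qed
  also have "\<dots> = ennreal c * (ennreal (3 * R - - 3 * R) * (\<integral>\<^sup>+x. ennreal ((f x)\<^sup>2) \<partial>lborel))"
    using nn_integral_line_average[OF f(1), of "- 3 * R" "3 * R" i] R by simp
  also have "(\<integral>\<^sup>+x. ennreal ((f x)\<^sup>2) \<partial>lborel) = ennreal (L2sq f)"
    by (rule nn_integral_eq_integral) (use int in auto)
  also have "ennreal c * (ennreal (3 * R - - 3 * R) * ennreal (L2sq f)) = ennreal (6 * R * c * (L2sq f))"
    using R c by (simp add: ennreal_mult''[symmetric] mult_ac)
  finally show ?thesis using R c by (simp add: ennreal_le_iff)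
qed

lemma spread_L2:
  fixes f :: "real^'n \<Rightarrow> real"
  assumes R: "R > 0" and f: "continuous_on UNIV f" "supp_in R f"
  shows "(L2sq (spread R i f)) \<le> 384 * (L2sq f)"
proof -
  have "(L2sq (spread R i f)) \<le> 6 * R * (64 / R) * (L2sq f)"
  proof (rule line_L2[OF R _ f continuous_spread[OF R f(1)] supp_in_spread[OF R f(2)]])
    fix x :: "real^'n"
    have "\<bar>bump R (x $ i) / bump_mass R\<bar> \<le> 1 / (R / 4)"
      using bump_nonneg[of R "x $ i"] bump_le_1[of R "x $ i"] bump_mass_ge[OF R] R
      by (simp only: abs_divide) (intro frac_le, auto)
    then have "\<bar>bump R (x $ i) / bump_mass R\<bar>\<^sup>2 \<le> (4 / R)\<^sup>2" by (intro power_mono) auto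
    then have "(spread R i f x)\<^sup>2 \<le> (4 / R)\<^sup>2 * (4 * R * line_total R i (\<lambda>x. (f x)\<^sup>2) x)"
      unfolding spread_def power_mult_distrib using line_total_square[OF R f(1)]
      by (intro mult_mono) (simp_all only: power2_abs zero_le_power2)
    then show "(spread R i f x)\<^sup>2 \<le> 64 / R * line_total R i (\<lambda>x. (f x)\<^sup>2) x"
      using R by (simp add: power2_eq_square)
  qed (use R in auto)
  then show ?thesis using R by simp
qed

lemma spread_deriv_L2:
  fixes f :: "real^'n \<Rightarrow> real"
  assumes R: "R > 0" and f: "continuous_on UNIV f" "supp_in R f"
  shows "(\<integral>x. (bump1 R (x $ i) / bump_mass R * line_total R i f x)\<^sup>2 \<partial>lborel) \<le> 13824 / R\<^sup>2 * (L2sq f)"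
proof -
  let ?g = "\<lambda>x. bump1 R (x $ i) / bump_mass R * line_total R i f x"
  have m0: "bump_mass R \<noteq> 0" using bump_mass_ge[OF R] R by linarith
  have "(L2sq ?g) \<le> 6 * R * (2304 / R ^ 3) * (L2sq f)"
  proof (rule line_L2[OF R _ f])
    show "continuous_on UNIV ?g"
      by (intro continuous_on_mult continuous_on_divide continuous_line_total[OF f(1)] continuous_on_coord continuous_bump1[OF R] continuous_on_const) (use m0 in auto)
    show "supp_in R ?g" by (rule has_pd_supp[OF has_pd_spread_same[OF R] supp_in_spread[OF R f(2)]])
    fix x :: "real^'n"
    have "\<bar>bump1 R (x $ i) / bump_mass R\<bar> \<le> (6 / R) / (R / 4)"
      using bump1_bound[OF R, of "x $ i"] bump_mass_ge[OF R] R
      by (simp only: abs_divide) (intro frac_le, auto)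
    then have "\<bar>bump1 R (x $ i) / bump_mass R\<bar>\<^sup>2 \<le> (24 / R\<^sup>2)\<^sup>2" by (intro power_mono) (auto simp: power2_eq_square)
    then have "(?g x)\<^sup>2 \<le> (24 / R\<^sup>2)\<^sup>2 * (4 * R * line_total R i (\<lambda>x. (f x)\<^sup>2) x)"
      unfolding power_mult_distrib using line_total_square[OF R f(1)]
      by (intro mult_mono) (simp_all only: power2_abs zero_le_power2)
    then show "(?g x)\<^sup>2 \<le> 2304 / R ^ 3 * line_total R i (\<lambda>x. (f x)\<^sup>2) x"
      using R by (simp add: power2_eq_square power3_eq_cube)
  qed (use R in auto)
  then show ?thesis using R by (simp add: power2_eq_square power3_eq_cube)
qed

lemma prim_bump_fraction:
  assumes R: "R > 0" and t: "\<bar>t\<bar> \<le> R"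
  shows "\<bar>prim (bump R) (- 2 * R) t / bump_mass R\<bar> \<le> 1"
proof -
  note c = continuous_bump[OF R, of UNIV]
  have "0 \<le> prim (bump R) (- 2 * R) t" "0 \<le> prim (bump R) t (2 * R)"
    using R t by (auto intro!: prim_nonneg c bump_nonneg)
  moreover have "prim (bump R) (- 2 * R) t + prim (bump R) t (2 * R) = bump_mass R"
    unfolding bump_mass_def by (rule prim_combine[OF c])
  ultimately show ?thesis using bump_mass_ge[OF R] R by (simp add: abs_divide divide_le_eq_1)
qed

lemma line_potential_L2:
  fixes f :: "real^'n \<Rightarrow> real"
  assumes R: "R > 0" and f: "continuous_on UNIV f" "supp_in R f"
  shows "(L2sq (line_potential R i f)) \<le> 96 * R\<^sup>2 * (L2sq f)"
proof -
  have "(L2sq (line_potential R i f)) \<le> 6 * R * (16 * R) * (L2sq f)"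
  proof (rule line_L2[OF R _ f continuous_line_potential[OF R f(1)] supp_in_line_potential[OF R f(2,1)]])
    fix x :: "real^'n" assume x: "\<bar>x $ i\<bar> \<le> R"
    let ?T = "prim (bump R) (- 2 * R) (x $ i) / bump_mass R"
    have "?T\<^sup>2 \<le> 1" using prim_bump_fraction[OF R x] by (simp only: abs_square_le_1)
    then have "(?T * line_total R i f x)\<^sup>2 \<le> 1 * (line_total R i f x)\<^sup>2"
      unfolding power_mult_distrib by (intro mult_right_mono) auto
    moreover have "(line_potential R i f x)\<^sup>2 \<le> 2 * (line_part R i f x)\<^sup>2 + 2 * (?T * line_total R i f x)\<^sup>2"
      unfolding line_potential_def using zero_le_power2[of "line_part R i f x + ?T * line_total R i f x"]
      unfolding power2_sum power2_diff by linarith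
    ultimately show "(line_potential R i f x)\<^sup>2 \<le> 16 * R * line_total R i (\<lambda>x. (f x)\<^sup>2) x"
      using line_total_square[OF R f(1), of i x] line_part_square[OF R f(1) x] by linarith
  qed (use R in auto)
  then show ?thesis by (simp add: power2_eq_square)
qed

text \<open>
Bounds that respect scaling: on a cube of size \<open>R\<close> a function with gradient of size \<open>\<surd>d\<close> in \<open>L\<^sup>2\<close> should
itself be of size \<open>R \<surd>d\<close>.  Spreading preserves this up to a constant.
\<close>

definition tame :: "real \<Rightarrow> real \<Rightarrow> (real^'n \<Rightarrow> real) \<Rightarrow> bool" where
  "tame R d f \<longleftrightarrow> continuous_on UNIV f \<and> supp_in R f \<and> (L2sq f) \<le> R\<^sup>2 * d \<and>
     (\<forall>j. \<exists>f'. continuous_on UNIV f' \<and> has_pd j f f' \<and> (L2sq f') \<le> d)"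

text \<open>
One component of the field \<open>W\<close> whose divergence is to be prescribed: \<open>A\<close> bounds it uniformly, \<open>D\<close> bounds
the squared \<open>L\<^sup>2\<close> norms of its partial derivatives.
\<close>

definition piece :: "real \<Rightarrow> real \<Rightarrow> real \<Rightarrow> (real^'n \<Rightarrow> real) \<Rightarrow> bool" where
  "piece R A D W \<longleftrightarrow> continuous_on UNIV W \<and> supp_in R W \<and> (\<forall>x. \<bar>W x\<bar> \<le> A) \<and>
     (\<forall>j. \<exists>W'. continuous_on UNIV W' \<and> has_pd j W W' \<and> (L2sq W') \<le> D)"

lemma tame_nonneg:
  fixes f :: "real^'n \<Rightarrow> real"
  shows "tame R d f \<Longrightarrow> 0 \<le> d"
proof -
  assume "tame R d f"
  then obtain f' :: "real^'n \<Rightarrow> real" where "(L2sq f') \<le> d" unfolding tame_def by blast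
  moreover have "0 \<le> (L2sq f')" by simp
  ultimately show ?thesis by linarith
qed

lemma piece_weaken:
  assumes "piece R A D W" "A \<le> A'" "D \<le> D'"
  shows "piece R A' D' W"
proof -
  have "\<bar>W x\<bar> \<le> A'" for x using assms unfolding piece_def by (meson order_trans)
  moreover have "\<exists>W'. continuous_on UNIV W' \<and> has_pd j W W' \<and> (L2sq W') \<le> D'" for j
  proof -
    obtain W' where "continuous_on UNIV W'" "has_pd j W W'" "(L2sq W') \<le> D"
      using assms(1) unfolding piece_def by blast
    then show ?thesis using assms(3) by (intro exI[of _ W']) simp
  qed
  ultimately show ?thesis using assms(1) unfolding piece_def by blast
qed

text \<open>
In direction \<open>i\<close> the derivative falls on the bump alone; this costs \<open>1/R\<close> in comparison with \<open>f\<close>, as the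
scaling of \<open>tame\<close> allows.  The constant is \<open>24\<^sup>2 * 24\<close>: the normalised bump has slope at most \<open>24/R\<^sup>2\<close>, and
\<open>line_L2\<close> contributes \<open>4R * 6R\<close>.
\<close>

lemma tame_spread:
  fixes f :: "real^'n \<Rightarrow> real"
  assumes R: "R > 0" and t: "tame R d f"
  shows "tame R (13824 * d) (spread R i f)"
proof -
  from t have f: "continuous_on UNIV f" "supp_in R f" and N: "(L2sq f) \<le> R\<^sup>2 * d"
    and D: "\<And>j. \<exists>f'. continuous_on UNIV f' \<and> has_pd j f f' \<and> (L2sq f') \<le> d"
    unfolding tame_def by auto
  have m0: "bump_mass R \<noteq> 0" using bump_mass_ge[OF R] R by linarith
  have d: "0 \<le> d" by (rule tame_nonneg[OF t])
  have "0 \<le> R\<^sup>2 * d" using d by simp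
  have "(L2sq (spread R i f)) \<le> 384 * (R\<^sup>2 * d)" using spread_L2[OF R f, of i] N by linarith
  also have "\<dots> \<le> 13824 * (R\<^sup>2 * d)" using \<open>0 \<le> R\<^sup>2 * d\<close> by linarith
  finally have 1: "(L2sq (spread R i f)) \<le> R\<^sup>2 * (13824 * d)" by (simp add: mult_ac)
  have 2: "\<exists>f'. continuous_on UNIV f' \<and> has_pd j (spread R i f) f' \<and> (L2sq f') \<le> 13824 * d" for j
  proof (cases "j = i")
    case True
    have "continuous_on UNIV (\<lambda>x. bump1 R (x $ i) / bump_mass R * line_total R i f x)"
      by (intro continuous_on_mult continuous_on_divide continuous_line_total[OF f(1)] continuous_on_coord continuous_bump1[OF R] continuous_on_const) (use m0 in auto)
    moreover have "13824 / R\<^sup>2 * (L2sq f) \<le> 13824 / R\<^sup>2 * (R\<^sup>2 * d)"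
      by (intro mult_left_mono N) auto
    then have "(\<integral>x. (bump1 R (x $ i) / bump_mass R * line_total R i f x)\<^sup>2 \<partial>lborel) \<le> 13824 * d"
      using spread_deriv_L2[OF R f, of i] R by simp
    ultimately show ?thesis using has_pd_spread_same[OF R, of i f] True by blast
  next
    case False
    obtain f' where f': "continuous_on UNIV f'" "has_pd j f f'" "(L2sq f') \<le> d" using D by blast
    have "(L2sq (spread R i f')) \<le> 13824 * d"
      using spread_L2[OF R f'(1) has_pd_supp[OF f'(2) f(2)], of i] f'(3) d by linarith
    then show ?thesis using has_pd_spread[OF R f(1) f'(1,2) False] continuous_spread[OF R f'(1), of i] by blast
  qed
  show ?thesis unfolding tame_def using 1 2 continuous_spread[OF R f(1)] supp_in_spread[OF R f(2)] by blast
qed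

text \<open>
The uniform bound is inherited from integrals of \<open>f\<close> along lines, not from the size of \<open>f\<close>; this is how
cancellation of \<open>u\<close> along segments enters.
\<close>

lemma piece_line_potential:
  fixes f :: "real^'n \<Rightarrow> real"
  assumes R: "R > 0" and t: "tame R d f"
    and I: "\<And>x. \<bar>line_total R i f x\<bar> \<le> a" and P: "\<And>x. \<bar>x $ i\<bar> \<le> R \<Longrightarrow> \<bar>line_part R i f x\<bar> \<le> a"
  shows "piece R (2 * a) (770 * (R\<^sup>2 * d)) (line_potential R i f)"
proof -
  from t have f: "continuous_on UNIV f" "supp_in R f" and N: "(L2sq f) \<le> R\<^sup>2 * d"
    and D: "\<And>j. \<exists>f'. continuous_on UNIV f' \<and> has_pd j f f' \<and> (L2sq f') \<le> d"
    unfolding tame_def by auto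
  have a: "0 \<le> a" using I by (meson abs_ge_zero order_trans)
  have d: "0 \<le> d" by (rule tame_nonneg[OF t])
  note sH = supp_in_line_potential[OF R f(2,1), of i]
  note cE = continuous_spread[OF R f(1), of i]
  note sE = supp_in_spread[OF R f(2), of i]
  have sup: "\<bar>line_potential R i f x\<bar> \<le> 2 * a" for x
  proof (cases "\<bar>x $ i\<bar> \<le> R")
    case True
    have "\<bar>prim (bump R) (- 2 * R) (x $ i) / bump_mass R * line_total R i f x\<bar> \<le> 1 * a"
      unfolding abs_mult by (intro mult_mono prim_bump_fraction[OF R True] I) auto
    then show ?thesis unfolding line_potential_def using P[OF True] by linarith
  next
    case False
    then have "line_potential R i f x = 0" using sH unfolding supp_in_def not_le by blast
    then show ?thesis using a by simp
  qed
  have 2: "\<exists>f'. continuous_on UNIV f' \<and> has_pd j (line_potential R i f) f' \<and> (L2sq f') \<le> 770 * (R\<^sup>2 * d)" for j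
  proof (cases "j = i")
    case True
    let ?g = "\<lambda>x. f x - spread R i f x"
    have c: "continuous_on UNIV ?g" by (intro continuous_on_diff f(1) cE)
    have i1: "integrable lborel (\<lambda>x. (f x)\<^sup>2)" "integrable lborel (\<lambda>x. (spread R i f x)\<^sup>2)" "integrable lborel (\<lambda>x. (?g x)\<^sup>2)"
      by (auto intro!: supp_in_integrable supp_in_square sE f(2) supp_in_diff continuous_on_power f(1) cE c)
    have "(L2sq ?g) \<le> (\<integral>x. 2 * (f x)\<^sup>2 + 2 * (spread R i f x)\<^sup>2 \<partial>lborel)"
    proof (rule integral_mono)
      fix x show "(?g x)\<^sup>2 \<le> 2 * (f x)\<^sup>2 + 2 * (spread R i f x)\<^sup>2"
        using zero_le_power2[of "f x + spread R i f x"] unfolding power2_sum power2_diff by linarith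
    qed (use i1 in auto)
    also have "\<dots> = 2 * (L2sq f) + 2 * (L2sq (spread R i f))" using i1 by simp
    also have "\<dots> \<le> 770 * (R\<^sup>2 * d)" using spread_L2[OF R f, of i] N by linarith
    finally show ?thesis using c has_pd_line_potential_same[OF R f(1), of i] True by blast
  next
    case False
    obtain f' where f': "continuous_on UNIV f'" "has_pd j f f'" "(L2sq f') \<le> d" using D by blast
    have "96 * R\<^sup>2 * (L2sq f') \<le> 96 * R\<^sup>2 * d" by (intro mult_left_mono f'(3)) auto
    moreover have "0 \<le> R\<^sup>2 * d" using d by simp
    ultimately have "(L2sq (line_potential R i f')) \<le> 770 * (R\<^sup>2 * d)"
      using line_potential_L2[OF R f'(1) has_pd_supp[OF f'(2) f(2)], of i] by linarith
    then show ?thesis using has_pd_line_potential[OF R f(1) f'(1,2) False] continuous_line_potential[OF R f'(1), of i] by blast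
  qed
  show ?thesis unfolding piece_def using sup 2 continuous_line_potential[OF R f(1)] sH by blast
qed

lemma line_sup:
  assumes R: "R > 0" and f: "continuous_on UNIV f" and a: "\<And>x. \<bar>f x\<bar> \<le> a"
  shows "\<bar>line_total R i f x\<bar> \<le> 4 * R * a" "\<bar>x $ i\<bar> \<le> R \<Longrightarrow> \<bar>line_part R i f x\<bar> \<le> 4 * R * a"
proof -
  have a0: "0 \<le> a" using a by (meson abs_ge_zero order_trans)
  show "\<bar>line_total R i f x\<bar> \<le> 4 * R * a"
    using prim_bound[OF continuous_on_line[OF f], of "- 2 * R" "2 * R" i x a] a R by (simp add: line_total_def)
  assume x: "\<bar>x $ i\<bar> \<le> R"
  have "\<bar>line_part R i f x\<bar> \<le> \<bar>x $ i - - 2 * R\<bar> * a"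
    unfolding line_part_def by (rule prim_bound[OF continuous_on_line[OF f]]) (rule a)
  also have "\<dots> \<le> (4 * R) * a" using x a0 by (intro mult_right_mono) auto
  finally show "\<bar>line_part R i f x\<bar> \<le> 4 * R * a" .
qed

lemma spread_sup:
  assumes R: "R > 0" and I: "\<And>x. \<bar>line_total R i f x\<bar> \<le> a"
  shows "\<bar>spread R i f x\<bar> \<le> 4 * a / R"
proof -
  have "\<bar>bump R (x $ i) / bump_mass R\<bar> \<le> 1 / (R / 4)"
    using bump_nonneg[of R "x $ i"] bump_le_1[of R "x $ i"] bump_mass_ge[OF R] R
    by (simp only: abs_divide) (intro frac_le, auto)
  then have "\<bar>spread R i f x\<bar> \<le> (1 / (R / 4)) * a"
    unfolding spread_def abs_mult using R by (intro mult_mono I) auto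
  then show ?thesis by simp
qed

lemma line_total_pull_out:
  assumes "\<And>s. c (upd k s x) = c x"
  shows "line_total R k (\<lambda>x. c x * g x) x = c x * line_total R k g x"
  unfolding line_total_def assms by (rule prim_cmult)

text \<open>
Spreading in the directions \<open>i\<close>, \<open>j\<close>, \<open>k\<close> in turn writes \<open>f\<close> as three exact derivatives plus a function
whose profile is fixed in each direction, hence a multiple of the product of the bumps.  Only the first step
needs line integrals of \<open>f\<close> itself: after it the function is bounded by \<open>4a/R\<close>, and integrating over a line
segment of length \<open>4R\<close> gives \<open>16a\<close>.  A second round gives \<open>256a\<close>, and a potential is at most twice that.
\<close>

lemma divergence_decomposition:
  fixes f :: "real^'n \<Rightarrow> real"
  assumes R: "R > 0" and t: "tame R d f"
    and I: "\<And>x. \<bar>line_total R i f x\<bar> \<le> a" and P: "\<And>x. \<bar>x $ i\<bar> \<le> R \<Longrightarrow> \<bar>line_part R i f x\<bar> \<le> a"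
    and ijk: "i \<noteq> j" "i \<noteq> k" "j \<noteq> k" "\<And>l. l = i \<or> l = j \<or> l = k"
  obtains W1 W2 W3 w1 w2 w3 \<kappa> where
    "piece R (512 * a) (770 * 13824\<^sup>2 * (R\<^sup>2 * d)) W1" "has_pd i W1 w1" "continuous_on UNIV w1"
    "piece R (512 * a) (770 * 13824\<^sup>2 * (R\<^sup>2 * d)) W2" "has_pd j W2 w2" "continuous_on UNIV w2"
    "piece R (512 * a) (770 * 13824\<^sup>2 * (R\<^sup>2 * d)) W3" "has_pd k W3 w3" "continuous_on UNIV w3"
    "\<And>x. f x = w1 x + w2 x + w3 x + \<kappa> * (bump R (x $ i) * bump R (x $ j) * bump R (x $ k))"
proof -
  have a: "0 \<le> a" using I by (meson abs_ge_zero order_trans)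
  define f1 where "f1 = spread R i f"
  define f2 where "f2 = spread R j f1"
  have t1: "tame R (13824 * d) f1" unfolding f1_def by (rule tame_spread[OF R t])
  have t2: "tame R (13824 * (13824 * d)) f2" unfolding f2_def by (rule tame_spread[OF R t1])
  have c: "continuous_on UNIV f" "continuous_on UNIV f1" "continuous_on UNIV f2"
    using t t1 t2 unfolding tame_def by auto
  have d: "0 \<le> d" by (rule tame_nonneg[OF t])
  have rd: "0 \<le> R\<^sup>2 * d" using d by simp
  have b1: "\<bar>f1 x\<bar> \<le> 4 * a / R" for x unfolding f1_def by (rule spread_sup[OF R I])
  have I1: "\<bar>line_total R j f1 x\<bar> \<le> 16 * a" for x using line_sup(1)[OF R c(2) b1, of j x] R by simp
  have P1: "\<bar>line_part R j f1 x\<bar> \<le> 16 * a" if "\<bar>x $ j\<bar> \<le> R" for x using line_sup(2)[OF R c(2) b1 that] R by simp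
  have b2: "\<bar>f2 x\<bar> \<le> 64 * a / R" for x unfolding f2_def using spread_sup[OF R I1, of x] by simp
  have I2: "\<bar>line_total R k f2 x\<bar> \<le> 256 * a" for x using line_sup(1)[OF R c(3) b2, of k x] R by simp
  have P2: "\<bar>line_part R k f2 x\<bar> \<le> 256 * a" if "\<bar>x $ k\<bar> \<le> R" for x using line_sup(2)[OF R c(3) b2 that] R by simp
  have p1: "piece R (512 * a) (770 * 13824\<^sup>2 * (R\<^sup>2 * d)) (line_potential R i f)"
    by (rule piece_weaken[OF piece_line_potential[OF R t I P]]) (use a rd d in auto)
  have p2: "piece R (512 * a) (770 * 13824\<^sup>2 * (R\<^sup>2 * d)) (line_potential R j f1)"
    by (rule piece_weaken[OF piece_line_potential[OF R t1 I1 P1]]) (use a rd d in \<open>auto simp: algebra_simps\<close>)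
  have p3: "piece R (512 * a) (770 * 13824\<^sup>2 * (R\<^sup>2 * d)) (line_potential R k f2)"
    by (rule piece_weaken[OF piece_line_potential[OF R t2 I2 P2]]) (use a rd d in \<open>auto simp: algebra_simps\<close>)
  define N where "N = line_total R k (line_total R j (line_total R i f))"
  have N: "N x = N 0" for x
  proof -
    have "upd i s1 (upd j s2 (upd k s3 x)) = upd i s1 (upd j s2 (upd k s3 0))" for s1 s2 s3
      using ijk(4) by (auto simp: vec_eq_iff upd_nth)
    then show ?thesis unfolding N_def line_total_def by simp
  qed
  define m where "m = bump_mass R"
  have f3: "spread R k f2 x = N 0 / m ^ 3 * (bump R (x $ i) * bump R (x $ j) * bump R (x $ k))" for x
  proof -
    have L1: "line_total R j f1 = (\<lambda>x. bump R (x $ i) / m * line_total R j (line_total R i f) x)"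
      unfolding f1_def spread_def[abs_def] m_def
      by (rule ext, rule line_total_pull_out) (use ijk in \<open>simp add: upd_nth\<close>)
    have "f2 = (\<lambda>x. bump R (x $ j) / m * (bump R (x $ i) / m) * line_total R j (line_total R i f) x)"
      unfolding f2_def spread_def[abs_def] L1 m_def by (simp add: mult.assoc)
    then have "line_total R k f2 x = bump R (x $ j) / m * (bump R (x $ i) / m) * N x"
      unfolding N_def by (simp only:) (rule line_total_pull_out, use ijk in \<open>simp add: upd_nth\<close>)
    then show ?thesis unfolding spread_def m_def[symmetric] N[of x] by (simp add: power3_eq_cube mult_ac)
  qed
  show thesis
  proof (rule that[OF p1 has_pd_line_potential_same[OF R c(1)] _ p2 has_pd_line_potential_same[OF R c(2)] _ p3 has_pd_line_potential_same[OF R c(3)]])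
    fix x
    show "f x = (f x - spread R i f x) + (f1 x - spread R j f1 x) + (f2 x - spread R k f2 x)
      + N 0 / m ^ 3 * (bump R (x $ i) * bump R (x $ j) * bump R (x $ k))"
      unfolding f3[symmetric] by (simp add: f1_def f2_def)
  qed (auto intro!: continuous_on_diff c continuous_spread R)
qed

section \<open>Product cutoffs and weak convergence\<close>

lemma Cauchy_Schwarz_integral:
  fixes f g :: "'a \<Rightarrow> real"
  assumes [measurable]: "f \<in> borel_measurable M" "g \<in> borel_measurable M"
    and f2: "integrable M (\<lambda>x. (f x)\<^sup>2)" and g2: "integrable M (\<lambda>x. (g x)\<^sup>2)"
  shows "integrable M (\<lambda>x. f x * g x)"
    and "(\<integral>x. \<bar>f x * g x\<bar> \<partial>M) \<le> sqrt (\<integral>x. (f x)\<^sup>2 \<partial>M) * sqrt (\<integral>x. (g x)\<^sup>2 \<partial>M)"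
    and "\<bar>\<integral>x. f x * g x \<partial>M\<bar> \<le> sqrt (\<integral>x. (f x)\<^sup>2 \<partial>M) * sqrt (\<integral>x. (g x)\<^sup>2 \<partial>M)"
proof -
  let ?A = "\<integral>x. (f x)\<^sup>2 \<partial>M" and ?B = "\<integral>x. (g x)\<^sup>2 \<partial>M"
  have AB: "0 \<le> ?A" "0 \<le> ?B" by simp_all
  show int: "integrable M (\<lambda>x. f x * g x)"
  proof (rule Bochner_Integration.integrable_bound[of M "\<lambda>x. (f x)\<^sup>2 + (g x)\<^sup>2"])
    show "AE x in M. norm (f x * g x) \<le> norm ((f x)\<^sup>2 + (g x)\<^sup>2)"
    proof (rule AE_I2)
      fix x
      have "2 * \<bar>f x\<bar> * \<bar>g x\<bar> \<le> (f x)\<^sup>2 + (g x)\<^sup>2"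
        using zero_le_power2[of "\<bar>f x\<bar> - \<bar>g x\<bar>"] by (simp add: power2_diff)
      moreover have "0 \<le> \<bar>f x\<bar> * \<bar>g x\<bar>" by simp
      moreover have "norm (f x * g x) = \<bar>f x\<bar> * \<bar>g x\<bar>" "norm ((f x)\<^sup>2 + (g x)\<^sup>2) = (f x)\<^sup>2 + (g x)\<^sup>2"
        by (simp_all add: abs_mult)
      ultimately show "norm (f x * g x) \<le> norm ((f x)\<^sup>2 + (g x)\<^sup>2)" by linarith
    qed
  qed (use f2 g2 in auto)
  have nnf: "(\<integral>\<^sup>+x. (ennreal \<bar>f x\<bar>)\<^sup>2 \<partial>M) = ennreal ?A" "(\<integral>\<^sup>+x. (ennreal \<bar>g x\<bar>)\<^sup>2 \<partial>M) = ennreal ?B"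
    using nn_integral_eq_integral[OF f2] nn_integral_eq_integral[OF g2] by (simp_all add: ennreal_power)
  have "(\<integral>\<^sup>+x. ennreal \<bar>f x\<bar> * ennreal \<bar>g x\<bar> \<partial>M) = ennreal (\<integral>x. \<bar>f x * g x\<bar> \<partial>M)"
    using nn_integral_eq_integral[OF integrable_abs[OF int]] by (simp add: ennreal_mult' abs_mult)
  moreover have "(\<integral>\<^sup>+x. ennreal \<bar>f x\<bar> * ennreal \<bar>g x\<bar> \<partial>M)\<^sup>2 \<le> ennreal ?A * ennreal ?B"
    using Cauchy_Schwarz_nn_integral[of "\<lambda>x. ennreal \<bar>f x\<bar>" M "\<lambda>x. ennreal \<bar>g x\<bar>"] nnf by simp
  ultimately have "ennreal ((\<integral>x. \<bar>f x * g x\<bar> \<partial>M)\<^sup>2) \<le> ennreal (?A * ?B)"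
    by (simp add: ennreal_power ennreal_mult')
  then have "(\<integral>x. \<bar>f x * g x\<bar> \<partial>M)\<^sup>2 \<le> ?A * ?B"
    using AB by (subst (asm) ennreal_le_iff) auto
  then show le: "(\<integral>x. \<bar>f x * g x\<bar> \<partial>M) \<le> sqrt ?A * sqrt ?B"
    by (metis real_le_rsqrt real_sqrt_mult)
  have "\<bar>\<integral>x. f x * g x \<partial>M\<bar> \<le> (\<integral>x. \<bar>f x * g x\<bar> \<partial>M)" by (rule integral_abs_bound)
  with le show "\<bar>\<integral>x. f x * g x \<partial>M\<bar> \<le> sqrt ?A * sqrt ?B" by linarith
qed

text \<open>
The product rule needs only the factor in direction \<open>j\<close>, since the others do not vary in that direction.
\<close>

lemma has_pd_prod_coord:
  assumes "\<And>l t. (a l has_real_derivative a' l t) (at t)"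
  shows "has_pd j (\<lambda>x::real^'n. \<Prod>l\<in>UNIV. a l (x $ l)) (\<lambda>x. \<Prod>l\<in>UNIV. (if l = j then a' l else a l) (x $ l))"
proof -
  have split: "(\<Prod>l\<in>UNIV. h l) = h j * (\<Prod>l\<in>UNIV - {j}. h l)" for h :: "'n \<Rightarrow> real"
    by (rule prod.remove) auto
  have "has_pd j (\<lambda>x::real^'n. \<Prod>l\<in>UNIV - {j}. a l (x $ l)) (\<lambda>x. 0)"
    by (rule has_pd_indep) (auto intro!: prod.cong simp: axis_def)
  from has_pd_mult[OF has_pd_coord[OF assms, of j j] this]
  show ?thesis unfolding split by (auto elim!: has_pd_cong intro!: prod.cong)
qed

text \<open>
\<open>cutoff1 R i\<close> and \<open>cutoff2 R i j\<close> are the partial derivatives \<open>\<partial>\<^sub>i\<close> and \<open>\<partial>\<^sub>j\<partial>\<^sub>i\<close> of the product cutoff.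
\<close>

definition cutoff :: "real \<Rightarrow> real^'n \<Rightarrow> real" where
  "cutoff R x = (\<Prod>l\<in>UNIV. bump R (x $ l))"

definition cutoff1 :: "real \<Rightarrow> 'n \<Rightarrow> real^'n \<Rightarrow> real" where
  "cutoff1 R i x = (\<Prod>l\<in>UNIV. (if l = i then bump1 R else bump R) (x $ l))"

definition cutoff2 :: "real \<Rightarrow> 'n \<Rightarrow> 'n \<Rightarrow> real^'n \<Rightarrow> real" where
  "cutoff2 R i j x = (\<Prod>l\<in>UNIV. (if l = j then (if l = i then bump2 R else bump1 R)
      else (if l = i then bump1 R else bump R)) (x $ l))"

lemma cutoff_nonneg: "0 \<le> (cutoff R x :: real)"
  unfolding cutoff_def by (intro prod_nonneg) (simp add: bump_nonneg)

lemma cutoff_le_1: "(cutoff R x :: real) \<le> 1"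
  unfolding cutoff_def by (intro prod_le_1) (simp add: bump_nonneg bump_le_1)

context
  fixes R :: real
  assumes R: "R > 0"
begin

lemma has_pd_cutoff: "has_pd i (cutoff R :: real^'n \<Rightarrow> real) (cutoff1 R i)"
  unfolding cutoff_def[abs_def] cutoff1_def[abs_def] by (rule has_pd_prod_coord) (rule bump_derivative[OF R])

lemma has_pd_cutoff1: "has_pd j (cutoff1 R i :: real^'n \<Rightarrow> real) (cutoff2 R i j)"
proof -
  have "((if l = i then bump1 R else bump R) has_real_derivative (if l = i then bump2 R else bump1 R) t) (at t)" for l t
    using bump_derivative[OF R] bump1_derivative[OF R] by simp
  from has_pd_prod_coord[of "\<lambda>l. if l = i then bump1 R else bump R" "\<lambda>l. if l = i then bump2 R else bump1 R", OF this]
  show ?thesis unfolding cutoff1_def[abs_def] cutoff2_def[abs_def] .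
qed

lemma continuous_on_prod_coord:
  assumes "\<And>l. continuous_on UNIV (a l :: real \<Rightarrow> real)"
  shows "continuous_on UNIV (\<lambda>x::real^'n. \<Prod>l\<in>UNIV. a l (x $ l))"
  by (intro continuous_on_prod continuous_on_coord assms)

lemma continuous_cutoff: "continuous_on UNIV (cutoff R :: real^'n \<Rightarrow> real)"
  unfolding cutoff_def[abs_def] by (intro continuous_on_prod_coord continuous_bump R)

lemma continuous_cutoff1: "continuous_on UNIV (cutoff1 R i :: real^'n \<Rightarrow> real)"
  unfolding cutoff1_def[abs_def]
  by (intro continuous_on_prod_coord) (simp add: continuous_bump continuous_bump1 R)

lemma continuous_cutoff2: "continuous_on UNIV (cutoff2 R i j :: real^'n \<Rightarrow> real)"
  unfolding cutoff2_def[abs_def]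
  by (intro continuous_on_prod_coord) (simp add: continuous_bump continuous_bump1 continuous_bump2 R)

lemma supp_in_cutoff: "supp_in R (cutoff R :: real^'n \<Rightarrow> real)"
  unfolding supp_in_def cutoff_def by (metis UNIV_I finite bump_outside(1)[OF R] prod_zero)

lemma supp_in_cutoff1: "supp_in R (cutoff1 R i :: real^'n \<Rightarrow> real)"
  by (rule has_pd_supp[OF has_pd_cutoff supp_in_cutoff])

lemma cutoff1_bound: "\<bar>cutoff1 R i (x::real^'n)\<bar> \<le> 6 / R"
proof -
  have "\<bar>cutoff1 R i x\<bar> = (\<Prod>l\<in>UNIV. \<bar>(if l = i then bump1 R else bump R) (x $ l)\<bar>)"
    unfolding cutoff1_def by (rule abs_prod)
  also have "\<dots> \<le> (\<Prod>l\<in>UNIV. if l = i then 6 / R else 1)"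
    by (intro prod_mono) (use bump1_bound[OF R] bump_nonneg[of R] bump_le_1[of R] in \<open>auto simp: abs_of_nonneg\<close>)
  also have "\<dots> = 6 / R" by simp
  finally show ?thesis .
qed

lemma cutoff2_bound: "\<bar>cutoff2 R i j (x::real^'n)\<bar> \<le> 36 / R\<^sup>2"
proof -
  let ?c = "\<lambda>i l. if l = i then 6 / R else 1"
  have "\<bar>cutoff2 R i j x\<bar> = (\<Prod>l\<in>UNIV. \<bar>(if l = j then (if l = i then bump2 R else bump1 R)
      else (if l = i then bump1 R else bump R)) (x $ l)\<bar>)"
    unfolding cutoff2_def by (rule abs_prod)
  also have "\<dots> \<le> (\<Prod>l\<in>UNIV. ?c i l * ?c j l)"
  proof (intro prod_mono conjI)
    fix l
    have "\<bar>bump2 R (x $ l)\<bar> \<le> 6 / R * (6 / R)"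
      using bump2_bound[OF R, of "x $ l"] R by (simp add: power2_eq_square field_simps)
    then show "\<bar>(if l = j then (if l = i then bump2 R else bump1 R)
      else (if l = i then bump1 R else bump R)) (x $ l)\<bar> \<le> ?c i l * ?c j l"
      using bump1_bound[OF R, of "x $ l"] bump_nonneg[of R "x $ l"] bump_le_1[of R "x $ l"] by (auto simp: abs_of_nonneg)
  qed simp
  also have "\<dots> = (\<Prod>l\<in>UNIV. ?c i l) * (\<Prod>l\<in>UNIV. ?c j l)" by (rule prod.distrib)
  also have "\<dots> = 36 / R\<^sup>2" by (simp add: power2_eq_square)
  finally show ?thesis .
qed

end

lemma cutoff_tendsto_1: "(\<lambda>n. cutoff (real (Suc n)) (x::real^'n)) \<longlonglongrightarrow> 1"
proof -
  have "(\<lambda>n. bump (real (Suc n)) t) \<longlonglongrightarrow> 1" for t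
  proof -
    have "(\<lambda>n. t * inverse (real (Suc n))) \<longlonglongrightarrow> t * 0"
      by (intro tendsto_mult tendsto_const LIMSEQ_inverse_real_of_nat)
    then have L: "(\<lambda>n. t / real (Suc n)) \<longlonglongrightarrow> 0" by (simp only: divide_inverse mult_zero_right)
    have "(\<lambda>n. (max 0 (1 - (t / real (Suc n))\<^sup>2)) ^ 3) \<longlonglongrightarrow> (max 0 (1 - 0\<^sup>2)) ^ 3"
      by (intro tendsto_intros L)
    then show ?thesis by (simp add: bump_def)
  qed
  then have "(\<lambda>n. cutoff (real (Suc n)) x) \<longlonglongrightarrow> (\<Prod>l\<in>(UNIV::'n set). 1)"
    unfolding cutoff_def by (intro tendsto_prod)
  then show ?thesis by simp
qed

lemma cutoff_tail_small:
  fixes F :: "real^'n \<Rightarrow> real"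
  assumes F: "continuous_on UNIV F" "integrable lborel (\<lambda>x. (F x)\<^sup>2)" and "\<delta> > 0"
  obtains K where "K > 0" "(\<integral>x. ((1 - cutoff K x) * F x)\<^sup>2 \<partial>lborel) \<le> \<delta>"
    "integrable lborel (\<lambda>x. ((1 - cutoff K x) * F x)\<^sup>2)"
proof -
  have [measurable]: "F \<in> borel_measurable borel" "\<And>n. cutoff (real (Suc n)) \<in> borel_measurable (borel :: (real^'n) measure)"
    using F by (auto intro!: borel_measurable_continuous_onI continuous_cutoff)
  let ?f = "\<lambda>n x. ((1 - cutoff (real (Suc n)) x) * F x)\<^sup>2"
  have bd: "norm (?f n x) \<le> (F x)\<^sup>2" for n x
  proof -
    have "\<bar>1 - cutoff (real (Suc n)) x\<bar> \<le> 1" using cutoff_nonneg[of "real (Suc n)" x] cutoff_le_1[of "real (Suc n)" x] by simp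
    then have "(1 - cutoff (real (Suc n)) x)\<^sup>2 \<le> 1" by (simp only: abs_square_le_1)
    then have "(1 - cutoff (real (Suc n)) x)\<^sup>2 * (F x)\<^sup>2 \<le> 1 * (F x)\<^sup>2" by (intro mult_right_mono) auto
    then show ?thesis by (simp add: power_mult_distrib)
  qed
  have "(\<lambda>n. \<integral>x. ?f n x \<partial>lborel) \<longlonglongrightarrow> (\<integral>x. 0 \<partial>(lborel :: (real^'n) measure))"
  proof (rule integral_dominated_convergence[OF _ _ F(2)])
    show "AE x in lborel. (\<lambda>n. ?f n x) \<longlonglongrightarrow> 0"
    proof (rule AE_I2)
      fix x
      have "(\<lambda>n. ?f n x) \<longlonglongrightarrow> ((1 - 1) * F x)\<^sup>2" by (intro tendsto_intros cutoff_tendsto_1)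
      then show "(\<lambda>n. ?f n x) \<longlonglongrightarrow> 0" by simp
    qed
    show "AE x in lborel. norm (?f n x) \<le> (F x)\<^sup>2" for n using bd by blast
    show "?f n \<in> borel_measurable lborel" for n by measurable
  qed simp
  then have "\<forall>\<^sub>F n in sequentially. (\<integral>x. ?f n x \<partial>lborel) < \<delta>"
    using assms(3) by (simp add: order_tendstoD)
  then obtain n where n: "(\<integral>x. ?f n x \<partial>lborel) < \<delta>" by (meson eventually_happens sequentially_bot)
  have "integrable lborel (?f n)"
  proof (rule Bochner_Integration.integrable_bound[OF F(2)])
    show "?f n \<in> borel_measurable lborel" by measurable
    show "AE x in lborel. norm (?f n x) \<le> norm ((F x)\<^sup>2)" using bd by simp
  qed
  then show thesis using that[of "real (Suc n)"] n by auto
qed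

text \<open>
By parts, the integral is minus that of \<open>F \<partial>\<^sub>jW\<close>.  The point is that \<open>C\<close> depends on \<open>F\<close>, \<open>D\<close> and \<open>\<epsilon>\<close>
only: for functions \<open>W\<close> with \<open>\<partial>\<^sub>jW\<close> bounded in \<open>L\<^sup>2\<close> and
\<open>A\<close> tending to \<open>0\<close>, the pairing of \<open>\<partial>\<^sub>jW\<close> with a fixed \<open>F\<close> in \<open>L\<^sup>2\<close> tends to \<open>0\<close>.  The part of \<open>F\<close> outside
a large cube is small in \<open>L\<^sup>2\<close>; for the part inside, the derivative is moved back from \<open>W\<close> to the localised
\<open>F\<close>, which costs a multiple of \<open>A\<close>.
\<close>

lemma weak_convergence_bound:
  fixes F :: "real^'n \<Rightarrow> real"
  assumes F: "continuous_on UNIV F" "continuous_on UNIV F'" "has_pd j F F'" "integrable lborel (\<lambda>x. (F x)\<^sup>2)"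
    and D: "D \<ge> 0" and "\<epsilon> > 0"
  obtains C where "C \<ge> 0" "\<And>R A (W :: real^'n \<Rightarrow> real). piece R A D W \<Longrightarrow> \<bar>\<integral>x. F' x * W x \<partial>lborel\<bar> \<le> \<epsilon> + C * A"
proof -
  \<comment> \<open>the tail of \<open>F\<close> will be multiplied by \<open>\<parallel>W'\<parallel>\<^sub>2 \<le> \<surd>D\<close>; the \<open>+ 1\<close> covers \<open>D = 0\<close>\<close>
  have "(\<epsilon> / (sqrt D + 1))\<^sup>2 > 0" using assms(5,6) by (smt (verit) divide_pos_pos real_sqrt_ge_zero zero_less_power)
  from cutoff_tail_small[OF F(1,4) this] obtain K where K: "K > 0"
    and small: "(\<integral>x. ((1 - cutoff K x) * F x)\<^sup>2 \<partial>lborel) \<le> (\<epsilon> / (sqrt D + 1))\<^sup>2"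
    and int: "integrable lborel (\<lambda>x. ((1 - cutoff K x) * F x)\<^sup>2)" by blast
  let ?G = "\<lambda>x. cutoff1 K j x * F x + cutoff K x * F' x"
  have cG: "continuous_on UNIV ?G" by (intro continuous_intros continuous_cutoff continuous_cutoff1 K F)
  have sG: "supp_in K ?G" by (intro supp_in_add supp_in_mult supp_in_cutoff supp_in_cutoff1 K)
  have iG: "integrable lborel ?G" by (rule supp_in_integrable[OF cG sG])
  have pdG: "has_pd j (\<lambda>x. cutoff K x * F x) ?G" by (rule has_pd_mult[OF has_pd_cutoff[OF K] F(3)])
  show thesis
  proof (rule that[of "\<integral>x. \<bar>?G x\<bar> \<partial>lborel"])
    fix R A and W :: "real^'n \<Rightarrow> real" assume "piece R A D W"
    then obtain W' where W: "continuous_on UNIV W" "supp_in R W" "\<And>x. \<bar>W x\<bar> \<le> A"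
      and W': "continuous_on UNIV W'" "has_pd j W W'" "(L2sq W') \<le> D"
      unfolding piece_def by blast
    note sW' = has_pd_supp[OF W'(2) W(2)]
    have A: "0 \<le> A" using W(3) by (meson abs_ge_zero order_trans)
    have [measurable]: "F \<in> borel_measurable borel" "W' \<in> borel_measurable borel" "cutoff K \<in> borel_measurable borel"
      using F W' by (auto intro!: borel_measurable_continuous_onI continuous_cutoff K)
    have i1: "integrable lborel (\<lambda>x. ((1 - cutoff K x) * F x) * W' x)"
      by (intro supp_in_integrable[where R = R] continuous_intros supp_in_mult sW' continuous_cutoff K F W')
    have i2: "integrable lborel (\<lambda>x. (cutoff K x * F x) * W' x)"
      by (intro supp_in_integrable[where R = R] continuous_intros supp_in_mult sW' continuous_cutoff K F W')
    have i3: "integrable lborel (\<lambda>x. (W' x)\<^sup>2)"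
      by (intro supp_in_integrable[where R = R] continuous_intros supp_in_square sW' W')
    have i4: "integrable lborel (\<lambda>x. ?G x * W x)"
      by (intro supp_in_integrable[where R = R] continuous_on_mult[OF cG] supp_in_mult W)
    have "(\<integral>x. F' x * W x \<partial>lborel) = - (\<integral>x. F x * W' x \<partial>lborel)"
      by (rule integral_by_parts_pd[OF F(1-3) W(1) W'(1,2) W(2)])
    also have "(\<integral>x. F x * W' x \<partial>lborel) = (\<integral>x. ((1 - cutoff K x) * F x) * W' x + (cutoff K x * F x) * W' x \<partial>lborel)"
      by (simp add: algebra_simps)
    also have "\<dots> = (\<integral>x. ((1 - cutoff K x) * F x) * W' x \<partial>lborel) + (\<integral>x. (cutoff K x * F x) * W' x \<partial>lborel)"
      using i1 i2 by (rule Bochner_Integration.integral_add)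
    also have "(\<integral>x. (cutoff K x * F x) * W' x \<partial>lborel) = - (\<integral>x. ?G x * W x \<partial>lborel)"
      using integral_by_parts_pd[OF continuous_on_mult[OF continuous_cutoff[OF K] F(1)] cG pdG W(1) W'(1,2) W(2)]
      by linarith
    finally have eq: "(\<integral>x. F' x * W x \<partial>lborel) = (\<integral>x. ?G x * W x \<partial>lborel) - (\<integral>x. ((1 - cutoff K x) * F x) * W' x \<partial>lborel)"
      by simp
    have "\<bar>\<integral>x. ((1 - cutoff K x) * F x) * W' x \<partial>lborel\<bar>
        \<le> sqrt (\<integral>x. ((1 - cutoff K x) * F x)\<^sup>2 \<partial>lborel) * sqrt (L2sq W')"
      by (rule Cauchy_Schwarz_integral(3)[OF _ _ int i3]) auto
    also have "\<dots> \<le> sqrt ((\<epsilon> / (sqrt D + 1))\<^sup>2) * sqrt D"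
      by (intro mult_mono real_sqrt_le_mono small W') auto
    also have "\<dots> = \<epsilon> * (sqrt D / (sqrt D + 1))" using assms(5,6) by simp
    also have "\<dots> \<le> \<epsilon> * 1"
    proof (rule mult_left_mono)
      have "0 \<le> sqrt D" using D by simp
      then show "sqrt D / (sqrt D + 1) \<le> 1" by (subst divide_le_eq_1_pos) linarith+
    qed (use assms(6) in simp)
    finally have b1: "\<bar>\<integral>x. ((1 - cutoff K x) * F x) * W' x \<partial>lborel\<bar> \<le> \<epsilon>" by simp
    have "\<bar>\<integral>x. ?G x * W x \<partial>lborel\<bar> \<le> (\<integral>x. \<bar>?G x * W x\<bar> \<partial>lborel)" by (rule integral_abs_bound)
    also have "\<dots> \<le> (\<integral>x. \<bar>?G x\<bar> * A \<partial>lborel)"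
      using W(3) by (intro integral_mono integrable_abs i4 integrable_mult_left iG) (auto simp: abs_mult intro!: mult_left_mono)
    also have "\<dots> = (\<integral>x. \<bar>?G x\<bar> \<partial>lborel) * A" by simp
    finally show "\<bar>\<integral>x. F' x * W x \<partial>lborel\<bar> \<le> \<epsilon> + (\<integral>x. \<bar>?G x\<bar> \<partial>lborel) * A"
      using b1 unfolding eq by linarith
  qed simp
qed

lemma transport_bound:
  fixes U V W :: "real^'n \<Rightarrow> real"
  assumes U: "continuous_on UNIV U" and V: "continuous_on UNIV V" "integrable lborel (\<lambda>x. (V x)\<^sup>2)"
    and W: "continuous_on UNIV W" "supp_in R W" "\<And>x. \<bar>W x\<bar> \<le> A"
    and S: "(\<integral>x. indicator (cube R) x * (U x)\<^sup>2 \<partial>lborel) \<le> S"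
  shows "\<bar>\<integral>x. (U x * V x) * W x \<partial>lborel\<bar> \<le> A * (sqrt S * sqrt (L2sq V))"
proof -
  have A: "0 \<le> A" using W(3) by (meson abs_ge_zero order_trans)
  have [measurable]: "U \<in> borel_measurable borel" "V \<in> borel_measurable borel" "W \<in> borel_measurable borel"
    using U V W by (auto intro!: borel_measurable_continuous_onI)
  have [measurable]: "cube R \<in> sets (borel :: (real^'n) measure)" unfolding cube_def by simp
  let ?U = "\<lambda>x. indicator (cube R) x * U x"
  have sq: "(?U x)\<^sup>2 = indicator (cube R) x * (U x)\<^sup>2" for x by (simp add: indicator_def)
  have i1: "integrable lborel (\<lambda>x. (?U x)\<^sup>2)"
    unfolding sq using borel_integrable_compact[of "cube R" "\<lambda>x. (U x)\<^sup>2"] U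
    by (auto simp: cube_def intro!: continuous_intros intro: continuous_on_subset)
  note CS = Cauchy_Schwarz_integral[OF _ _ i1 V(2)]
  have "\<bar>\<integral>x. (U x * V x) * W x \<partial>lborel\<bar> \<le> (\<integral>x. \<bar>(U x * V x) * W x\<bar> \<partial>lborel)" by (rule integral_abs_bound)
  also have "\<dots> \<le> (\<integral>x. A * \<bar>?U x * V x\<bar> \<partial>lborel)"
  proof (rule integral_mono)
    show "integrable lborel (\<lambda>x. \<bar>(U x * V x) * W x\<bar>)"
      by (intro integrable_abs supp_in_integrable[where R = R] continuous_intros supp_in_mult U V W)
    show "integrable lborel (\<lambda>x. A * \<bar>?U x * V x\<bar>)"
      by (intro integrable_mult_right integrable_abs CS(1)) measurable
    fix x
    show "\<bar>(U x * V x) * W x\<bar> \<le> A * \<bar>?U x * V x\<bar>"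
    proof (cases "x \<in> cube R")
      case True
      have "\<bar>W x\<bar> * \<bar>U x * V x\<bar> \<le> A * \<bar>U x * V x\<bar>" by (intro mult_right_mono W) auto
      then show ?thesis using True by (simp add: abs_mult mult_ac)
    next
      case False then show ?thesis using W(2) A unfolding supp_in_iff by simp
    qed
  qed
  also have "\<dots> = A * (\<integral>x. \<bar>?U x * V x\<bar> \<partial>lborel)" by simp
  also have "\<dots> \<le> A * (sqrt (L2sq ?U) * sqrt (L2sq V))"
    by (intro mult_left_mono CS(2) A) measurable
  also have "\<dots> \<le> A * (sqrt S * sqrt (L2sq V))"
    using S unfolding sq by (intro mult_left_mono mult_right_mono real_sqrt_le_mono A) auto
  finally show ?thesis .
qed

lemma continuous_nonneg_integral_zero:
  fixes f :: "real^'n \<Rightarrow> real"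
  assumes f: "continuous_on UNIV f" "integrable lborel f" "\<And>x. 0 \<le> f x" and "(\<integral>x. f x \<partial>lborel) = 0"
  shows "f x = 0"
proof (rule ccontr)
  assume "f x \<noteq> 0"
  have "AE x in lborel. f x = 0"
    using assms integral_nonneg_eq_0_iff_AE[OF f(2)] by simp
  then have "{x. f x \<noteq> 0} \<in> null_sets lborel"
    using f(1) by (subst AE_iff_null_sets) (auto intro!: borel_open open_Collect_neq continuous_intros)
  then have "negligible {x. f x \<noteq> 0}"
    by (simp add: negligible_iff_null_sets null_sets_completionI)
  moreover have "open {x. f x \<noteq> 0}" using f(1) by (intro open_Collect_neq continuous_intros)
  ultimately show False using open_not_negligible[of "{x. f x \<noteq> 0}"] \<open>f x \<noteq> 0\<close> by auto
qed

section \<open>Decay from bounded line integrals\<close>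

text \<open>
The components \<open>u\<^sub>i\<close> with \<open>D j i = \<partial>\<^sub>ju\<^sub>i\<close> and \<open>DD j i = \<partial>\<^sub>j\<partial>\<^sub>ju\<^sub>i\<close>, the pressure and its gradient.  The
hypothesis on line integrals is recorded only along coordinate lines, in both orientations.
\<close>

locale steady_flow =
  fixes U :: "3 \<Rightarrow> real^3 \<Rightarrow> real" and D DD :: "3 \<Rightarrow> 3 \<Rightarrow> real^3 \<Rightarrow> real"
    and p :: "real^3 \<Rightarrow> real" and dp :: "3 \<Rightarrow> real^3 \<Rightarrow> real" and C \<beta> :: real
  assumes cU: "\<And>i. continuous_on UNIV (U i)" and cD: "\<And>j i. continuous_on UNIV (D j i)"
    and cDD: "\<And>j i. continuous_on UNIV (DD j i)"
    and cp: "continuous_on UNIV p" and cdp: "\<And>i. continuous_on UNIV (dp i)"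
    and pdU: "\<And>j i. has_pd j (U i) (D j i)" and pdD: "\<And>j i. has_pd j (D j i) (DD j i)"
    and pdp: "\<And>i. has_pd i p (dp i)"
    and momentum: "\<And>i x. dp i x = (\<Sum>j\<in>UNIV. DD j i x) - (\<Sum>j\<in>UNIV. U j x * D j i x)"
    and incompressible: "\<And>x. (\<Sum>i\<in>UNIV. D i i x) = 0"
    and finite_energy: "\<And>j i. integrable lborel (\<lambda>x. (D j i x)\<^sup>2)"
    and line: "\<And>i x a b. \<bar>prim (\<lambda>s. U i (upd i s x)) a b\<bar> \<le> C * \<bar>b - a\<bar> powr \<beta>"
    and C_pos: "C > 0" and \<beta>_pos: "0 < \<beta>" and \<beta>_less_1: "\<beta> < 1"
begin

definition E0 :: real where "E0 = (\<Sum>i\<in>UNIV. \<Sum>j\<in>UNIV. \<integral>x. (D j i x)\<^sup>2 \<partial>lborel)"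

lemma E0_bound: "(L2sq (D j i)) \<le> E0"
proof -
  have "(L2sq (D j i)) \<le> (\<Sum>j\<in>UNIV. \<integral>x. (D j i x)\<^sup>2 \<partial>lborel)"
    by (rule member_le_sum) auto
  also have "\<dots> \<le> E0" unfolding E0_def
    by (rule member_le_sum[of i UNIV "\<lambda>i. \<Sum>j\<in>UNIV. \<integral>x. (D j i x)\<^sup>2 \<partial>lborel"]) (auto intro: sum_nonneg)
  finally show ?thesis .
qed

lemma E0_nonneg: "0 \<le> E0" unfolding E0_def by (intro sum_nonneg) auto

text \<open>
An upper bound for the variation of \<open>u\<^sub>i\<close> on the segment of length \<open>L\<close> from \<open>x\<close> in direction \<open>i\<close>.
\<close>

definition osc :: "3 \<Rightarrow> real \<Rightarrow> real^3 \<Rightarrow> real" where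
  "osc i L x = prim (\<lambda>r. \<bar>D i i (x + r *\<^sub>R axis i 1)\<bar>) 0 L"

lemma U_le_average_plus_osc:
  assumes L: "L > 0"
  shows "\<bar>U i x\<bar> \<le> C * L powr (\<beta> - 1) + osc i L x"
proof -
  let ?e = "axis i 1 :: real^3"
  let ?u = "\<lambda>r. U i (x + r *\<^sub>R ?e)" and ?d = "\<lambda>r. D i i (x + r *\<^sub>R ?e)"
  have cu: "continuous_on UNIV ?u" by (rule continuous_on_comp_UNIV[OF cU]) (intro continuous_intros)
  have cd: "continuous_on UNIV ?d" by (rule continuous_on_comp_UNIV[OF cD]) (intro continuous_intros)
  have ca: "continuous_on UNIV (\<lambda>r. \<bar>?d r\<bar>)" by (intro continuous_intros cd)
  have inc: "\<bar>?u r - U i x\<bar> \<le> osc i L x" if r: "0 \<le> r" "r \<le> L" for r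
  proof -
    have "prim ?d 0 r = ?u r - ?u 0" by (rule prim_antiderivative) (rule has_pd_along[OF pdU])
    moreover have "\<bar>prim ?d 0 r\<bar> \<le> prim (\<lambda>r. \<bar>?d r\<bar>) 0 r"
    proof (rule abs_leI)
      show "prim ?d 0 r \<le> prim (\<lambda>r. \<bar>?d r\<bar>) 0 r" by (rule prim_mono[OF cd ca r(1)]) simp
      have "prim (\<lambda>r. (-1) * ?d r) 0 r \<le> prim (\<lambda>r. \<bar>?d r\<bar>) 0 r"
        by (rule prim_mono[OF _ ca r(1)]) (auto intro!: continuous_intros cd)
      then show "- prim ?d 0 r \<le> prim (\<lambda>r. \<bar>?d r\<bar>) 0 r" unfolding prim_cmult by simp
    qed
    moreover have "0 \<le> prim (\<lambda>r. \<bar>?d r\<bar>) r L" by (rule prim_nonneg[OF ca r(2)]) simp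
    then have "prim (\<lambda>r. \<bar>?d r\<bar>) 0 r \<le> osc i L x"
      using prim_combine[OF ca, of 0 r L] by (simp add: osc_def)
    ultimately show ?thesis by simp
  qed
  have "prim (\<lambda>s. U i (upd i s x)) (x $ i + 0) (x $ i + L) = prim (\<lambda>r. U i (upd i (x $ i + r) x)) 0 L"
    by (rule prim_shift[symmetric])
  then have "prim (\<lambda>s. U i (upd i s x)) (x $ i + 0) (x $ i + L) = prim ?u 0 L"
    by (simp add: upd_eq_translate)
  then have A: "\<bar>prim ?u 0 L\<bar> \<le> C * L powr \<beta>"
    using line[of i x "x $ i + 0" "x $ i + L"] L by simp
  have "prim (\<lambda>r. ?u r - U i x) 0 L + prim (\<lambda>r. U i x) 0 L = prim ?u 0 L"
    using prim_add[of "\<lambda>r. ?u r - U i x" "\<lambda>r. U i x" 0 L] cu by (simp add: continuous_on_diff)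
  moreover have "\<bar>prim (\<lambda>r. ?u r - U i x) 0 L\<bar> \<le> \<bar>L - 0\<bar> * osc i L x"
    by (rule prim_bound) (use inc L in \<open>auto intro!: continuous_intros cu\<close>)
  moreover have "prim (\<lambda>r. U i x) 0 L = L * U i x" by (simp add: prim_def)
  ultimately have "\<bar>L * U i x\<bar> \<le> C * L powr \<beta> + L * osc i L x" using A L by simp
  moreover have "L * (C * L powr (\<beta> - 1) + osc i L x) = C * L powr \<beta> + L * osc i L x"
    using L powr_mult_base[of L "\<beta> - 1"] by (simp add: distrib_left mult.left_commute)
  ultimately have "L * \<bar>U i x\<bar> \<le> L * (C * L powr (\<beta> - 1) + osc i L x)"
    using L by (simp add: abs_mult)
  then show ?thesis using L by simp
qed

lemma continuous_osc: "continuous_on UNIV (osc i L)"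
  unfolding osc_def[abs_def]
  by (rule continuous_prim_translate[of "\<lambda>x. \<bar>D i i x\<bar>"]) (intro continuous_intros cD)

lemma osc_L2:
  assumes L: "L > 0"
  shows "(\<integral>\<^sup>+x. ennreal ((osc i L x)\<^sup>2) \<partial>lborel) \<le> ennreal (L\<^sup>2 * E0)"
proof -
  let ?h = "\<lambda>x. prim (\<lambda>r. (D i i (x + r *\<^sub>R axis i 1))\<^sup>2) 0 L"
  have cd: "continuous_on UNIV (\<lambda>r. \<bar>D i i (x + r *\<^sub>R axis i 1)\<bar>)" for x
    by (intro continuous_on_rabs continuous_on_comp_UNIV[OF cD]) (intro continuous_intros)
  have [measurable]: "?h \<in> borel_measurable borel"
    by (intro borel_measurable_continuous_onI continuous_prim_translate[of "\<lambda>x. (D i i x)\<^sup>2"] continuous_intros cD)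
  have "(\<integral>\<^sup>+x. ennreal ((osc i L x)\<^sup>2) \<partial>lborel) \<le> (\<integral>\<^sup>+x. ennreal L * ennreal (?h x) \<partial>lborel)"
  proof (rule nn_integral_mono)
    fix x
    have "(osc i L x)\<^sup>2 \<le> (L - 0) * ?h x"
      using prim_square[OF cd, of 0 L x] L by (simp add: osc_def)
    then show "ennreal ((osc i L x)\<^sup>2) \<le> ennreal L * ennreal (?h x)"
      using L by (simp add: ennreal_mult'[symmetric] ennreal_leI)
  qed
  also have "\<dots> = ennreal L * (\<integral>\<^sup>+x. ennreal (?h x) \<partial>lborel)" by (rule nn_integral_cmult) measurable
  also have "\<dots> = ennreal L * (ennreal L * (\<integral>\<^sup>+x. ennreal ((D i i x)\<^sup>2) \<partial>lborel))"
    using nn_integral_line_average[OF cD, of 0 L i i i] L by simp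
  also have "(\<integral>\<^sup>+x. ennreal ((D i i x)\<^sup>2) \<partial>lborel) = ennreal (L2sq (D i i))"
    by (rule nn_integral_eq_integral[OF finite_energy]) simp
  also have "ennreal L * (ennreal L * ennreal (L2sq (D i i))) = ennreal (L\<^sup>2 * (L2sq (D i i)))"
    using L by (simp add: ennreal_mult'[symmetric] power2_eq_square mult.assoc)
  also have "\<dots> \<le> ennreal (L\<^sup>2 * E0)" by (intro ennreal_leI mult_left_mono E0_bound) simp
  finally show ?thesis .
qed

text \<open>
If the sum of the \<open>|u\<^sub>i|\<close> exceeds \<open>t\<close>, then some \<open>|u\<^sub>i|\<close> exceeds \<open>t/3\<close>.  The length \<open>L\<close> is chosen so that
the mean of \<open>u\<^sub>i\<close> accounts for at most \<open>t/6\<close>; then \<open>osc\<close> exceeds \<open>t/6\<close>, and Markov's inequality applies to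
its square.
\<close>

lemma weak_estimate:
  obtains K where "K \<ge> 0"
    "\<And>t. t > 0 \<Longrightarrow> emeasure lborel {x. t < (\<Sum>i\<in>UNIV. \<bar>U i x\<bar>)} \<le> ennreal (K * t powr (- ((4 - 2 * \<beta>) / (1 - \<beta>))))"
proof (rule that)
  define q where "q = (4 - 2 * \<beta>) / (1 - \<beta>)"
  define K where "K = 108 * E0 * (6 * C) powr (2 / (1 - \<beta>))"
  show "K \<ge> 0" unfolding K_def using E0_nonneg by simp
  fix t :: real assume t: "t > 0"
  define L where "L = (6 * C / t) powr (1 / (1 - \<beta>))"
  let ?S = "\<lambda>i. {x\<in>UNIV. 1 \<le> ennreal (36 / t\<^sup>2) * ennreal ((osc i L x)\<^sup>2)}"
  have L: "L > 0" unfolding L_def using t C_pos by simp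
  have "1 / (1 - \<beta>) * (\<beta> - 1) = - 1" using \<beta>_less_1 by (simp add: field_simps)
  then have "L powr (\<beta> - 1) = (6 * C / t) powr (- 1)" unfolding L_def powr_powr by (simp only:)
  also have "\<dots> = t / (6 * C)" using t C_pos by (simp add: powr_minus divide_simps)
  finally have avg: "C * L powr (\<beta> - 1) = t / 6" using C_pos by simp
  have sub: "{x. t < (\<Sum>i\<in>UNIV. \<bar>U i x\<bar>)} \<subseteq> (\<Union>i\<in>UNIV. ?S i)"
  proof
    fix x assume "x \<in> {x. t < (\<Sum>i\<in>UNIV. \<bar>U i x\<bar>)}"
    then have "t < \<bar>U 1 x\<bar> + \<bar>U 2 x\<bar> + \<bar>U 3 x\<bar>" by (simp add: sum_3)
    then have "\<not> (\<bar>U 1 x\<bar> \<le> t / 3 \<and> \<bar>U 2 x\<bar> \<le> t / 3 \<and> \<bar>U 3 x\<bar> \<le> t / 3)" by linarith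
    then have "\<exists>i. t / 3 < \<bar>U i x\<bar>" unfolding not_le[symmetric] by blast
    then obtain i where "t / 3 < \<bar>U i x\<bar>" by blast
    then have "t / 6 \<le> osc i L x" using U_le_average_plus_osc[OF L, of i x] avg by linarith
    then have "(t / 6)\<^sup>2 \<le> (osc i L x)\<^sup>2" using t by (intro power_mono) auto
    then have "1 \<le> 36 / t\<^sup>2 * (osc i L x)\<^sup>2" using t by (simp add: field_simps power2_eq_square)
    then have "ennreal 1 \<le> ennreal (36 / t\<^sup>2 * (osc i L x)\<^sup>2)" by (rule ennreal_leI)
    moreover have "ennreal (36 / t\<^sup>2 * (osc i L x)\<^sup>2) = ennreal (36 / t\<^sup>2) * ennreal ((osc i L x)\<^sup>2)"
      by (rule ennreal_mult') simp
    ultimately have "1 \<le> ennreal (36 / t\<^sup>2) * ennreal ((osc i L x)\<^sup>2)" by (simp only: ennreal_1)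
    then show "x \<in> (\<Union>i\<in>UNIV. ?S i)" by blast
  qed
  have [measurable]: "osc i L \<in> borel_measurable borel" for i
    by (intro borel_measurable_continuous_onI continuous_osc)
  have meas: "(?S i) \<in> sets lborel" for i
    by measurable
  have one: "emeasure lborel (?S i) \<le> ennreal (36 / t\<^sup>2 * (L\<^sup>2 * E0))" for i
  proof -
    have "emeasure lborel (?S i)
      \<le> ennreal (36 / t\<^sup>2) * (\<integral>\<^sup>+x. ennreal ((osc i L x)\<^sup>2) * indicator UNIV x \<partial>lborel)"
      by (rule nn_integral_Markov_inequality) auto
    also have "\<dots> \<le> ennreal (36 / t\<^sup>2) * ennreal (L\<^sup>2 * E0)"
      using osc_L2[OF L, of i] by (intro mult_left_mono) auto
    also have "\<dots> = ennreal (36 / t\<^sup>2 * (L\<^sup>2 * E0))" by (rule ennreal_mult'[symmetric]) simp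
    finally show ?thesis .
  qed
  have "emeasure lborel {x. t < (\<Sum>i\<in>UNIV. \<bar>U i x\<bar>)}
      \<le> emeasure lborel (\<Union>i\<in>UNIV. ?S i)"
    using meas by (intro emeasure_mono sub sets.finite_UN) auto
  also have "\<dots> \<le> (\<Sum>i\<in>UNIV. emeasure lborel (?S i))"
    using meas by (intro emeasure_subadditive_finite) auto
  also have "\<dots> \<le> (\<Sum>i\<in>(UNIV :: 3 set). ennreal (36 / t\<^sup>2 * (L\<^sup>2 * E0)))" by (intro sum_mono one)
  also have "\<dots> = ennreal (\<Sum>i\<in>(UNIV :: 3 set). 36 / t\<^sup>2 * (L\<^sup>2 * E0))" using E0_nonneg by (intro sum_ennreal) auto
  also have "(\<Sum>i\<in>(UNIV :: 3 set). 36 / t\<^sup>2 * (L\<^sup>2 * E0)) = 108 * E0 * (L\<^sup>2 / t\<^sup>2)" by simp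
  also have "L\<^sup>2 / t\<^sup>2 = (6 * C) powr (2 / (1 - \<beta>)) * t powr (- q)"
  proof -
    have "L\<^sup>2 = L powr 2" using L by (simp add: powr_numeral)
    also have "\<dots> = (6 * C / t) powr (2 / (1 - \<beta>))" unfolding L_def powr_powr by simp
    also have "\<dots> = (6 * C) powr (2 / (1 - \<beta>)) * t powr (- (2 / (1 - \<beta>)))"
    proof -
      have "(6 * C / t) powr b = (6 * C) powr b / t powr b" for b using t C_pos by (simp add: powr_divide)
      then show ?thesis by (simp only: powr_minus_divide times_divide_eq_right mult_1_right)
    qed
    finally have "L\<^sup>2 / t\<^sup>2 = (6 * C) powr (2 / (1 - \<beta>)) * (t powr (- (2 / (1 - \<beta>))) * t powr (- 2))"
      using t by (simp add: powr_minus powr_numeral divide_inverse)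
    also have "t powr (- (2 / (1 - \<beta>))) * t powr (- 2) = t powr (- q)"
    proof -
      have "q = (2 + 2 * (1 - \<beta>)) / (1 - \<beta>)" unfolding q_def by simp
      also have "\<dots> = 2 / (1 - \<beta>) + 2" 
        unfolding add_divide_distrib using \<beta>_less_1 nonzero_mult_div_cancel_right[of "1 - \<beta>" 2] by simp
      finally show ?thesis unfolding powr_add[symmetric] by simp
    qed
    finally show ?thesis .
  qed
  finally show "emeasure lborel {x. t < (\<Sum>i\<in>UNIV. \<bar>U i x\<bar>)} \<le> ennreal (K * t powr (- ((4 - 2 * \<beta>) / (1 - \<beta>))))"
    unfolding K_def q_def by (simp add: mult_ac)
qed

lemma measure_cube: "R \<ge> 0 \<Longrightarrow> emeasure lborel (cube R :: (real^3) set) = ennreal (8 * R ^ 3)"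
proof -
  assume R: "R \<ge> 0"
  have "(0 :: real^3) \<in> cube R" using R by (simp add: mem_cube)
  then have "measure lborel (cube R :: (real^3) set) = (\<Prod>i\<in>(UNIV::3 set). 2 * R)"
    unfolding cube_def by (subst content_cbox_cart) auto
  then have "measure lborel (cube R :: (real^3) set) = 8 * R ^ 3" by (simp add: power3_eq_cube)
  moreover have "emeasure lborel (cube R :: (real^3) set) < \<infinity>"
    unfolding cube_def by (rule emeasure_lborel_cbox_finite)
  then have "emeasure lborel (cube R :: (real^3) set) = ennreal (measure lborel (cube R :: (real^3) set))"
    by (intro emeasure_eq_ennreal_measure) (simp add: less_top)
  ultimately show ?thesis by simp
qed

text \<open>
The choice \<open>L = R\<^bsup>\<alpha>\<^esup>\<close> balances \<open>L\<^bsup>2\<beta>-2\<^esup> R\<^sup>3\<close>, the contribution of the means on the cube, against the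
contribution \<open>L\<^sup>2\<close> of the oscillation.
\<close>

definition \<alpha> :: real where "\<alpha> = 3 / (4 - 2 * \<beta>)"

lemma local_L2:
  obtains c where "c \<ge> 0"
    "\<And>R i. R \<ge> 1 \<Longrightarrow> (\<integral>x. indicator (cube R) x * (U i x)\<^sup>2 \<partial>lborel) \<le> c * R powr (2 * \<alpha>)"
proof (rule that)
  show "0 \<le> 16 * C\<^sup>2 + 2 * E0" using E0_nonneg by simp
  fix R :: real and i assume R: "R \<ge> 1"
  define L where "L = R powr \<alpha>"
  have L: "L > 0" unfolding L_def using R by simp
  have [measurable]: "U i \<in> borel_measurable borel" "osc i L \<in> borel_measurable borel" "cube R \<in> sets (borel :: (real^3) measure)"
    by (auto intro!: borel_measurable_continuous_onI cU continuous_osc simp: cube_def)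
  let ?a = "2 * (C * L powr (\<beta> - 1))\<^sup>2"
  have "(\<integral>\<^sup>+x. ennreal (indicator (cube R) x * (U i x)\<^sup>2) \<partial>lborel)
      \<le> (\<integral>\<^sup>+x. ennreal ?a * indicator (cube R) x + 2 * ennreal ((osc i L x)\<^sup>2) \<partial>lborel)"
  proof (rule nn_integral_mono)
    fix x
    have "\<bar>U i x\<bar>\<^sup>2 \<le> (C * L powr (\<beta> - 1) + osc i L x)\<^sup>2"
      by (intro power_mono U_le_average_plus_osc L) simp
    also have "\<dots> \<le> ?a + 2 * (osc i L x)\<^sup>2"
      using zero_le_power2[of "C * L powr (\<beta> - 1) - osc i L x"] unfolding power2_sum power2_diff by linarith
    finally have "indicator (cube R) x * (U i x)\<^sup>2 \<le> ?a * indicator (cube R) x + 2 * (osc i L x)\<^sup>2"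
      by (auto simp: indicator_def)
    then have "ennreal (indicator (cube R) x * (U i x)\<^sup>2) \<le> ennreal (?a * indicator (cube R) x + 2 * (osc i L x)\<^sup>2)"
      by (rule ennreal_leI)
    also have "\<dots> = ennreal ?a * indicator (cube R) x + 2 * ennreal ((osc i L x)\<^sup>2)"
      by (auto simp: indicator_def ennreal_mult' ennreal_plus)
    finally show "ennreal (indicator (cube R) x * (U i x)\<^sup>2) \<le> ennreal ?a * indicator (cube R) x + 2 * ennreal ((osc i L x)\<^sup>2)" .
  qed
  also have "\<dots> = (\<integral>\<^sup>+x. ennreal ?a * indicator (cube R) x \<partial>(lborel :: (real^3) measure)) + (\<integral>\<^sup>+x. 2 * ennreal ((osc i L x)\<^sup>2) \<partial>lborel)"
    by (rule nn_integral_add) measurable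
  also have "(\<integral>\<^sup>+x. ennreal ?a * indicator (cube R) x \<partial>(lborel :: (real^3) measure)) = ennreal ?a * ennreal (8 * R ^ 3)"
    using measure_cube[of R] R by (subst nn_integral_cmult_indicator) auto
  also have "(\<integral>\<^sup>+x. 2 * ennreal ((osc i L x)\<^sup>2) \<partial>lborel) = 2 * (\<integral>\<^sup>+x. ennreal ((osc i L x)\<^sup>2) \<partial>lborel)"
    by (rule nn_integral_cmult) measurable
  also have "ennreal ?a * ennreal (8 * R ^ 3) + 2 * (\<integral>\<^sup>+x. ennreal ((osc i L x)\<^sup>2) \<partial>lborel)
      \<le> ennreal ?a * ennreal (8 * R ^ 3) + 2 * ennreal (L\<^sup>2 * E0)"
    by (intro add_mono mult_left_mono osc_L2 L) auto
  also have "\<dots> = ennreal (?a * (8 * R ^ 3) + 2 * (L\<^sup>2 * E0))"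
  proof -
    have "ennreal ?a * ennreal (8 * R ^ 3) = ennreal (?a * (8 * R ^ 3))" by (rule ennreal_mult'[symmetric]) simp
    moreover have "2 * ennreal (L\<^sup>2 * E0) = ennreal (2 * (L\<^sup>2 * E0))" by (simp add: ennreal_mult')
    moreover have "0 \<le> ?a * (8 * R ^ 3)" "0 \<le> 2 * (L\<^sup>2 * E0)" using R E0_nonneg by auto
    ultimately show ?thesis by (simp only: ennreal_plus)
  qed
  finally have "ennreal (\<integral>x. indicator (cube R) x * (U i x)\<^sup>2 \<partial>lborel) \<le> ennreal (?a * (8 * R ^ 3) + 2 * (L\<^sup>2 * E0))"
  proof (rule order_trans[rotated])
    have "integrable lborel (\<lambda>x. indicator (cube R) x * (U i x)\<^sup>2)"
      using borel_integrable_compact[of "cube R" "\<lambda>x. (U i x)\<^sup>2"] cU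
      by (auto simp: cube_def intro!: continuous_intros intro: continuous_on_subset)
    then show "ennreal (\<integral>x. indicator (cube R) x * (U i x)\<^sup>2 \<partial>lborel) \<le> (\<integral>\<^sup>+x. ennreal (indicator (cube R) x * (U i x)\<^sup>2) \<partial>lborel)"
      by (subst nn_integral_eq_integral) auto
  qed
  then have "(\<integral>x. indicator (cube R) x * (U i x)\<^sup>2 \<partial>lborel) \<le> ?a * (8 * R ^ 3) + 2 * (L\<^sup>2 * E0)"
    using R E0_nonneg by (subst (asm) ennreal_le_iff) auto
  also have "?a * (8 * R ^ 3) = 16 * C\<^sup>2 * R powr (2 * \<alpha>)"
  proof -
    have "(L powr (\<beta> - 1))\<^sup>2 = R powr (\<alpha> * (\<beta> - 1) + \<alpha> * (\<beta> - 1))"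
      unfolding L_def powr_powr power2_eq_square powr_add ..
    moreover have "R ^ 3 = R powr 3" using R by simp
    ultimately have "(L powr (\<beta> - 1))\<^sup>2 * R ^ 3 = R powr (\<alpha> * (\<beta> - 1) + \<alpha> * (\<beta> - 1) + 3)"
      by (simp only: powr_add)
    also have "\<alpha> * (\<beta> - 1) + \<alpha> * (\<beta> - 1) + 3 = 2 * \<alpha>"
    proof -
      have "\<alpha> * (4 - 2 * \<beta>) = 3" using \<beta>_less_1 nonzero_divide_eq_eq[of "4 - 2 * \<beta>" 3 \<alpha>] unfolding \<alpha>_def by linarith
      then show ?thesis by (simp add: algebra_simps)
    qed
    finally have *: "(L powr (\<beta> - 1))\<^sup>2 * R ^ 3 = R powr (2 * \<alpha>)" .
    have "?a * (8 * R ^ 3) = 16 * C\<^sup>2 * ((L powr (\<beta> - 1))\<^sup>2 * R ^ 3)"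
      unfolding power_mult_distrib by simp
    then show ?thesis unfolding * .
  qed
  also have "L\<^sup>2 = R powr (2 * \<alpha>)"
    unfolding L_def power2_eq_square powr_add[symmetric] by simp
  finally show "(\<integral>x. indicator (cube R) x * (U i x)\<^sup>2 \<partial>lborel) \<le> (16 * C\<^sup>2 + 2 * E0) * R powr (2 * \<alpha>)"
    by (simp add: algebra_simps)
qed

end

section \<open>Pairing the Bernoulli head with the flux through the cutoff\<close>

context steady_flow
begin

text \<open>
The Bernoulli head.  Using it instead of the pressure removes the convective term from the energy balance,
because \<open>u \<cdot> (u \<cdot> \<nabla>)u = u \<cdot> \<nabla>|u|\<^sup>2 / 2\<close> (\<open>U_dot_dQ\<close>).
\<close>

definition Q :: "real^3 \<Rightarrow> real" where "Q x = p x + (\<Sum>j\<in>UNIV. (U j x)\<^sup>2) / 2"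

definition dQ :: "3 \<Rightarrow> real^3 \<Rightarrow> real" where
  "dQ i x = (\<Sum>j\<in>UNIV. DD j i x) - (\<Sum>j\<in>UNIV. U j x * D j i x) + (\<Sum>j\<in>UNIV. U j x * D i j x)"

lemma continuous_Q: "continuous_on UNIV Q" and continuous_dQ: "continuous_on UNIV (dQ i)"
  unfolding Q_def[abs_def] dQ_def[abs_def] by (intro continuous_intros cp cU cD cDD; simp)+

lemma has_pd_Q: "has_pd i Q (dQ i)"
proof -
  have "has_pd i (\<lambda>x. U j x * U j x) (\<lambda>x. D i j x * U j x + U j x * D i j x)" for j
    by (rule has_pd_mult[OF pdU pdU])
  then have "has_pd i (\<lambda>x. \<Sum>j\<in>UNIV. U j x * U j x) (\<lambda>x. \<Sum>j\<in>UNIV. D i j x * U j x + U j x * D i j x)"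
    by (rule has_pd_sum)
  from has_pd_add[OF pdp[of i] has_pd_mult[OF has_pd_const[of i "1 / 2"] this]]
  have "has_pd i (\<lambda>x. p x + 1 / 2 * (\<Sum>j\<in>UNIV. U j x * U j x))
    (\<lambda>x. dp i x + (0 * (\<Sum>j\<in>UNIV. U j x * U j x) + 1 / 2 * (\<Sum>j\<in>UNIV. D i j x * U j x + U j x * D i j x)))" .
  moreover have "dp i x + (0 * (\<Sum>j\<in>UNIV. U j x * U j x) + 1 / 2 * (\<Sum>j\<in>UNIV. D i j x * U j x + U j x * D i j x)) = dQ i x" for x
  proof -
    have "(\<Sum>j\<in>UNIV. D i j x * U j x + U j x * D i j x) = 2 * (\<Sum>j\<in>UNIV. U j x * D i j x)"
      unfolding sum_distrib_left by (intro sum.cong) auto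
    then show ?thesis unfolding dQ_def momentum by simp
  qed
  ultimately show ?thesis unfolding Q_def[abs_def] by (auto elim: has_pd_cong simp: power2_eq_square)
qed

lemma U_dot_dQ: "(\<Sum>i\<in>UNIV. U i x * dQ i x) = (\<Sum>i\<in>UNIV. \<Sum>j\<in>UNIV. U i x * DD j i x)"
proof -
  have "(\<Sum>i\<in>UNIV. U i x * (\<Sum>j\<in>UNIV. U j x * D j i x)) = (\<Sum>i\<in>UNIV. \<Sum>j\<in>UNIV. U i x * (U j x * D j i x))"
    unfolding sum_distrib_left ..
  also have "\<dots> = (\<Sum>j\<in>UNIV. \<Sum>i\<in>UNIV. U i x * (U j x * D j i x))" by (rule sum.swap)
  also have "\<dots> = (\<Sum>i\<in>UNIV. U i x * (\<Sum>j\<in>UNIV. U j x * D i j x))"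
    unfolding sum_distrib_left by (simp add: mult.left_commute)
  finally show ?thesis
    unfolding dQ_def by (simp add: distrib_left right_diff_distrib sum.distrib sum_subtractf sum_distrib_left)
qed

lemma linear_part_vanishes:
  assumes "Dc \<ge> 0" "\<epsilon> > 0"
  obtains K where "K \<ge> 0"
    "\<And>R A (W :: real^3 \<Rightarrow> real). piece R A Dc W \<Longrightarrow> \<bar>\<integral>x. (\<Sum>j\<in>UNIV. DD j d x) * W x \<partial>lborel\<bar> \<le> \<epsilon> + K * A"
proof -
  have "\<forall>j. \<exists>K\<ge>0. \<forall>R A (W :: real^3 \<Rightarrow> real). piece R A Dc W \<longrightarrow> \<bar>\<integral>x. DD j d x * W x \<partial>lborel\<bar> \<le> \<epsilon> / 3 + K * A"
  proof
    fix j
    have e: "\<epsilon> / 3 > 0" using assms by simp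
    obtain K where "K \<ge> 0" "\<And>R A (W :: real^3 \<Rightarrow> real). piece R A Dc W \<Longrightarrow> \<bar>\<integral>x. DD j d x * W x \<partial>lborel\<bar> \<le> \<epsilon> / 3 + K * A"
      using weak_convergence_bound[OF cD cDD pdD finite_energy assms(1) e] by blast
    then show "\<exists>K\<ge>0. \<forall>R A (W :: real^3 \<Rightarrow> real). piece R A Dc W \<longrightarrow> \<bar>\<integral>x. DD j d x * W x \<partial>lborel\<bar> \<le> \<epsilon> / 3 + K * A" by blast
  qed
  then obtain K where K: "\<And>j. K j \<ge> 0"
    "\<And>j R A (W :: real^3 \<Rightarrow> real). piece R A Dc W \<Longrightarrow> \<bar>\<integral>x. DD j d x * W x \<partial>lborel\<bar> \<le> \<epsilon> / 3 + K j * A" by metis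
  show thesis
  proof (rule that[of "\<Sum>j\<in>UNIV. K j"])
    show "0 \<le> (\<Sum>j\<in>UNIV. K j)" by (intro sum_nonneg K)
    fix R A and W :: "real^3 \<Rightarrow> real" assume W: "piece R A Dc W"
    have cW: "continuous_on UNIV W" "supp_in R W" using W unfolding piece_def by auto
    have int: "integrable lborel (\<lambda>x. DD j d x * W x)" for j
      by (intro supp_in_integrable[where R = R] continuous_on_mult cDD cW supp_in_mult)
    have "(\<integral>x. (\<Sum>j\<in>UNIV. DD j d x) * W x \<partial>lborel) = (\<Sum>j\<in>UNIV. \<integral>x. DD j d x * W x \<partial>lborel)"
      unfolding sum_distrib_right by (rule Bochner_Integration.integral_sum) (rule int)
    also have "\<bar>\<dots>\<bar> \<le> (\<Sum>j\<in>UNIV. \<bar>\<integral>x. DD j d x * W x \<partial>lborel\<bar>)" by (rule sum_abs)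
    also have "\<dots> \<le> (\<Sum>j\<in>UNIV. \<epsilon> / 3 + K j * A)" by (intro sum_mono K(2)[OF W])
    also have "\<dots> = \<epsilon> + (\<Sum>j\<in>UNIV. K j) * A" by (simp add: sum.distrib sum_distrib_right)
    finally show "\<bar>\<integral>x. (\<Sum>j\<in>UNIV. DD j d x) * W x \<partial>lborel\<bar> \<le> \<epsilon> + (\<Sum>j\<in>UNIV. K j) * A" .
  qed
qed

lemma nonlinear_part_bound:
  assumes W: "continuous_on UNIV W" "supp_in R W" "\<And>x. \<bar>W x\<bar> \<le> A"
    and S: "\<And>i. (\<integral>x. indicator (cube R) x * (U i x)\<^sup>2 \<partial>lborel) \<le> S"
  shows "\<bar>\<integral>x. (\<Sum>j\<in>UNIV. U j x * D (k j) (l j) x) * W x \<partial>lborel\<bar> \<le> 3 * (A * (sqrt S * sqrt E0))"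
proof -
  have A: "0 \<le> A" using W(3) by (meson abs_ge_zero order_trans)
  have S0: "0 \<le> S" by (rule order_trans[OF _ S[of 1]]) (auto intro!: integral_nonneg_AE)
  have int: "integrable lborel (\<lambda>x. U j x * D (k j) (l j) x * W x)" for j
    by (intro supp_in_integrable[where R = R] continuous_on_mult cU cD W supp_in_mult)
  have one: "\<bar>\<integral>x. U j x * D (k j) (l j) x * W x \<partial>lborel\<bar> \<le> A * (sqrt S * sqrt E0)" for j
  proof -
    have "\<bar>\<integral>x. U j x * D (k j) (l j) x * W x \<partial>lborel\<bar> \<le> A * (sqrt S * sqrt (\<integral>x. (D (k j) (l j) x)\<^sup>2 \<partial>lborel))"
      by (rule transport_bound[OF cU cD finite_energy W S])
    also have "\<dots> \<le> A * (sqrt S * sqrt E0)"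
      using S0 by (intro mult_left_mono real_sqrt_le_mono E0_bound A) auto
    finally show ?thesis .
  qed
  have "(\<integral>x. (\<Sum>j\<in>UNIV. U j x * D (k j) (l j) x) * W x \<partial>lborel) = (\<Sum>j\<in>UNIV. \<integral>x. U j x * D (k j) (l j) x * W x \<partial>lborel)"
    unfolding sum_distrib_right by (rule Bochner_Integration.integral_sum) (rule int)
  also have "\<bar>\<dots>\<bar> \<le> (\<Sum>j\<in>UNIV. \<bar>\<integral>x. U j x * D (k j) (l j) x * W x \<partial>lborel\<bar>)" by (rule sum_abs)
  also have "\<dots> \<le> (\<Sum>j\<in>(UNIV :: 3 set). A * (sqrt S * sqrt E0))" by (intro sum_mono one)
  also have "\<dots> = 3 * (A * (sqrt S * sqrt E0))" by simp
  finally show ?thesis .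
qed

lemma powr_neg_tendsto:
  assumes "a < (0::real)" shows "((\<lambda>R. c * R powr a) \<longlongrightarrow> 0) at_top"
  by (rule tendsto_mult_right_zero, rule tendsto_neg_powr[OF assms], rule filterlim_ident)

text \<open>
The convective terms are bounded by the product of \<open>|W| \<le> const R\<^bsup>\<beta>-1\<^esup>\<close>, the norm of \<open>u\<close> on the cube, of
order \<open>R\<^bsup>\<alpha>\<^esup>\<close>, and the norm of \<open>\<nabla>u\<close>; this is where \<open>\<alpha> + \<beta> < 1\<close> is needed.
\<close>

lemma head_gradient_pairing_vanishes:
  assumes small: "\<alpha> + \<beta> < 1" and "Dc \<ge> 0" "ca \<ge> 0" "\<epsilon> > 0"
  shows "\<forall>\<^sub>F R in at_top. \<forall>W :: real^3 \<Rightarrow> real. piece R (ca * R powr (\<beta> - 1)) Dc W \<longrightarrow> \<bar>\<integral>x. dQ d x * W x \<partial>lborel\<bar> \<le> \<epsilon>"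
proof -
  have "\<epsilon> / 3 > 0" using assms by simp
  from linear_part_vanishes[OF assms(2) this, of d] obtain K where K: "K \<ge> 0"
    "\<And>R A (W :: real^3 \<Rightarrow> real). piece R A Dc W \<Longrightarrow> \<bar>\<integral>x. (\<Sum>j\<in>UNIV. DD j d x) * W x \<partial>lborel\<bar> \<le> \<epsilon> / 3 + K * A"
    by blast
  obtain c where c: "c \<ge> 0"
    "\<And>R i. R \<ge> 1 \<Longrightarrow> (\<integral>x. indicator (cube R) x * (U i x)\<^sup>2 \<partial>lborel) \<le> c * R powr (2 * \<alpha>)"
    using local_L2 by blast
  have "((\<lambda>R. K * ca * R powr (\<beta> - 1)) \<longlongrightarrow> 0) at_top" by (rule powr_neg_tendsto) (use \<beta>_less_1 in simp)
  then have 1: "\<forall>\<^sub>F R in at_top. K * ca * R powr (\<beta> - 1) < \<epsilon> / 3" using assms by (intro order_tendstoD) auto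
  have "((\<lambda>R. 6 * ca * sqrt c * sqrt E0 * R powr (\<alpha> + \<beta> - 1)) \<longlongrightarrow> 0) at_top" by (rule powr_neg_tendsto) (use small in simp)
  then have 2: "\<forall>\<^sub>F R in at_top. 6 * ca * sqrt c * sqrt E0 * R powr (\<alpha> + \<beta> - 1) < \<epsilon> / 3" using assms by (intro order_tendstoD) auto
  show ?thesis using 1 2 eventually_ge_at_top[of "1::real"]
  proof eventually_elim
    case (elim R)
    show ?case
    proof (intro allI impI)
      fix W :: "real^3 \<Rightarrow> real" assume W: "piece R (ca * R powr (\<beta> - 1)) Dc W"
      then have cW: "continuous_on UNIV W" "supp_in R W" "\<And>x. \<bar>W x\<bar> \<le> ca * R powr (\<beta> - 1)" unfolding piece_def by auto
      let ?n = "ca * R powr (\<beta> - 1) * (sqrt (c * R powr (2 * \<alpha>)) * sqrt E0)"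
      have R: "R \<ge> 1" by fact
      have "sqrt (R powr (2 * \<alpha>)) = R powr \<alpha>"
        using R by (simp add: powr_half_sqrt[symmetric] powr_powr)
      then have "6 * ?n = 6 * ca * sqrt c * sqrt E0 * (R powr \<alpha> * R powr (\<beta> - 1))"
        unfolding real_sqrt_mult by simp
      also have "R powr \<alpha> * R powr (\<beta> - 1) = R powr (\<alpha> + \<beta> - 1)"
        unfolding powr_add[symmetric] by (simp add: add_diff_eq)
      finally have n: "6 * ?n < \<epsilon> / 3" using elim(2) by linarith
      have k: "K * (ca * R powr (\<beta> - 1)) < \<epsilon> / 3" using elim(1) by (simp only: mult.assoc)
      have int: "integrable lborel (\<lambda>x. (\<Sum>j\<in>UNIV. DD j d x) * W x)"
        "integrable lborel (\<lambda>x. (\<Sum>j\<in>UNIV. U j x * D j d x) * W x)"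
        "integrable lborel (\<lambda>x. (\<Sum>j\<in>UNIV. U j x * D d j x) * W x)"
        by (intro supp_in_integrable[where R = R] continuous_on_mult continuous_on_sum cDD cU cD cW supp_in_mult)+
      have "(\<integral>x. dQ d x * W x \<partial>lborel) = (\<integral>x. (\<Sum>j\<in>UNIV. DD j d x) * W x \<partial>lborel)
          - (\<integral>x. (\<Sum>j\<in>UNIV. U j x * D j d x) * W x \<partial>lborel) + (\<integral>x. (\<Sum>j\<in>UNIV. U j x * D d j x) * W x \<partial>lborel)"
        unfolding dQ_def distrib_right left_diff_distrib
        by (subst Bochner_Integration.integral_add[OF Bochner_Integration.integrable_diff[OF int(1,2)] int(3)],
            subst Bochner_Integration.integral_diff[OF int(1,2)]) (rule refl)
      moreover have "\<bar>\<integral>x. (\<Sum>j\<in>UNIV. DD j d x) * W x \<partial>lborel\<bar> \<le> \<epsilon> / 3 + K * (ca * R powr (\<beta> - 1))" by (rule K(2)[OF W])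
      moreover have "\<bar>\<integral>x. (\<Sum>j\<in>UNIV. U j x * D j d x) * W x \<partial>lborel\<bar> \<le> 3 * ?n"
        using nonlinear_part_bound[OF cW c(2)[OF R], of "\<lambda>j. j" "\<lambda>j. d"] by simp
      moreover have "\<bar>\<integral>x. (\<Sum>j\<in>UNIV. U j x * D d j x) * W x \<partial>lborel\<bar> \<le> 3 * ?n"
        using nonlinear_part_bound[OF cW c(2)[OF R], of "\<lambda>j. d" "\<lambda>j. j"] by simp
      ultimately show "\<bar>\<integral>x. dQ d x * W x \<partial>lborel\<bar> \<le> \<epsilon>"
        using n k by linarith
    qed
  qed
qed

definition flux :: "real \<Rightarrow> 3 \<Rightarrow> real^3 \<Rightarrow> real" where "flux R i x = U i x * cutoff1 R i x"

lemma supp_in_flux: "R > 0 \<Longrightarrow> supp_in R (flux R i)"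
  unfolding flux_def[abs_def] by (intro supp_in_mult supp_in_cutoff1)

lemma continuous_flux: "R > 0 \<Longrightarrow> continuous_on UNIV (flux R i)"
  unfolding flux_def[abs_def] by (intro continuous_on_mult continuous_cutoff1 cU)

lemma integrable_cube: "continuous_on UNIV f \<Longrightarrow> integrable lborel (\<lambda>x. indicator (cube R) x * (f x :: real))"
  for f :: "real^3 \<Rightarrow> real"
  using borel_integrable_compact[of "cube R" f] by (auto simp: cube_def intro: continuous_on_subset)

text \<open>
Each derivative of the cutoff gains a factor \<open>1/R\<close>, and \<open>u\<close> has norm at most of order \<open>R\<close> on the cube,
since \<open>\<alpha> \<le> 1\<close>.
\<close>

lemma tame_flux:
  assumes \<alpha>: "\<alpha> \<le> 1"
  obtains c where "c \<ge> 0" "\<And>R i. R \<ge> 1 \<Longrightarrow> tame R (c / R\<^sup>2) (flux R i)"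
proof -
  obtain c where c: "c \<ge> 0"
    "\<And>R i. R \<ge> 1 \<Longrightarrow> (\<integral>x. indicator (cube R) x * (U i x)\<^sup>2 \<partial>lborel) \<le> c * R powr (2 * \<alpha>)"
    using local_L2 by blast
  have c2: "(\<integral>x. indicator (cube R) x * (U i x)\<^sup>2 \<partial>lborel) \<le> c * R\<^sup>2" if "R \<ge> 1" for R i
  proof -
    have "R powr (2 * \<alpha>) \<le> R powr 2" using that \<alpha> by (intro powr_mono) auto
    then have "R powr (2 * \<alpha>) \<le> R\<^sup>2" using that by simp
    then show ?thesis using c(2)[OF that, of i] c(1) by (meson mult_left_mono order_trans)
  qed
  show thesis
  proof (rule that)
    show "0 \<le> 72 * E0 + 2592 * c" using E0_nonneg c by simp
    fix R :: real and i assume R1: "R \<ge> 1"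
    then have R: "R > 0" by simp
    note iU = integrable_cube[OF continuous_on_power[OF cU[of i]], of R 2]
    have sq1: "(cutoff1 R j x)\<^sup>2 \<le> 36 / R\<^sup>2" for j and x :: "real^3"
    proof -
      have "\<bar>cutoff1 R j x\<bar>\<^sup>2 \<le> (6 / R)\<^sup>2" by (intro power_mono cutoff1_bound[OF R]) simp
      then show ?thesis by (simp add: power_divide)
    qed
    have sq2: "(cutoff2 R i j x)\<^sup>2 \<le> 1296 / R ^ 4" for j and x :: "real^3"
    proof -
      have "\<bar>cutoff2 R i j x\<bar>\<^sup>2 \<le> (36 / R\<^sup>2)\<^sup>2" by (intro power_mono cutoff2_bound[OF R]) simp
      then show ?thesis by (simp add: power_divide flip: power_mult)
    qed
    have "(L2sq (flux R i)) \<le> (\<integral>x. 36 / R\<^sup>2 * (indicator (cube R) x * (U i x)\<^sup>2) \<partial>lborel)"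
    proof (rule integral_mono)
      show "integrable lborel (\<lambda>x. (flux R i x)\<^sup>2)"
        by (intro supp_in_integrable[where R = R] supp_in_square supp_in_flux continuous_on_power continuous_flux R)
      show "integrable lborel (\<lambda>x. 36 / R\<^sup>2 * (indicator (cube R) x * (U i x)\<^sup>2))"
        by (intro integrable_mult_right iU)
      fix x
      show "(flux R i x)\<^sup>2 \<le> 36 / R\<^sup>2 * (indicator (cube R) x * (U i x)\<^sup>2)"
      proof (cases "x \<in> cube R")
        case True
        have "(cutoff1 R i x)\<^sup>2 * (U i x)\<^sup>2 \<le> 36 / R\<^sup>2 * (U i x)\<^sup>2" by (intro mult_right_mono sq1) simp
        then show ?thesis using True by (simp add: flux_def power_mult_distrib mult.commute)
      next
        case False then show ?thesis using supp_in_flux[OF R, of i] unfolding supp_in_iff by simp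
      qed
    qed
    also have "\<dots> = 36 / R\<^sup>2 * (\<integral>x. indicator (cube R) x * (U i x)\<^sup>2 \<partial>lborel)" by (rule integral_mult_right_zero)
    also have "\<dots> \<le> 36 / R\<^sup>2 * (c * R\<^sup>2)" by (intro mult_left_mono c2 R1) simp
    also have "\<dots> = 36 * c" using R by simp
    also have "\<dots> \<le> R\<^sup>2 * ((72 * E0 + 2592 * c) / R\<^sup>2)" using R E0_nonneg c by simp
    finally have N: "(L2sq (flux R i)) \<le> R\<^sup>2 * ((72 * E0 + 2592 * c) / R\<^sup>2)" .
    have D: "\<exists>f'. continuous_on UNIV f' \<and> has_pd j (flux R i) f' \<and> (L2sq f') \<le> (72 * E0 + 2592 * c) / R\<^sup>2" for j
    proof (intro exI conjI)
      let ?f = "\<lambda>x. D j i x * cutoff1 R i x + U i x * cutoff2 R i j x"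
      show pd: "has_pd j (flux R i) ?f"
        unfolding flux_def[abs_def] by (rule has_pd_mult[OF pdU has_pd_cutoff1[OF R]])
      show cf: "continuous_on UNIV ?f"
        by (intro continuous_on_add continuous_on_mult cD cU continuous_cutoff1 continuous_cutoff2 R)
      have sf: "supp_in R ?f" by (rule has_pd_supp[OF pd supp_in_flux[OF R]])
      have "(L2sq ?f) \<le> (\<integral>x. 72 / R\<^sup>2 * (D j i x)\<^sup>2 + 2592 / R ^ 4 * (indicator (cube R) x * (U i x)\<^sup>2) \<partial>lborel)"
      proof (rule integral_mono)
        show "integrable lborel (\<lambda>x. (?f x)\<^sup>2)"
          by (intro supp_in_integrable[where R = R] supp_in_square sf continuous_on_power cf)
        show "integrable lborel (\<lambda>x. 72 / R\<^sup>2 * (D j i x)\<^sup>2 + 2592 / R ^ 4 * (indicator (cube R) x * (U i x)\<^sup>2))"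
          by (intro Bochner_Integration.integrable_add integrable_mult_right iU finite_energy)
        fix x
        show "(?f x)\<^sup>2 \<le> 72 / R\<^sup>2 * (D j i x)\<^sup>2 + 2592 / R ^ 4 * (indicator (cube R) x * (U i x)\<^sup>2)"
        proof (cases "x \<in> cube R")
          case True
          have "(?f x)\<^sup>2 \<le> 2 * (D j i x * cutoff1 R i x)\<^sup>2 + 2 * (U i x * cutoff2 R i j x)\<^sup>2"
            using zero_le_power2[of "D j i x * cutoff1 R i x - U i x * cutoff2 R i j x"]
            unfolding power2_sum power2_diff by linarith
          also have "\<dots> \<le> 2 * ((D j i x)\<^sup>2 * (36 / R\<^sup>2)) + 2 * ((U i x)\<^sup>2 * (1296 / R ^ 4))"
            unfolding power_mult_distrib by (intro add_mono mult_left_mono sq1 sq2) auto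
          finally show ?thesis using True by (simp add: mult.commute)
        next
          case False
          then have "?f x = 0" using sf unfolding supp_in_iff by blast
          then show ?thesis using False by simp
        qed
      qed
      also have "\<dots> = 72 / R\<^sup>2 * (L2sq (D j i)) + 2592 / R ^ 4 * (\<integral>x. indicator (cube R) x * (U i x)\<^sup>2 \<partial>lborel)"
        by (subst Bochner_Integration.integral_add) (auto intro!: integrable_mult_right iU finite_energy)
      also have "\<dots> \<le> 72 / R\<^sup>2 * E0 + 2592 / R ^ 4 * (c * R\<^sup>2)"
        by (intro add_mono mult_left_mono c2 R1 E0_bound) auto
      also have "\<dots> = (72 * E0 + 2592 * c) / R\<^sup>2"
        using R by (simp add: power4_eq_xxxx power2_eq_square add_divide_distrib)
      finally show "(L2sq ?f) \<le> (72 * E0 + 2592 * c) / R\<^sup>2" .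
    qed
    show "tame R ((72 * E0 + 2592 * c) / R\<^sup>2) (flux R i)"
      unfolding tame_def using N D continuous_flux[OF R] supp_in_flux[OF R] by blast
  qed
qed

text \<open>
Along a line the other factors of the cutoff are constant.  Integrating by parts against the primitive of
\<open>u\<^sub>i\<close>, which is at most \<open>C (4R)\<^bsup>\<beta>\<^esup>\<close>, leaves derivatives of the bump, of sizes \<open>6/R\<close> and \<open>30/R\<^sup>2\<close>.
The constant is \<open>(6 + 4 * 30) * 4\<close>, with \<open>(4R)\<^bsup>\<beta>\<^esup> \<le> 4 R\<^bsup>\<beta>\<^esup>\<close>.
\<close>

lemma flux_line_bound:
  assumes R: "R \<ge> 1" and b: "- 2 * R \<le> b" "b \<le> 2 * R"
  shows "\<bar>prim (\<lambda>s. flux R i (upd i s x)) (- 2 * R) b\<bar> \<le> 504 * C * R powr (\<beta> - 1)"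
proof -
  have R0: "R > 0" using R by simp
  define M where "M = (\<Prod>l\<in>UNIV - {i}. bump R (x $ l))"
  define B where "B = C * (4 * R) powr \<beta>"
  have B: "0 \<le> B" unfolding B_def using C_pos by simp
  have M: "0 \<le> M" "M \<le> 1" unfolding M_def by (auto intro!: prod_nonneg prod_le_1 bump_nonneg bump_le_1)
  have "cutoff1 R i (upd i s x) = M * bump1 R s" for s
  proof -
    have "cutoff1 R i (upd i s x) = bump1 R s * (\<Prod>l\<in>UNIV - {i}. (if l = i then bump1 R else bump R) (upd i s x $ l))"
      unfolding cutoff1_def by (subst prod.remove[of UNIV i]) (auto simp: upd_nth)
    also have "(\<Prod>l\<in>UNIV - {i}. (if l = i then bump1 R else bump R) (upd i s x $ l)) = M"
      unfolding M_def by (intro prod.cong) (auto simp: upd_nth)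
    finally show ?thesis by (simp add: mult.commute)
  qed
  then have eq: "prim (\<lambda>s. flux R i (upd i s x)) (- 2 * R) b = M * prim (\<lambda>s. U i (upd i s x) * bump1 R s) (- 2 * R) b"
    unfolding flux_def prim_cmult[symmetric] by (simp add: mult.left_commute)
  let ?u = "\<lambda>s. U i (upd i s x)"
  note cu = continuous_on_line[OF cU, of i i x]
  have V: "\<bar>prim ?u (- 2 * R) s\<bar> \<le> B" if "- 2 * R \<le> s" "s \<le> 2 * R" for s
  proof -
    have "\<bar>prim ?u (- 2 * R) s\<bar> \<le> C * \<bar>s - - 2 * R\<bar> powr \<beta>" by (rule line)
    also have "\<dots> \<le> B" unfolding B_def using that \<beta>_pos C_pos by (intro mult_left_mono powr_mono2) auto
    finally show ?thesis .
  qed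
  have cV: "continuous_on UNIV (\<lambda>s. prim ?u (- 2 * R) s * bump2 R s)"
    by (intro continuous_on_mult continuous_prim cu continuous_bump2 R0)
  have "\<bar>prim ?u (- 2 * R) b * bump1 R b\<bar> \<le> B * (6 / R)"
    unfolding abs_mult by (intro mult_mono V b bump1_bound[OF R0] B) auto
  moreover have "\<bar>prim (\<lambda>s. prim ?u (- 2 * R) s * bump2 R s) (- 2 * R) b\<bar> \<le> \<bar>b - - 2 * R\<bar> * (B * (30 / R\<^sup>2))"
  proof (rule prim_bound[OF cV])
    fix s assume "min (- 2 * R) b \<le> s" "s \<le> max (- 2 * R) b"
    then have "- 2 * R \<le> s" "s \<le> 2 * R" using b by auto
    then show "\<bar>prim ?u (- 2 * R) s * bump2 R s\<bar> \<le> B * (30 / R\<^sup>2)"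
      unfolding abs_mult by (intro mult_mono V bump2_bound[OF R0] B) auto
  qed
  moreover have "\<bar>b - - 2 * R\<bar> * (B * (30 / R\<^sup>2)) \<le> (4 * R) * (B * (30 / R\<^sup>2))"
    using b B by (intro mult_right_mono) auto
  moreover have "prim (\<lambda>s. ?u s * bump1 R s) (- 2 * R) b = prim ?u (- 2 * R) b * bump1 R b - prim (\<lambda>s. prim ?u (- 2 * R) s * bump2 R s) (- 2 * R) b"
    by (rule prim_by_parts[OF cu bump1_derivative[OF R0] continuous_bump2[OF R0]])
  ultimately have "\<bar>prim (\<lambda>s. ?u s * bump1 R s) (- 2 * R) b\<bar> \<le> B * (6 / R) + (4 * R) * (B * (30 / R\<^sup>2))"
    by linarith
  also have "\<dots> = 126 * B / R" using R0 by (simp add: power2_eq_square field_simps)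
  also have "\<dots> \<le> 126 * (C * (4 * R powr \<beta>)) / R"
  proof -
    have "4 powr \<beta> \<le> 4 powr (1::real)" using \<beta>_less_1 by (intro powr_mono) auto
    then have "B \<le> C * (4 * R powr \<beta>)"
      unfolding B_def using C_pos R by (intro mult_left_mono) (auto simp: powr_mult intro!: mult_right_mono)
    then show ?thesis using R0 by (intro divide_right_mono mult_left_mono) auto
  qed
  also have "\<dots> = 504 * C * R powr (\<beta> - 1)" using R0 by (simp add: powr_diff)
  finally have fin: "\<bar>prim (\<lambda>s. ?u s * bump1 R s) (- 2 * R) b\<bar> \<le> 504 * C * R powr (\<beta> - 1)" .
  have "M * \<bar>prim (\<lambda>s. ?u s * bump1 R s) (- 2 * R) b\<bar> \<le> 1 * \<bar>prim (\<lambda>s. ?u s * bump1 R s) (- 2 * R) b\<bar>"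
    by (intro mult_right_mono M) simp
  then show ?thesis unfolding eq abs_mult using M fin by simp
qed

end

section \<open>The energy argument\<close>

lemma three_directions:
  obtains j k :: 3 where "i \<noteq> j" "i \<noteq> k" "j \<noteq> k" "\<And>l. l = i \<or> l = j \<or> l = k"
proof -
  consider "i = 1" | "i = 2" | "i = 3" using exhaust_3[of i] by blast
  then show thesis
  proof cases
    case 1 show thesis by (rule that[of 2 3]) (use 1 exhaust_3 in auto)
  next
    case 2 show thesis by (rule that[of 1 3]) (use 2 exhaust_3 in auto)
  next
    case 3 show thesis by (rule that[of 1 2]) (use 3 exhaust_3 in auto)
  qed
qed

lemma cutoff_three:
  assumes "i \<noteq> j" "i \<noteq> k" "j \<noteq> k" "\<And>l :: 3. l = i \<or> l = j \<or> l = k"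
  shows "cutoff R x = bump R (x $ i) * bump R (x $ j) * bump R (x $ k)"
proof -
  have "UNIV = {i, j, k}" using assms(4) by blast
  then have "cutoff R x = (\<Prod>l\<in>{i, j, k}. bump R (x $ l))" unfolding cutoff_def by (simp only:)
  then show ?thesis using assms(1-3) by (simp add: mult.assoc)
qed

context steady_flow
begin

lemma total_flux_zero:
  assumes R: "R > 0"
  shows "(\<Sum>i\<in>UNIV. \<integral>x. flux R i x \<partial>lborel) = 0"
proof -
  have int: "integrable lborel (\<lambda>x. D i i x * cutoff R x)" "integrable lborel (flux R i)" for i
    by (intro supp_in_integrable[where R = R] continuous_on_mult cD continuous_cutoff continuous_flux supp_in_mult supp_in_cutoff supp_in_flux R)+
  have "(\<integral>x. D i i x * cutoff R x \<partial>lborel) = - (\<integral>x. flux R i x \<partial>lborel)" for i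
    unfolding flux_def
    by (rule integral_by_parts_pd[OF cU cD pdU continuous_cutoff[OF R] continuous_cutoff1[OF R] has_pd_cutoff[OF R] supp_in_cutoff[OF R]])
  then have "(\<Sum>i\<in>UNIV. \<integral>x. flux R i x \<partial>lborel) = - (\<Sum>i\<in>UNIV. \<integral>x. D i i x * cutoff R x \<partial>lborel)"
    by (simp add: sum_negf)
  also have "(\<Sum>i\<in>UNIV. \<integral>x. D i i x * cutoff R x \<partial>lborel) = (\<integral>x. (\<Sum>i\<in>UNIV. D i i x * cutoff R x) \<partial>lborel)"
    by (rule Bochner_Integration.integral_sum[symmetric]) (rule int)
  also have "\<dots> = 0" unfolding sum_distrib_right[symmetric] incompressible by simp
  finally show ?thesis by simp
qed

lemma integral_cutoff_pos:
  assumes R: "R > 0"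
  shows "0 < (\<integral>x. cutoff R x \<partial>(lborel :: (real^3) measure))"
proof (rule ccontr)
  have int: "integrable (lborel :: (real^3) measure) (cutoff R)"
    by (rule supp_in_integrable[OF continuous_cutoff[OF R] supp_in_cutoff[OF R]])
  have "0 \<le> (\<integral>x. cutoff R x \<partial>(lborel :: (real^3) measure))"
    by (intro integral_nonneg_AE AE_I2 cutoff_nonneg)
  moreover assume "\<not> ?thesis"
  ultimately have "(\<integral>x. cutoff R x \<partial>(lborel :: (real^3) measure)) = 0" by simp
  from continuous_nonneg_integral_zero[OF continuous_cutoff[OF R] int cutoff_nonneg this, of 0]
  show False by (simp add: cutoff_def bump_def)
qed

text \<open>
The identity obtained from \<open>u \<cdot> \<nabla>Q = u \<cdot> \<Delta>u\<close> by multiplying with the cutoff and integrating both sides by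
parts; on the left the divergence of \<open>u\<close> drops out.
\<close>

lemma energy_identity:
  assumes R: "R > 0"
  shows "(\<Sum>i\<in>UNIV. \<Sum>j\<in>UNIV. \<integral>x. cutoff R x * (D j i x)\<^sup>2 \<partial>lborel)
    = (\<Sum>i\<in>UNIV. \<integral>x. Q x * flux R i x \<partial>lborel) - (\<Sum>i\<in>UNIV. \<Sum>j\<in>UNIV. \<integral>x. U i x * D j i x * cutoff1 R j x \<partial>lborel)"
proof -
  note c = continuous_cutoff[OF R] and c1 = continuous_cutoff1[OF R] and s = supp_in_cutoff[OF R] and s1 = supp_in_cutoff1[OF R]
  have int: "integrable lborel (\<lambda>x. Q x * (D i i x * cutoff R x))" "integrable lborel (\<lambda>x. Q x * flux R i x)"
    "integrable lborel (\<lambda>x. dQ i x * (U i x * cutoff R x))"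
    "integrable lborel (\<lambda>x. DD j i x * (U i x * cutoff R x))"
    "integrable lborel (\<lambda>x. cutoff R x * (D j i x)\<^sup>2)"
    "integrable lborel (\<lambda>x. U i x * D j i x * cutoff1 R j x)" for i j
    unfolding flux_def
    by (intro supp_in_integrable[where R = R] continuous_on_mult continuous_on_power cD cU cDD continuous_Q continuous_dQ c c1 supp_in_mult s s1)+
  have A: "(\<integral>x. dQ i x * (U i x * cutoff R x) \<partial>lborel)
      = - (\<integral>x. Q x * (D i i x * cutoff R x) \<partial>lborel) - (\<integral>x. Q x * flux R i x \<partial>lborel)" for i
  proof -
    have "(\<integral>x. dQ i x * (U i x * cutoff R x) \<partial>lborel) = - (\<integral>x. Q x * (D i i x * cutoff R x + U i x * cutoff1 R i x) \<partial>lborel)"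
      by (rule integral_by_parts_pd[OF continuous_Q continuous_dQ has_pd_Q _ _ has_pd_mult[OF pdU has_pd_cutoff[OF R]] supp_in_mult(2)[OF s]])
         (intro continuous_on_mult continuous_on_add cU cD c c1)+
    also have "(\<integral>x. Q x * (D i i x * cutoff R x + U i x * cutoff1 R i x) \<partial>lborel)
        = (\<integral>x. Q x * (D i i x * cutoff R x) \<partial>lborel) + (\<integral>x. Q x * flux R i x \<partial>lborel)"
      unfolding distrib_left flux_def[symmetric] by (rule Bochner_Integration.integral_add[OF int(1,2)])
    finally show ?thesis by simp
  qed
  have B: "(\<integral>x. DD j i x * (U i x * cutoff R x) \<partial>lborel)
      = - (\<integral>x. cutoff R x * (D j i x)\<^sup>2 \<partial>lborel) - (\<integral>x. U i x * D j i x * cutoff1 R j x \<partial>lborel)" for i j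
  proof -
    have "(\<integral>x. DD j i x * (U i x * cutoff R x) \<partial>lborel) = - (\<integral>x. D j i x * (D j i x * cutoff R x + U i x * cutoff1 R j x) \<partial>lborel)"
      by (rule integral_by_parts_pd[OF cD cDD pdD _ _ has_pd_mult[OF pdU has_pd_cutoff[OF R]] supp_in_mult(2)[OF s]])
         (intro continuous_on_mult continuous_on_add cU cD c c1)+
    also have "(\<lambda>x. D j i x * (D j i x * cutoff R x + U i x * cutoff1 R j x))
        = (\<lambda>x. cutoff R x * (D j i x)\<^sup>2 + U i x * D j i x * cutoff1 R j x)"
      by (simp add: fun_eq_iff power2_eq_square algebra_simps)
    also have "(\<integral>x. cutoff R x * (D j i x)\<^sup>2 + U i x * D j i x * cutoff1 R j x \<partial>lborel)
        = (\<integral>x. cutoff R x * (D j i x)\<^sup>2 \<partial>lborel) + (\<integral>x. U i x * D j i x * cutoff1 R j x \<partial>lborel)"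
      by (rule Bochner_Integration.integral_add[OF int(5,6)])
    finally show ?thesis by simp
  qed
  have "(\<Sum>i\<in>UNIV. \<integral>x. Q x * (D i i x * cutoff R x) \<partial>lborel) = (\<integral>x. (\<Sum>i\<in>UNIV. Q x * (D i i x * cutoff R x)) \<partial>lborel)"
    by (rule Bochner_Integration.integral_sum[symmetric]) (rule int)
  also have "\<dots> = 0" unfolding sum_distrib_left[symmetric] sum_distrib_right[symmetric] incompressible by simp
  finally have div: "(\<Sum>i\<in>UNIV. \<integral>x. Q x * (D i i x * cutoff R x) \<partial>lborel) = 0" .
  have "(\<Sum>i\<in>UNIV. \<integral>x. dQ i x * (U i x * cutoff R x) \<partial>lborel) = (\<integral>x. (\<Sum>i\<in>UNIV. dQ i x * (U i x * cutoff R x)) \<partial>lborel)"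
    by (rule Bochner_Integration.integral_sum[symmetric]) (rule int)
  also have "(\<lambda>x. \<Sum>i\<in>UNIV. dQ i x * (U i x * cutoff R x)) = (\<lambda>x. \<Sum>i\<in>UNIV. \<Sum>j\<in>UNIV. DD j i x * (U i x * cutoff R x))"
  proof
    fix x
    have "(\<Sum>i\<in>UNIV. dQ i x * (U i x * cutoff R x)) = (\<Sum>i\<in>UNIV. U i x * dQ i x) * cutoff R x"
      unfolding sum_distrib_right by (simp add: mult_ac)
    also have "\<dots> = (\<Sum>i\<in>UNIV. \<Sum>j\<in>UNIV. DD j i x * (U i x * cutoff R x))"
      unfolding U_dot_dQ sum_distrib_right by (simp add: mult_ac)
    finally show "(\<Sum>i\<in>UNIV. dQ i x * (U i x * cutoff R x)) = (\<Sum>i\<in>UNIV. \<Sum>j\<in>UNIV. DD j i x * (U i x * cutoff R x))" .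
  qed
  also have "(\<integral>x. (\<Sum>i\<in>UNIV. \<Sum>j\<in>UNIV. DD j i x * (U i x * cutoff R x)) \<partial>lborel)
      = (\<Sum>i\<in>UNIV. \<integral>x. (\<Sum>j\<in>UNIV. DD j i x * (U i x * cutoff R x)) \<partial>lborel)"
    by (rule Bochner_Integration.integral_sum) (intro Bochner_Integration.integrable_sum int)
  also have "\<dots> = (\<Sum>i\<in>UNIV. \<Sum>j\<in>UNIV. \<integral>x. DD j i x * (U i x * cutoff R x) \<partial>lborel)"
    by (intro sum.cong refl Bochner_Integration.integral_sum int)
  finally have "(\<Sum>i\<in>UNIV. \<integral>x. dQ i x * (U i x * cutoff R x) \<partial>lborel)
      = (\<Sum>i\<in>UNIV. \<Sum>j\<in>UNIV. \<integral>x. DD j i x * (U i x * cutoff R x) \<partial>lborel)" .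
  then show ?thesis unfolding A B sum_subtractf sum_negf div by linarith
qed

text \<open>
Integrating the decomposition of each flux shows that its coefficient \<open>\<kappa>\<^sub>i\<close> is the total of that flux
divided by the integral of the cutoff.  The totals add up to \<open>0\<close>, so the terms \<open>\<kappa>\<^sub>i \<integral> Q \<phi>\<close> cancel and the size
of \<open>Q\<close>, in particular of the pressure, never enters.
\<close>

lemma head_flux_vanishes:
  assumes small: "\<alpha> + \<beta> < 1" and "\<epsilon> > 0"
  shows "\<forall>\<^sub>F R in at_top. \<bar>\<Sum>i\<in>UNIV. \<integral>x. Q x * flux R i x \<partial>lborel\<bar> \<le> 9 * \<epsilon>"
proof -
  have "\<alpha> \<le> 1" using small \<beta>_pos by simp
  from tame_flux[OF this] obtain c where c: "c \<ge> 0" "\<And>R i. R \<ge> 1 \<Longrightarrow> tame R (c / R\<^sup>2) (flux R i)" by blast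
  define Dc where "Dc = 770 * 13824\<^sup>2 * c"
  define ca where "ca = 512 * (504 * C)"
  have "Dc \<ge> 0" "ca \<ge> 0" unfolding Dc_def ca_def using c C_pos by auto
  note ev = head_gradient_pairing_vanishes[OF small this assms(2)]
  have "\<forall>\<^sub>F R in at_top. \<forall>d. \<forall>W :: real^3 \<Rightarrow> real. piece R (ca * R powr (\<beta> - 1)) Dc W \<longrightarrow> \<bar>\<integral>x. dQ d x * W x \<partial>lborel\<bar> \<le> \<epsilon>"
    by (rule eventually_all_finite) (rule ev)
  then show ?thesis using eventually_ge_at_top[of "1::real"]
  proof eventually_elim
    case (elim R)
    let ?c = "\<integral>x. cutoff R x \<partial>(lborel :: (real^3) measure)" and ?q = "\<integral>x. Q x * cutoff R x \<partial>lborel"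
    let ?f = "\<lambda>i. \<integral>x. Q x * flux R i x \<partial>lborel"
    have R: "R > 0" using elim by simp
    have pd: "\<bar>\<integral>x. dQ d x * W x \<partial>lborel\<bar> \<le> \<epsilon>" if "piece R (ca * R powr (\<beta> - 1)) Dc W" for d W
      by (rule elim(1)[rule_format, OF that])
    have "\<forall>i. \<exists>\<kappa>. \<bar>?f i - \<kappa> * ?q\<bar> \<le> 3 * \<epsilon>
        \<and> (\<integral>x. flux R i x \<partial>lborel) = \<kappa> * ?c"
    proof
      fix i :: 3
      obtain j k where ijk: "i \<noteq> j" "i \<noteq> k" "j \<noteq> k" "\<And>l. l = i \<or> l = j \<or> l = k" using three_directions[of i] by blast
      have I: "\<bar>line_total R i (flux R i) x\<bar> \<le> 504 * C * R powr (\<beta> - 1)" for x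
        unfolding line_total_def by (rule flux_line_bound) (use elim in auto)
      have P: "\<bar>line_part R i (flux R i) x\<bar> \<le> 504 * C * R powr (\<beta> - 1)" if "\<bar>x $ i\<bar> \<le> R" for x
        unfolding line_part_def by (rule flux_line_bound) (use elim that in auto)
      have A: "512 * (504 * C * R powr (\<beta> - 1)) = ca * R powr (\<beta> - 1)" by (simp add: ca_def)
      have B: "770 * 13824\<^sup>2 * (R\<^sup>2 * (c / R\<^sup>2)) = Dc" using R by (simp add: Dc_def)
      have t: "tame R (c / R\<^sup>2) (flux R i)" by (rule c(2)) (use elim in simp)
      obtain W1 W2 W3 w1 w2 w3 \<kappa> where
        W1: "piece R (ca * R powr (\<beta> - 1)) Dc W1" "has_pd i W1 w1" "continuous_on UNIV w1" and
        W2: "piece R (ca * R powr (\<beta> - 1)) Dc W2" "has_pd j W2 w2" "continuous_on UNIV w2" and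
        W3: "piece R (ca * R powr (\<beta> - 1)) Dc W3" "has_pd k W3 w3" "continuous_on UNIV w3" and
        eq: "\<And>x. flux R i x = w1 x + w2 x + w3 x + \<kappa> * (bump R (x $ i) * bump R (x $ j) * bump R (x $ k))"
        by (rule divergence_decomposition[OF R t I P ijk, unfolded A B]) (assumption, (rule that; assumption))
      have eq': "flux R i x = w1 x + w2 x + w3 x + \<kappa> * cutoff R x" for x
        unfolding eq cutoff_three[OF ijk] ..
      have one: "\<bar>\<integral>x. Q x * w x \<partial>lborel\<bar> \<le> \<epsilon>" "(\<integral>x. w x \<partial>lborel) = 0"
        "integrable lborel w" "integrable lborel (\<lambda>x. Q x * w x)"
        if W: "piece R (ca * R powr (\<beta> - 1)) Dc W" "has_pd d W w" "continuous_on UNIV w" for d W w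
      proof -
        have cW: "continuous_on UNIV W" "supp_in R W" using W unfolding piece_def by auto
        note sw = has_pd_supp[OF W(2) cW(2)]
        have "(\<integral>x. Q x * w x \<partial>lborel) = - (\<integral>x. dQ d x * W x \<partial>lborel)"
          using integral_by_parts_pd[OF continuous_Q continuous_dQ has_pd_Q cW(1) W(3,2) cW(2)] by simp
        then show "\<bar>\<integral>x. Q x * w x \<partial>lborel\<bar> \<le> \<epsilon>" using pd[OF W(1), of d] by simp
        show "(\<integral>x. w x \<partial>lborel) = 0" by (rule integral_pd_eq_0[OF cW(1) W(3,2) cW(2)])
        show "integrable lborel w" "integrable lborel (\<lambda>x. Q x * w x)"
          by (intro supp_in_integrable[where R = R] W sw continuous_on_mult continuous_Q supp_in_mult)+
      qed
      note o1 = one[OF W1] and o2 = one[OF W2] and o3 = one[OF W3]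
      have ic: "integrable (lborel :: (real^3) measure) (\<lambda>x. \<kappa> * cutoff R x)" "integrable lborel (\<lambda>x. Q x * (\<kappa> * cutoff R x))"
        by (intro supp_in_integrable[where R = R] continuous_on_mult continuous_Q continuous_on_const continuous_cutoff R supp_in_mult supp_in_cutoff)+
      have "(\<integral>x. flux R i x \<partial>lborel) = (\<integral>x. w1 x \<partial>lborel) + (\<integral>x. w2 x \<partial>lborel) + (\<integral>x. w3 x \<partial>lborel) + (\<integral>x. \<kappa> * cutoff R x \<partial>(lborel :: (real^3) measure))"
        unfolding eq' by (simp only: Bochner_Integration.integral_add Bochner_Integration.integrable_add o1(3) o2(3) o3(3) ic(1))
      then have f: "(\<integral>x. flux R i x \<partial>lborel) = \<kappa> * ?c"
        unfolding o1(2) o2(2) o3(2) by simp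
      have "?f i = (\<integral>x. Q x * w1 x \<partial>lborel) + (\<integral>x. Q x * w2 x \<partial>lborel) + (\<integral>x. Q x * w3 x \<partial>lborel) + (\<integral>x. Q x * (\<kappa> * cutoff R x) \<partial>lborel)"
        unfolding eq' distrib_left by (simp only: Bochner_Integration.integral_add Bochner_Integration.integrable_add o1(4) o2(4) o3(4) ic(2))
      also have "(\<integral>x. Q x * (\<kappa> * cutoff R x) \<partial>lborel) = \<kappa> * ?q"
        by (simp add: mult.left_commute)
      finally have "\<bar>?f i - \<kappa> * ?q\<bar> \<le> 3 * \<epsilon>"
        using o1(1) o2(1) o3(1) by linarith
      then show "\<exists>\<kappa>. \<bar>?f i - \<kappa> * ?q\<bar> \<le> 3 * \<epsilon>
        \<and> (\<integral>x. flux R i x \<partial>lborel) = \<kappa> * ?c"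
        using f by (intro exI[of _ \<kappa>] conjI)
    qed
    from choice[OF this] obtain \<kappa> where *: "\<forall>i. \<bar>?f i - \<kappa> i * ?q\<bar> \<le> 3 * \<epsilon>
        \<and> (\<integral>x. flux R i x \<partial>lborel) = \<kappa> i * ?c" ..
    note \<kappa> = conjunct1[OF spec[OF *]] conjunct2[OF spec[OF *]]
    have "(\<Sum>i\<in>UNIV. \<kappa> i) * ?c = 0"
      using total_flux_zero[OF R] unfolding \<kappa>(2) sum_distrib_right .
    then have "(\<Sum>i\<in>UNIV. \<kappa> i) = 0" using integral_cutoff_pos[OF R] by simp
    then have eq: "(\<Sum>i\<in>UNIV. \<integral>x. Q x * flux R i x \<partial>lborel)
        = (\<Sum>i\<in>UNIV. ?f i - \<kappa> i * ?q)"
      unfolding sum_subtractf sum_distrib_right[symmetric] by simp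
    have "\<bar>\<Sum>i\<in>UNIV. ?f i - \<kappa> i * ?q\<bar> \<le> (\<Sum>i\<in>(UNIV :: 3 set). 3 * \<epsilon>)"
      by (rule order_trans[OF sum_abs sum_mono]) (rule \<kappa>(1))
    then show ?case unfolding eq by simp
  qed
qed

lemma viscous_boundary_term_vanishes:
  assumes "\<alpha> < 1" "\<epsilon> > 0"
  shows "\<forall>\<^sub>F R in at_top. \<bar>\<Sum>i\<in>UNIV. \<Sum>j\<in>UNIV. \<integral>x. U i x * D j i x * cutoff1 R j x \<partial>lborel\<bar> \<le> \<epsilon>"
proof -
  obtain c where c: "c \<ge> 0"
    "\<And>R i. R \<ge> 1 \<Longrightarrow> (\<integral>x. indicator (cube R) x * (U i x)\<^sup>2 \<partial>lborel) \<le> c * R powr (2 * \<alpha>)"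
    using local_L2 by blast
  have "((\<lambda>R. 54 * sqrt c * sqrt E0 * R powr (\<alpha> - 1)) \<longlongrightarrow> 0) at_top" by (rule powr_neg_tendsto) (use assms in simp)
  then have "\<forall>\<^sub>F R in at_top. 54 * sqrt c * sqrt E0 * R powr (\<alpha> - 1) < \<epsilon>" using assms by (intro order_tendstoD) auto
  then show ?thesis using eventually_ge_at_top[of "1::real"]
  proof eventually_elim
    case (elim R)
    have R: "R > 0" using elim by simp
    let ?b = "6 / R * (sqrt (c * R powr (2 * \<alpha>)) * sqrt E0)"
    have S0: "0 \<le> c * R powr (2 * \<alpha>)" using c by simp
    have "\<bar>\<integral>x. U i x * D j i x * cutoff1 R j x \<partial>lborel\<bar> \<le> ?b" for i j
    proof -
      have "\<bar>\<integral>x. U i x * D j i x * cutoff1 R j x \<partial>lborel\<bar>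
          \<le> 6 / R * (sqrt (c * R powr (2 * \<alpha>)) * sqrt (L2sq (D j i)))"
        by (rule transport_bound[OF cU cD finite_energy continuous_cutoff1[OF R] supp_in_cutoff1[OF R] cutoff1_bound[OF R] c(2)])
           (use elim in simp)
      also have "\<dots> \<le> ?b" using S0 R by (intro mult_left_mono real_sqrt_le_mono E0_bound) auto
      finally show ?thesis .
    qed
    then have "(\<Sum>i\<in>UNIV. \<Sum>j\<in>UNIV. \<bar>\<integral>x. U i x * D j i x * cutoff1 R j x \<partial>lborel\<bar>) \<le> (\<Sum>i\<in>(UNIV :: 3 set). \<Sum>j\<in>(UNIV :: 3 set). ?b)"
      by (intro sum_mono)
    moreover have "\<bar>\<Sum>i\<in>UNIV. \<Sum>j\<in>UNIV. \<integral>x. U i x * D j i x * cutoff1 R j x \<partial>lborel\<bar>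
        \<le> (\<Sum>i\<in>UNIV. \<Sum>j\<in>UNIV. \<bar>\<integral>x. U i x * D j i x * cutoff1 R j x \<partial>lborel\<bar>)"
      by (rule order_trans[OF sum_abs sum_mono[OF sum_abs]])
    moreover have "(\<Sum>i\<in>(UNIV :: 3 set). \<Sum>j\<in>(UNIV :: 3 set). ?b) = 9 * ?b" by simp
    moreover have "9 * ?b = 54 * sqrt c * sqrt E0 * R powr (\<alpha> - 1)"
    proof -
      have "sqrt (R powr (2 * \<alpha>)) = R powr \<alpha>" using R by (simp add: powr_half_sqrt[symmetric] powr_powr)
      then show ?thesis using R by (simp add: real_sqrt_mult powr_diff)
    qed
    ultimately show ?case using elim(1) by linarith
  qed
qed

text \<open>
As \<open>R\<close> grows the cutoff tends to \<open>1\<close>, and both terms on the right of the energy identity tend to \<open>0\<close>.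
\<close>

theorem gradient_vanishes:
  assumes small: "\<alpha> + \<beta> < 1"
  shows "D j i x = 0"
proof -
  define F where "F i j R = (\<integral>x. cutoff R x * (D j i x)\<^sup>2 \<partial>lborel)" for i j R
  have intF: "integrable lborel (\<lambda>x. cutoff R x * (D j i x)\<^sup>2)" if "R > 0" for i j R
    by (intro supp_in_integrable[where R = R] continuous_on_mult continuous_on_power cD continuous_cutoff supp_in_mult supp_in_cutoff that)
  have F0: "0 \<le> F i j R" for i j R
    unfolding F_def by (intro integral_nonneg_AE AE_I2 mult_nonneg_nonneg cutoff_nonneg zero_le_power2)
  have lim: "(\<lambda>n. F i j (real (Suc n))) \<longlonglongrightarrow> (L2sq (D j i))"
    unfolding F_def
  proof (rule integral_dominated_convergence[OF _ _ finite_energy[of j i]])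
    show "(\<lambda>x. (D j i x)\<^sup>2) \<in> borel_measurable lborel" using finite_energy[of j i] by (rule borel_measurable_integrable)
    show "(\<lambda>x. cutoff (real (Suc n)) x * (D j i x)\<^sup>2) \<in> borel_measurable lborel" for n
      by (rule borel_measurable_integrable[OF intF]) simp
    show "AE x in lborel. (\<lambda>n. cutoff (real (Suc n)) x * (D j i x)\<^sup>2) \<longlonglongrightarrow> (D j i x)\<^sup>2"
    proof (rule AE_I2)
      fix x
      have "(\<lambda>n. cutoff (real (Suc n)) x * (D j i x)\<^sup>2) \<longlonglongrightarrow> 1 * (D j i x)\<^sup>2"
        by (intro tendsto_mult tendsto_const cutoff_tendsto_1)
      then show "(\<lambda>n. cutoff (real (Suc n)) x * (D j i x)\<^sup>2) \<longlonglongrightarrow> (D j i x)\<^sup>2" by simp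
    qed
    show "AE x in lborel. norm (cutoff (real (Suc n)) x * (D j i x)\<^sup>2) \<le> (D j i x)\<^sup>2" for n
    proof (rule AE_I2)
      fix x
      have "\<bar>cutoff (real (Suc n)) x\<bar> * (D j i x)\<^sup>2 \<le> 1 * (D j i x)\<^sup>2"
        using cutoff_nonneg[of "real (Suc n)" x] cutoff_le_1[of "real (Suc n)" x] by (intro mult_right_mono) auto
      then show "norm (cutoff (real (Suc n)) x * (D j i x)\<^sup>2) \<le> (D j i x)\<^sup>2" by (simp add: abs_mult)
    qed
  qed
  have "(L2sq (D j i)) \<le> 0 + \<epsilon>" if "\<epsilon> > 0" for \<epsilon>
  proof -
    have e: "\<epsilon> / 18 > 0" "\<epsilon> / 2 > 0" using that by auto
    have "\<alpha> < 1" using small \<beta>_pos by simp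
    have "\<forall>\<^sub>F R in at_top. F i j R \<le> \<epsilon>"
      using head_flux_vanishes[OF small e(1)] viscous_boundary_term_vanishes[OF \<open>\<alpha> < 1\<close> e(2)] eventually_gt_at_top[of "0::real"]
    proof eventually_elim
      case (elim R)
      have "F i j R \<le> (\<Sum>j\<in>UNIV. F i j R)" by (rule member_le_sum) (auto intro: F0)
      also have "\<dots> \<le> (\<Sum>i\<in>UNIV. \<Sum>j\<in>UNIV. F i j R)"
        by (rule member_le_sum[of i UNIV "\<lambda>i. \<Sum>j\<in>UNIV. F i j R"]) (auto intro: F0 sum_nonneg)
      also have "\<dots> \<le> \<epsilon>" unfolding F_def energy_identity[OF elim(3)] using elim(1,2) by linarith
      finally show ?case .
    qed
    moreover have "filterlim (\<lambda>n. real (Suc n)) at_top sequentially"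
      by (rule filterlim_compose[OF filterlim_real_sequentially filterlim_Suc])
    ultimately have "\<forall>\<^sub>F n in sequentially. F i j (real (Suc n)) \<le> \<epsilon>"
      by (rule eventually_compose_filterlim)
    then show ?thesis using tendsto_upperbound[OF lim] by simp
  qed
  then have "(L2sq (D j i)) \<le> 0" by (rule field_le_epsilon)
  then have "(L2sq (D j i)) = 0" by (simp add: antisym)
  from continuous_nonneg_integral_zero[OF continuous_on_power[OF cD] finite_energy _ this, of x]
  show ?thesis by simp
qed

end

section \<open>From the differential equations to the coordinate formulation\<close>

lemma partial_deriv_along_line:
  fixes f :: "real^'n \<Rightarrow> 'b::real_normed_vector"
  assumes "\<And>x. f differentiable (at x)"
  shows "((\<lambda>t. f (x + t *\<^sub>R axis i 1)) has_vector_derivative partial_deriv i f x) (at 0)"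
proof -
  let ?F = "frechet_derivative f (at x)"
  have F: "(f has_derivative ?F) (at (x + 0 *\<^sub>R axis i 1))" using assms by (simp add: frechet_derivative_works)
  have "((\<lambda>t. x + t *\<^sub>R axis i 1) has_derivative (\<lambda>t. t *\<^sub>R axis i 1)) (at 0)"
    by (auto intro!: derivative_eq_intros)
  from has_derivative_compose[OF this F]
  have "((\<lambda>t. f (x + t *\<^sub>R axis i 1)) has_derivative (\<lambda>t. ?F (t *\<^sub>R axis i 1))) (at 0)" .
  moreover have "(\<lambda>t. ?F (t *\<^sub>R axis i 1)) = (\<lambda>t. t *\<^sub>R partial_deriv i f x)"
    using linear_frechet_derivative[of f "at x"] assms
    by (simp add: fun_eq_iff partial_deriv_def linear_cmul)
  ultimately show ?thesis by (simp add: has_vector_derivative_def)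
qed

lemma has_pd_component:
  fixes f :: "real^'n \<Rightarrow> real^'m"
  assumes "\<And>x. f differentiable (at x)"
  shows "has_pd i (\<lambda>x. f x $ k) (\<lambda>x. partial_deriv i f x $ k)"
  unfolding has_pd_def has_real_derivative_iff_has_vector_derivative
  using bounded_linear.has_vector_derivative[OF bounded_linear_vec_nth partial_deriv_along_line[OF assms]] by blast

lemma has_pd_partial_deriv:
  fixes f :: "real^'n \<Rightarrow> real"
  assumes "\<And>x. f differentiable (at x)"
  shows "has_pd i f (partial_deriv i f)"
  unfolding has_pd_def has_real_derivative_iff_has_vector_derivative
  using partial_deriv_along_line[OF assms] by blast

lemma differentiable_everywhere_continuous:
  "(\<And>x. f differentiable (at x)) \<Longrightarrow> continuous_on UNIV f"
  by (simp add: continuous_at_imp_continuous_on differentiable_imp_continuous_within)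

lemma smooth_C2:
  assumes "smooth f"
  shows "\<And>x. f differentiable (at x)" "\<And>i x. partial_deriv i f differentiable (at x)"
    "\<And>i j. continuous_on UNIV (partial_deriv i (partial_deriv j f))"
proof -
  have "C_k (Suc (Suc 0)) f" using assms unfolding smooth_def by blast
  then show "\<And>x. f differentiable (at x)" "\<And>i x. partial_deriv i f differentiable (at x)"
    "\<And>i j. continuous_on UNIV (partial_deriv i (partial_deriv j f))" by auto
qed

lemma prim_line_eq_segment_integral:
  "prim (\<lambda>s. u (upd i s x) $ i) a b = segment_integral u (upd i a x) (upd i b x)"
proof -
  have d: "upd i b x - upd i a x = (b - a) *\<^sub>R axis i 1"
    by (simp add: vec_eq_iff upd_nth axis_def)
  have "upd i a x + \<tau> *\<^sub>R ((b - a) *\<^sub>R axis i 1) = upd i (a + \<tau> * (b - a)) x" for \<tau>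
    using upd_plus_axis[of i a x "\<tau> * (b - a)"] by simp
  then show ?thesis unfolding segment_integral_def prim_def d
    by (simp add: inner_axis mult.commute flip: integral_mult_right)
qed

lemma segment_integral_swap: "segment_integral u y x = - segment_integral u x y" if "continuous_on UNIV u" for u :: "real^'n \<Rightarrow> real^'n"
proof -
  have "((\<lambda>\<tau>. u (x + \<tau> *\<^sub>R (y - x)) \<bullet> (y - x)) has_integral segment_integral u x y) (cbox 0 1)"
    unfolding segment_integral_def cbox_interval[symmetric]
    by (intro integrable_integral integrable_continuous continuous_on_inner continuous_on_comp_UNIV[OF that])
       (intro continuous_intros)+
  from has_integral_affinity[OF this, of "-1" 1]
  have "((\<lambda>\<tau>. u (x + (1 - \<tau>) *\<^sub>R (y - x)) \<bullet> (y - x)) has_integral segment_integral u x y) {0..1}"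
    by simp
  then have "((\<lambda>\<tau>. - (u (x + (1 - \<tau>) *\<^sub>R (y - x)) \<bullet> (y - x))) has_integral - segment_integral u x y) {0..1}"
    by (rule has_integral_neg)
  moreover have "- (u (x + (1 - \<tau>) *\<^sub>R (y - x)) \<bullet> (y - x)) = u (y + \<tau> *\<^sub>R (x - y)) \<bullet> (x - y)" for \<tau>
  proof -
    have "x + (1 - \<tau>) *\<^sub>R (y - x) = y + \<tau> *\<^sub>R (x - y)" by (simp add: algebra_simps)
    moreover have "- (v \<bullet> (y - x)) = v \<bullet> (x - y)" for v by (simp add: inner_diff_right)
    ultimately show ?thesis by simp
  qed
  ultimately show ?thesis unfolding segment_integral_def[of u y x] by (simp add: integral_unique)
qed

text \<open>
For \<open>t \<ge> M\<close> the level set is empty, and for \<open>t < M\<close> one has \<open>t\<^bsup>-q\<^esup> \<le> M\<^bsup>p-q\<^esup> t\<^bsup>-p\<^esup>\<close>.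
\<close>

lemma weak_Lp_of_distribution_bound:
  fixes f :: "real^'n \<Rightarrow> 'b::euclidean_space"
  assumes f: "continuous_on UNIV f" and M: "\<And>x. norm (f x) \<le> M" and K: "K \<ge> 0"
    and K_bd: "\<And>t. t > 0 \<Longrightarrow> emeasure lebesgue {x. t < norm (f x)} \<le> ennreal (K * t powr (- q))"
    and p: "q \<le> p" "0 < p"
  shows "weak_Lp p f"
proof -
  have [measurable]: "f \<in> borel_measurable borel" using f by (rule borel_measurable_continuous_onI)
  define A where "A = (K * max M 0 powr (p - q)) powr (1 / p)"
  have "f \<in> borel_measurable lebesgue"
    by (rule measurable_completion) measurable
  moreover have "0 \<le> A" by (simp add: A_def)
  moreover have "emeasure lebesgue {x. t < norm (f x)} \<le> ennreal ((A / t) powr p)" if t: "t > 0" for t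
  proof (cases "t < M")
    case True
    have "t powr (p - q) \<le> max M 0 powr (p - q)" using True t p by (intro powr_mono2) auto
    moreover have "t powr (- q) = t powr (p - q) * t powr (- p)" by (simp flip: powr_add)
    ultimately have "K * t powr (- q) \<le> K * (max M 0 powr (p - q) * t powr (- p))"
      using K by (simp add: mult_left_mono mult_right_mono)
    also have "\<dots> = A powr p * t powr (- p)" using K p by (simp add: A_def powr_powr)
    also have "\<dots> = (A / t) powr p" using t by (simp add: A_def powr_divide powr_minus_divide)
    finally have "ennreal (K * t powr (- q)) \<le> ennreal ((A / t) powr p)" by (rule ennreal_leI)
    with K_bd[OF t] show ?thesis by (rule order_trans)
  next
    case False
    have "{x. t < norm (f x)} = {}"
    proof (rule equals0I)
      fix x assume "x \<in> {x. t < norm (f x)}"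
      then show False using M[of x] False by simp
    qed
    then show ?thesis by simp
  qed
  ultimately show ?thesis unfolding weak_Lp_def by blast
qed

lemma continuous_vanishing_at_infinity_bounded:
  fixes f :: "'a::euclidean_space \<Rightarrow> 'b::real_normed_vector"
  assumes "continuous_on UNIV f" "(f \<longlongrightarrow> 0) at_infinity"
  obtains M where "\<And>x. norm (f x) \<le> M"
proof -
  have "\<forall>\<^sub>F x in at_infinity. norm (f x) < 1" using assms(2) tendstoD[of f 0 at_infinity 1] by simp
  then obtain b where b: "\<And>x. b \<le> norm x \<Longrightarrow> norm (f x) < 1" unfolding eventually_at_infinity by blast
  have "compact (f ` cball 0 b)" by (intro compact_continuous_image continuous_on_subset[OF assms(1)]) auto
  then obtain B where B: "\<And>x. x \<in> cball 0 b \<Longrightarrow> norm (f x) \<le> B"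
    by (meson bounded_iff compact_imp_bounded imageI)
  have "norm (f x) \<le> max 1 B" for x
    using b[of x] B[of x] by (cases "b \<le> norm x") (auto simp: max_def)
  then show thesis using that by blast
qed

lemma D_solution_steady_flow:
  assumes u: "D_solution u" and "C > 0" "0 < \<beta>" "\<beta> < 1"
    and line: "\<forall>x0 x. segment_integral u x0 x \<le> C * norm (x - x0) powr \<beta>"
  obtains p where "steady_flow (\<lambda>i x. u x $ i) (\<lambda>j i x. partial_deriv j u x $ i)
      (\<lambda>j i x. partial_deriv j (partial_deriv j u) x $ i) p (\<lambda>i. partial_deriv i p) C \<beta>"
proof -
  obtain p where p: "smooth p" "\<And>x. - laplacian u x + convection u x + gradient p x = 0"
    and su: "smooth u" and div: "\<And>x. divergence u x = 0"
    and fin: "(\<integral>\<^sup>+ x. ennreal (grad_norm_sq u x) \<partial>lborel) < \<infinity>"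
    using u unfolding D_solution_def by blast
  note U2 = smooth_C2[OF su] and P2 = smooth_C2[OF p(1)]
  have cu: "continuous_on UNIV u" by (rule differentiable_everywhere_continuous[OF U2(1)])
  have cDu: "continuous_on UNIV (partial_deriv j u)" for j by (rule differentiable_everywhere_continuous[OF U2(2)])
  have comp: "continuous_on UNIV f \<Longrightarrow> continuous_on UNIV (\<lambda>x. f x $ i)" for f :: "real^3 \<Rightarrow> real^3" and i
    by (intro continuous_intros)
  show thesis
  proof (rule that[of p], unfold_locales)
    fix i j :: 3 and x
    show "continuous_on UNIV (\<lambda>x. u x $ i)" by (rule comp[OF cu])
    show "continuous_on UNIV (\<lambda>x. partial_deriv j u x $ i)" by (rule comp[OF cDu])
    show "continuous_on UNIV (\<lambda>x. partial_deriv j (partial_deriv j u) x $ i)" by (rule comp[OF U2(3)])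
    show "continuous_on UNIV p" by (rule differentiable_everywhere_continuous[OF P2(1)])
    show "continuous_on UNIV (partial_deriv i p)" by (rule differentiable_everywhere_continuous[OF P2(2)])
    show "has_pd j (\<lambda>x. u x $ i) (\<lambda>x. partial_deriv j u x $ i)" by (rule has_pd_component[OF U2(1)])
    show "has_pd j (\<lambda>x. partial_deriv j u x $ i) (\<lambda>x. partial_deriv j (partial_deriv j u) x $ i)"
      by (rule has_pd_component[OF U2(2)])
    show "has_pd i p (partial_deriv i p)" by (rule has_pd_partial_deriv[OF P2(1)])
    have "(- laplacian u x + convection u x + gradient p x) $ i = 0" by (simp only: p(2) zero_index)
    then show "partial_deriv i p x = (\<Sum>j\<in>UNIV. partial_deriv j (partial_deriv j u) x $ i)
        - (\<Sum>j\<in>UNIV. u x $ j * partial_deriv j u x $ i)"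
      by (simp add: laplacian_def convection_def gradient_def)
    show "(\<Sum>i\<in>UNIV. partial_deriv i u x $ i) = 0" using div unfolding divergence_def .
    show "integrable lborel (\<lambda>x. (partial_deriv j u x $ i)\<^sup>2)"
    proof (rule integrableI_bounded)
      show "(\<lambda>x. (partial_deriv j u x $ i)\<^sup>2) \<in> borel_measurable lborel"
        using borel_measurable_continuous_onI[OF continuous_on_power[OF comp[OF cDu]]] by simp
      have "(partial_deriv j u x $ i)\<^sup>2 \<le> grad_norm_sq u x" for x
      proof -
        have "(partial_deriv j u x $ i)\<^sup>2 \<le> (\<Sum>i\<in>UNIV. (partial_deriv j u x $ i)\<^sup>2)" by (rule member_le_sum) auto
        also have "\<dots> \<le> grad_norm_sq u x" unfolding grad_norm_sq_def
          by (rule member_le_sum[of j UNIV "\<lambda>j. \<Sum>i\<in>UNIV. (partial_deriv j u x $ i)\<^sup>2"]) (auto intro: sum_nonneg)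
        finally show ?thesis .
      qed
      then have "(\<integral>\<^sup>+ x. ennreal (norm ((partial_deriv j u x $ i)\<^sup>2)) \<partial>lborel) \<le> (\<integral>\<^sup>+ x. ennreal (grad_norm_sq u x) \<partial>lborel)"
        by (intro nn_integral_mono ennreal_leI) simp
      then show "(\<integral>\<^sup>+ x. ennreal (norm ((partial_deriv j u x $ i)\<^sup>2)) \<partial>lborel) < \<infinity>" using fin by (rule le_less_trans)
    qed
  next
    fix i :: 3 and x a b
    have n: "norm (upd i s x - upd i t x) = \<bar>s - t\<bar>" for s t
    proof -
      have "upd i s x - upd i t x = (s - t) *\<^sub>R axis i 1" by (simp add: vec_eq_iff upd_nth axis_def)
      then show ?thesis by simp
    qed
    have "segment_integral u (upd i a x) (upd i b x) \<le> C * \<bar>b - a\<bar> powr \<beta>" using line n by metis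
    moreover have "segment_integral u (upd i b x) (upd i a x) \<le> C * \<bar>b - a\<bar> powr \<beta>" using line n by (metis abs_minus_commute)
    then have "- segment_integral u (upd i a x) (upd i b x) \<le> C * \<bar>b - a\<bar> powr \<beta>"
      unfolding segment_integral_swap[OF cu, of "upd i b x"] .
    ultimately show "\<bar>prim (\<lambda>s. u (upd i s x) $ i) a b\<bar> \<le> C * \<bar>b - a\<bar> powr \<beta>"
      unfolding prim_line_eq_segment_integral by (intro abs_leI)
  qed (use assms in auto)
qed

lemma zero_gradient_vanishing_at_infinity:
  fixes f :: "real^3 \<Rightarrow> real^3"
  assumes "\<And>x. f differentiable (at x)" "\<And>i x. partial_deriv i f x = 0" "(f \<longlongrightarrow> 0) at_infinity"
  shows "f x = 0"
proof -
  have "(f has_derivative (\<lambda>h. 0)) (at y within UNIV)" for y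
  proof -
    let ?F = "frechet_derivative f (at y)"
    have lin: "linear ?F" by (rule linear_frechet_derivative[OF assms(1)])
    have "?F h = 0" for h
    proof -
      have "?F h = ?F (\<Sum>i\<in>UNIV. (h $ i) *\<^sub>R axis i 1)" by (simp add: basis_expansion flip: scalar_mult_eq_scaleR)
      also have "\<dots> = (\<Sum>i\<in>UNIV. (h $ i) *\<^sub>R partial_deriv i f y)"
        by (simp add: linear_sum[OF lin] linear_cmul[OF lin] partial_deriv_def)
      finally show ?thesis using assms(2) by simp
    qed
    then have "?F = (\<lambda>h. 0)" by blast
    then show ?thesis using assms(1)[of y] by (simp add: frechet_derivative_works)
  qed
  then obtain c where c: "\<And>y. f y = c"
    using has_derivative_zero_constant[of UNIV f] by auto
  then have "f = (\<lambda>y. c)" by blast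
  then have "((\<lambda>y :: real^3. c) \<longlongrightarrow> 0) at_infinity" using assms(3) by simp
  then have "c = 0" by (simp add: tendsto_const_iff trivial_limit_at_infinity)
  then show ?thesis using c by simp
qed

section \<open>Decay and the Liouville property\<close>

theorem theorem1p2:
  fixes u :: "real^3 \<Rightarrow> real^3" and C \<beta> :: real
  assumes "D_solution u"
    and "C > 0" and "0 < \<beta>" and "\<beta> < 1"
    and "\<forall>x0 x. segment_integral u x0 x \<le> C * norm (x - x0) powr \<beta>"
  shows "(\<forall>p::real. p > (4 - 34 * \<beta> / 29) / (1 - \<beta>) \<longrightarrow> weak_Lp p u) \<and>
         (\<beta> < 29 / 193 \<longrightarrow> (\<forall>x. u x = 0))"
proof -
  obtain \<pi> where flow: "steady_flow (\<lambda>i x. u x $ i) (\<lambda>j i x. partial_deriv j u x $ i)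
      (\<lambda>j i x. partial_deriv j (partial_deriv j u) x $ i) \<pi> (\<lambda>i. partial_deriv i \<pi>) C \<beta>"
    using D_solution_steady_flow[OF assms] by blast
  interpret steady_flow "\<lambda>i x. u x $ i" "\<lambda>j i x. partial_deriv j u x $ i"
      "\<lambda>j i x. partial_deriv j (partial_deriv j u) x $ i" \<pi> "\<lambda>i. partial_deriv i \<pi>" C \<beta>
    by (rule flow)
  have "smooth u" and lim: "(u \<longlongrightarrow> 0) at_infinity" using assms(1) unfolding D_solution_def by auto
  note du = smooth_C2(1)[OF \<open>smooth u\<close>]
  have cu: "continuous_on UNIV u" by (rule differentiable_everywhere_continuous[OF du])
  obtain M where M: "\<And>x. norm (u x) \<le> M" using continuous_vanishing_at_infinity_bounded[OF cu lim] by blast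
  have "weak_Lp p u" if p: "p > (4 - 34 * \<beta> / 29) / (1 - \<beta>)" for p
  proof -
    define q where "q = (4 - 2 * \<beta>) / (1 - \<beta>)"
    have "q \<le> (4 - 34 * \<beta> / 29) / (1 - \<beta>)"
      unfolding q_def using assms(3,4) by (intro divide_right_mono) auto
    then have "q \<le> p" using p by simp
    have "0 < q" unfolding q_def using assms(4) by (intro divide_pos_pos) auto
    obtain K where K: "K \<ge> 0"
      "\<And>t. t > 0 \<Longrightarrow> emeasure lborel {x. t < (\<Sum>i\<in>UNIV. \<bar>u x $ i\<bar>)} \<le> ennreal (K * t powr (- q))"
      using weak_estimate unfolding q_def by blast
    have "emeasure lebesgue {x. t < norm (u x)} \<le> ennreal (K * t powr (- q))" if "t > 0" for t
    proof -
      have o: "open {x. t < norm (u x)}" "open {x. t < (\<Sum>i\<in>UNIV. \<bar>u x $ i\<bar>)}"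
        by (intro open_Collect_less continuous_intros cu)+
      have "emeasure lebesgue {x. t < norm (u x)} = emeasure lborel {x. t < norm (u x)}"
        using o by (simp add: main_part_sets)
      also have "\<dots> \<le> emeasure lborel {x. t < (\<Sum>i\<in>UNIV. \<bar>u x $ i\<bar>)}"
        using o norm_le_l1_cart[of "u _"] by (intro emeasure_mono) (auto intro: less_le_trans)
      also have "\<dots> \<le> ennreal (K * t powr (- q))" by (rule K(2)[OF that])
      finally show ?thesis .
    qed
    then show ?thesis
      using \<open>q \<le> p\<close> \<open>0 < q\<close> by (intro weak_Lp_of_distribution_bound[OF cu M K(1)]) auto
  qed
  moreover have "u x = 0" if \<beta>: "\<beta> < 29 / 193" for x
  proof (rule zero_gradient_vanishing_at_infinity[OF du _ lim])
    \<comment> \<open>this is \<open>\<alpha> < 1 - \<beta>\<close> after multiplying out; \<open>6 * 29 / 193 < 1\<close>\<close>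
    have "3 < (1 - \<beta>) * (4 - 2 * \<beta>)"
    proof -
      have "(1 - \<beta>) * (4 - 2 * \<beta>) = 4 - 6 * \<beta> + 2 * \<beta>\<^sup>2" by (simp add: algebra_simps power2_eq_square)
      then show ?thesis using \<beta> zero_le_power2[of \<beta>] by linarith
    qed
    then have "\<alpha> < 1 - \<beta>" unfolding \<alpha>_def using assms(4) by (subst pos_divide_less_eq) auto
    then have "\<alpha> + \<beta> < 1" by simp
    from gradient_vanishes[OF this]
    show "partial_deriv i u y = 0" for i y by (simp add: vec_eq_iff)
  qed
  ultimately show ?thesis by blast
qed

end
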